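(* Let $\ell\ge 2$ be an integer and let $\mathcal B_\ell=\{\ker(x_i-x_j)\mid 1\le i<j\le \ell\}$ be the braid arrangement in $\mathbb C^\ell$. Then, for every integer $m\ge 1$, the multiarrangement $(\mathcal B_\ell,m)$ (constant multiplicity $m$) with defining polynomial $$Q(\mathcal B_\ell,m)=\prod_{1\le i<j\le \ell}(x_i-x_j)^m$$ is inductively free. In particular, for the irreducible Coxeter arrangement $\mathcal A_{\ell-1}$ of type $A_{\ell-1}$ (in the $(\ell-1)$-dimensional space $\mathbb C^\ell/\mathbb C(1,\dots,1)$), the multiarrangement $(\mathcal A_{\ell-1},m)$ with constant multiplicity $m$ is inductively free, with multiset of exponents (having $\ell-1$ elements) $$\exp(\mathcal A_{\ell-1},m)=\left\{\tfrac{m\ell}{2},\ldots,\tfrac{m\ell}{2}\right\}$$ if $m$ is even, and $$\exp(\mathcal A_{\ell-1},m)=\left\{\tfrac{(m-1)\ell}{2}+1,\tfrac{(m-1)\ell}{2}+2,\ldots,\tfrac{(m-1)\ell}{2}+\ell-1\right\}$$ if $m$ is odd.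
   Context: **Type $A$ arrangements.** The forms $x_i-x_j$ on $\mathbb C^\ell$ vanish on the line $\mathbb C(1,\dots,1)$, hence are linear forms on the quotient $\mathbb C^\ell/\mathbb C(1,\dots,1)$, of dimension $\ell-1$. The irreducible Coxeter arrangement $\mathcal A_{\ell-1}$ of type $A_{\ell-1}$ is the arrangement of the hyperplanes $\ker(x_i-x_j)$, $1\le i<j\le\ell$, in this quotient. The braid arrangement $\mathcal B_\ell$ in $\mathbb C^\ell$ is the product of $\mathcal A_{\ell-1}$ with the empty arrangement in a $1$-dimensional space. **Multiarrangements.** Let $V$ be an $n$-dimensional vector space over a field $\mathbb K$ (here $\mathbb K=\mathbb C$), and let $S=S(V^* )\cong\mathbb K[y_1,\dots,y_n]$. A multiarrangement $(\mathcal A,\nu)$ in $V$ is a finite set $\mathcal A$ of linear hyperplanes $H=\ker\alpha_H$ ($\alpha_H\in V^*$) together with a multiplicity $\nu:\mathcal A\to\mathbb Z_{\ge 0}$. It is regarded as the multiset in which $H$ occurs $\nu(H)$ times; hyperplanes of multiplicity $0$ are discarded. $(\mathcal A,m)$ denotes $(\mathcal A,\nu)$ with $\nu(H)=m$ for all $H$. Its defining polynomial is $Q(\mathcal A,\nu)=\prod_{H}\alpha_H^{\nu(H)}$. $\Phi_n$ denotes the empty arrangement in an $n$-dimensional space. **Freeness and exponents.** $\mathrm{Der}(S)$ is the $S$-module of $\mathbb K$-derivations of $S$. A derivation $\theta=\sum f_i\,\partial/\partial y_i$ is homogeneous of polynomial degree $\mathrm{pdeg}\,\theta=p$ if each $f_i$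 is $0$ or homogeneous of degree $p$. Put $$D(\mathcal A,\nu)=\{\theta\in\mathrm{Der}(S)\mid\theta(\alpha_H)\in\alpha_H^{\nu(H)}S\text{ for all }H\in\mathcal A\}.$$ $(\mathcal A,\nu)$ is free if $D(\mathcal A,\nu)$ is a free $S$-module; it then has a homogeneous basis $\theta_1,\dots,\theta_n$, and the well-defined multiset $\{\mathrm{pdeg}\,\theta_1,\dots,\mathrm{pdeg}\,\theta_n\}$ is denoted $\exp(\mathcal A,\nu)$. In particular $\Phi_n$ is free with exponents $0$ ($n$ times). **Deletion and restriction.** Fix $H_0=\ker\alpha_0\in\mathcal A$ with $\nu(H_0)\ge1$. The deletion $(\mathcal A',\nu')$ is obtained by lowering the multiplicity of $H_0$ by one (removing $H_0$ if $\nu(H_0)=1$). The restriction is $(\mathcal A'',\nu^* )$, an arrangement in $H_0$ with $\mathcal A''=\{H\cap H_0\mid H\in\mathcal A\setminus\{H_0\}\}$ and with the Euler multiplicity $\nu^*$ defined as follows. For $Y\in\mathcal A''$ let $\mathcal A_Y=\{H\in\mathcal A\mid Y\subseteq H\}$ and $\nu_Y=\nu|_{\mathcal A_Y}$. Choose coordinates with $Y=\{y_1=y_2=0\}$. Then $D(\mathcal A_Y,\nu_Y)$ is free and (by Abe–Terao–Wakefield) has a homogeneous basis $\theta_Y,\psi_Y,\partial/\partial y_3,\dots,\partial/\partial y_n$ with $\theta_Y\notin\alpha_0\mathrm{Der}(S)$ and $\psi_Y\in\alpha_0\mathrm{Der}(S)$. Set $\nu^*(Y)=\mathrm{pdeg}\,\theta_Y$.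 **Inductive freeness.** The class of inductively free multiarrangements is the smallest class such that (i) it contains $\Phi_n$ for every $n\ge0$; (ii) $(\mathcal A,\nu)$ belongs to it whenever there is $H_0\in\mathcal A$ such that $(\mathcal A',\nu')$ and $(\mathcal A'',\nu^* )$ (with respect to $H_0$) both belong to it and $\exp(\mathcal A'',\nu^* )\subseteq\exp(\mathcal A',\nu')$ as multisets. (Members of this class are free, by the Addition-Deletion Theorem of Abe–Terao–Wakefield, so exponents make sense.) *)

theory Defs
  imports "HOL-Analysis.Cartesian_Space" "HOL-Library.Multiset"
begin

text \<open>
  All spaces are finite-dimensional linear subspaces \<open>V\<close> of an ambient complex vector space, so
  that the restriction of an arrangement in \<open>V\<close> to a hyperplane \<open>H\<close> of \<open>V\<close> is an arrangement
  in the subspace \<open>H\<close> of the same ambient space.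

  As \<open>\<complex>\<close> is infinite, the symmetric algebra \<open>S(V\<^sup>*)\<close> is the algebra of polynomial functions on
  \<open>V\<close>.  A function on \<open>V\<close> is represented by a function on the ambient space that is zero
  outside of \<open>V\<close>; likewise a derivation of \<open>S(V\<^sup>*)\<close> is zero outside of \<open>S(V\<^sup>*)\<close>.  Thus equality
  in HOL is equality of functions on \<open>V\<close> and of derivations.
\<close>

locale complex_space = vector_space scale
  for scale :: "complex \<Rightarrow> 'v::ab_group_add \<Rightarrow> 'v" (infixr "*\<^sub>V" 75)
begin

definition fd_subspace :: "'v set \<Rightarrow> bool" where
  "fd_subspace V \<longleftrightarrow> (\<exists>B. finite B \<and> span B = V)"

definition dual :: "'v set \<Rightarrow> ('v \<Rightarrow> complex) set" where
  "dual V = {\<alpha>. (\<forall>x\<in>V. \<forall>y\<in>V. \<alpha> (x + y) = \<alpha> x + \<alpha> y) \<and>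
                (\<forall>c. \<forall>x\<in>V. \<alpha> (c *\<^sub>V x) = c * \<alpha> x) \<and>
                (\<forall>x. x \<notin> V \<longrightarrow> \<alpha> x = 0)}"

definition const_on :: "'v set \<Rightarrow> complex \<Rightarrow> 'v \<Rightarrow> complex" where
  "const_on V c = (\<lambda>x. if x \<in> V then c else 0)"

definition ker_on :: "'v set \<Rightarrow> ('v \<Rightarrow> complex) \<Rightarrow> 'v set" where
  "ker_on V \<alpha> = {x \<in> V. \<alpha> x = 0}"

definition hyperplane :: "'v set \<Rightarrow> 'v set \<Rightarrow> bool" where
  "hyperplane V H \<longleftrightarrow> (\<exists>\<alpha>\<in>dual V. \<alpha> \<noteq> (\<lambda>x. 0) \<and> H = ker_on V \<alpha>)"


subsection \<open>The symmetric algebra and its derivations\<close>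

inductive_set Sym :: "'v set \<Rightarrow> ('v \<Rightarrow> complex) set" for V :: "'v set" where
  const: "const_on V c \<in> Sym V"
| form: "\<alpha> \<in> dual V \<Longrightarrow> \<alpha> \<in> Sym V"
| add: "f \<in> Sym V \<Longrightarrow> g \<in> Sym V \<Longrightarrow> (\<lambda>x. f x + g x) \<in> Sym V"
| mult: "f \<in> Sym V \<Longrightarrow> g \<in> Sym V \<Longrightarrow> (\<lambda>x. f x * g x) \<in> Sym V"

text \<open>The graded pieces of \<open>S(V\<^sup>*)\<close>; each of them contains the zero polynomial.\<close>

inductive homogeneous :: "'v set \<Rightarrow> nat \<Rightarrow> ('v \<Rightarrow> complex) \<Rightarrow> bool" for V :: "'v set" where
  const: "homogeneous V 0 (const_on V c)"
| mult: "\<alpha> \<in> dual V \<Longrightarrow> homogeneous V p f \<Longrightarrow> homogeneous V (Suc p) (\<lambda>x. \<alpha> x * f x)"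
| add: "homogeneous V p f \<Longrightarrow> homogeneous V p g \<Longrightarrow> homogeneous V p (\<lambda>x. f x + g x)"

definition Der :: "'v set \<Rightarrow> (('v \<Rightarrow> complex) \<Rightarrow> ('v \<Rightarrow> complex)) set" where
  "Der V = {\<theta>.
     (\<forall>f\<in>Sym V. \<theta> f \<in> Sym V) \<and>
     (\<forall>f\<in>Sym V. \<forall>g\<in>Sym V. \<theta> (\<lambda>x. f x + g x) = (\<lambda>x. \<theta> f x + \<theta> g x)) \<and>
     (\<forall>c. \<forall>f\<in>Sym V. \<theta> (\<lambda>x. c * f x) = (\<lambda>x. c * \<theta> f x)) \<and>
     (\<forall>f\<in>Sym V. \<forall>g\<in>Sym V. \<theta> (\<lambda>x. f x * g x) = (\<lambda>x. \<theta> f x * g x + f x * \<theta> g x)) \<and>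
     (\<forall>f. f \<notin> Sym V \<longrightarrow> \<theta> f = (\<lambda>x. 0))}"

text \<open>
  If \<open>\<theta> = \<Sum> f\<^sub>i \<partial>/\<partial>y\<^sub>i\<close> then \<open>f\<^sub>i = \<theta> y\<^sub>i\<close>, and the values of \<open>\<theta>\<close> on \<open>V\<^sup>*\<close> are the linear
  combinations of the \<open>f\<^sub>i\<close>; so the following does not depend on coordinates.
\<close>

definition pdeg :: "'v set \<Rightarrow> (('v \<Rightarrow> complex) \<Rightarrow> ('v \<Rightarrow> complex)) \<Rightarrow> nat \<Rightarrow> bool" where
  "pdeg V \<theta> p \<longleftrightarrow> \<theta> \<in> Der V \<and> (\<forall>\<alpha>\<in>dual V. homogeneous V p (\<theta> \<alpha>))"

text \<open>\<open>b 1, \<dots>, b r\<close> is a basis of the \<open>S(V\<^sup>*)\<close>-module \<open>D \<subseteq> Der V\<close>.\<close>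

definition module_basis ::
  "'v set \<Rightarrow> (('v \<Rightarrow> complex) \<Rightarrow> ('v \<Rightarrow> complex)) set \<Rightarrow> nat \<Rightarrow>
   (nat \<Rightarrow> ('v \<Rightarrow> complex) \<Rightarrow> ('v \<Rightarrow> complex)) \<Rightarrow> bool" where
  "module_basis V D r b \<longleftrightarrow>
     (\<forall>i\<in>{1..r}. b i \<in> D) \<and>
     (\<forall>\<theta>\<in>D. \<exists>!c. (\<forall>i\<in>{1..r}. c i \<in> Sym V) \<and> (\<forall>i. i \<notin> {1..r} \<longrightarrow> c i = (\<lambda>x. 0)) \<and>
                  \<theta> = (\<lambda>f x. \<Sum>i=1..r. c i x * b i f x))"


subsection \<open>Multiarrangements\<close>

text \<open>
  A multiarrangement \<open>(\<A>, \<nu>)\<close> is the multiset \<open>M\<close> of hyperplanes with \<open>\<nu> = count M\<close>, whence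
  \<open>\<A> = set_mset M\<close> consists of the hyperplanes of positive multiplicity.
\<close>

definition multiarrangement :: "'v set \<Rightarrow> 'v set multiset \<Rightarrow> bool" where
  "multiarrangement V M \<longleftrightarrow> fd_subspace V \<and> (\<forall>H\<in>#M. hyperplane V H)"

text \<open>The defining polynomial is determined up to the choice of the forms \<open>\<alpha> H\<close>.\<close>

definition defining_polynomial :: "'v set \<Rightarrow> 'v set multiset \<Rightarrow> ('v \<Rightarrow> complex) \<Rightarrow> bool" where
  "defining_polynomial V M Q \<longleftrightarrow>
     (\<exists>\<alpha>. (\<forall>H\<in>#M. \<alpha> H \<in> dual V \<and> ker_on V (\<alpha> H) = H) \<and>
          Q = (\<lambda>x. if x \<in> V then \<Prod>H\<in>set_mset M. \<alpha> H x ^ count M H else 0))"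

definition log_der ::
  "'v set \<Rightarrow> 'v set multiset \<Rightarrow> (('v \<Rightarrow> complex) \<Rightarrow> ('v \<Rightarrow> complex)) set" where
  "log_der V M = {\<theta> \<in> Der V. \<forall>H\<in>#M. \<forall>\<alpha>\<in>dual V. ker_on V \<alpha> = H \<longrightarrow>
                    (\<exists>g\<in>Sym V. \<theta> \<alpha> = (\<lambda>x. \<alpha> x ^ count M H * g x))}"

text \<open>
  \<open>(\<A>, \<nu>)\<close> is free and \<open>E\<close> is its multiset of exponents.  (\<open>log_der V M\<close> is finitely generated
  over the Noetherian ring \<open>S(V\<^sup>*)\<close>, so that finite bases suffice, and \<open>E\<close> is unique.)
\<close>

definition has_exponents :: "'v set \<Rightarrow> 'v set multiset \<Rightarrow> nat multiset \<Rightarrow> bool" where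
  "has_exponents V M E \<longleftrightarrow>
     (\<exists>r b d. module_basis V (log_der V M) r b \<and> (\<forall>i\<in>{1..r}. pdeg V (b i) (d i)) \<and>
              E = image_mset d (mset_set {1..r}))"


subsection \<open>Restriction\<close>

text \<open>\<open>y 1, \<dots>, y n\<close> is a basis of the dual space of \<open>V\<close>.\<close>

definition coordinates :: "'v set \<Rightarrow> nat \<Rightarrow> (nat \<Rightarrow> 'v \<Rightarrow> complex) \<Rightarrow> bool" where
  "coordinates V n y \<longleftrightarrow>
     (\<forall>i\<in>{1..n}. y i \<in> dual V) \<and>
     (\<forall>\<alpha>\<in>dual V. \<exists>!c. (\<forall>i. i \<notin> {1..n} \<longrightarrow> c i = 0) \<and> \<alpha> = (\<lambda>x. \<Sum>i=1..n. c i * y i x))"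

definition is_partial ::
  "'v set \<Rightarrow> nat \<Rightarrow> (nat \<Rightarrow> 'v \<Rightarrow> complex) \<Rightarrow> nat \<Rightarrow>
   (('v \<Rightarrow> complex) \<Rightarrow> ('v \<Rightarrow> complex)) \<Rightarrow> bool" where
  "is_partial V n y i \<delta> \<longleftrightarrow>
     \<delta> \<in> Der V \<and> (\<forall>j\<in>{1..n}. \<delta> (y j) = const_on V (if j = i then 1 else 0))"

text \<open>The submodule \<open>\<alpha>\<^sub>H Der V\<close>, where \<open>H = ker \<alpha>\<^sub>H\<close>.\<close>

definition form_times_Der ::
  "'v set \<Rightarrow> 'v set \<Rightarrow> (('v \<Rightarrow> complex) \<Rightarrow> ('v \<Rightarrow> complex)) set" where
  "form_times_Der V H =
     {(\<lambda>f x. \<alpha> x * \<delta> f x) | \<alpha> \<delta>. \<alpha> \<in> dual V \<and> ker_on V \<alpha> = H \<and> \<delta> \<in> Der V}"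

text \<open>
  \<open>\<nu>\<^sup>*(Y) = d\<close> for the restriction of \<open>M\<close> to \<open>H\<^sub>0\<close>, with \<open>\<theta>\<^sub>Y = b 1\<close> and \<open>\<psi>\<^sub>Y = b 2\<close>.
\<close>

definition euler_multiplicity ::
  "'v set \<Rightarrow> 'v set multiset \<Rightarrow> 'v set \<Rightarrow> 'v set \<Rightarrow> nat \<Rightarrow> bool" where
  "euler_multiplicity V M H\<^sub>0 Y d \<longleftrightarrow>
     (\<exists>n y b e. 2 \<le> n \<and> coordinates V n y \<and> Y = {x \<in> V. y 1 x = 0 \<and> y 2 x = 0} \<and>
        module_basis V (log_der V (filter_mset (\<lambda>H. Y \<subseteq> H) M)) n b \<and>
        pdeg V (b 1) d \<and> b 1 \<notin> form_times_Der V H\<^sub>0 \<and>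
        pdeg V (b 2) e \<and> b 2 \<in> form_times_Der V H\<^sub>0 \<and>
        (\<forall>i\<in>{3..n}. is_partial V n y i (b i)))"

text \<open>
  By Abe, Terao and Wakefield \<open>\<nu>\<^sup>*\<close>, and hence the restriction \<open>M''\<close>, exists and is unique.
\<close>

definition euler_restriction ::
  "'v set \<Rightarrow> 'v set multiset \<Rightarrow> 'v set \<Rightarrow> 'v set multiset \<Rightarrow> bool" where
  "euler_restriction V M H\<^sub>0 M'' \<longleftrightarrow>
     (let \<A>'' = {H \<inter> H\<^sub>0 | H. H \<in># M \<and> H \<noteq> H\<^sub>0} in
      \<exists>\<nu>. (\<forall>Y\<in>\<A>''. euler_multiplicity V M H\<^sub>0 Y (\<nu> Y)) \<and>
          M'' = (\<Sum>Y\<in>\<A>''. replicate_mset (\<nu> Y) Y))"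


subsection \<open>Inductive freeness\<close>

inductive inductively_free :: "'v set \<Rightarrow> 'v set multiset \<Rightarrow> bool" where
  empty: "fd_subspace V \<Longrightarrow> inductively_free V {#}"
| add: "\<lbrakk>multiarrangement V M; H\<^sub>0 \<in># M;
         inductively_free V (M - {#H\<^sub>0#});
         euler_restriction V M H\<^sub>0 M''; inductively_free H\<^sub>0 M'';
         has_exponents V (M - {#H\<^sub>0#}) E'; has_exponents H\<^sub>0 M'' E''; E'' \<subseteq># E'\<rbrakk>
        \<Longrightarrow> inductively_free V M"

end

text \<open>The multiarrangement \<open>(\<A>, m)\<close> with constant multiplicity, for finite \<open>\<A>\<close>.\<close>

definition const_mult :: "'v set set \<Rightarrow> nat \<Rightarrow> 'v set multiset" where
  "const_mult \<A> m = (\<Sum>H\<in>\<A>. replicate_mset m H)"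


subsection \<open>The arrangements of type A\<close>

text \<open>
  Coordinates are indexed by a finite linearly ordered type \<open>'n\<close>, which plays the role of
  \<open>{1, \<dots>, \<ell>}\<close> with \<open>\<ell> = CARD('n)\<close>.
\<close>

global_interpretation cvec: complex_space "(*s) :: complex \<Rightarrow> complex ^ 'n \<Rightarrow> complex ^ 'n"
  by (rule complex_space.intro) (rule vec.vector_space_axioms)

definition braid :: "(complex ^ 'n::{finite,linorder}) set set" where
  "braid = {{x. x $ i - x $ j = 0} | i j. i < j}"

definition diag_rel :: "complex ^ 'n \<Rightarrow> complex ^ 'n \<Rightarrow> bool" where
  "diag_rel x y \<longleftrightarrow> (\<exists>c. x - y = c *s 1)"

lemma diag_rel_iff: "diag_rel x y \<longleftrightarrow> (\<exists>c. \<forall>i. x $ i = y $ i + c)"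
  by (auto simp: diag_rel_def vec_eq_iff algebra_simps)

text \<open>The quotient of \<open>\<complex>\<^sup>\<ell>\<close> by the line spanned by \<open>1 = (1, \<dots>, 1)\<close>.\<close>

quotient_type 'n diag_quotient = "complex ^ 'n" / diag_rel
proof (rule equivpI)
  show "reflp (diag_rel :: complex ^ 'n \<Rightarrow> _)"
    by (auto simp: reflp_def diag_rel_iff intro: exI[of _ 0])
  show "symp (diag_rel :: complex ^ 'n \<Rightarrow> _)"
  proof (rule sympI)
    fix x y :: "complex ^ 'n"
    assume "diag_rel x y"
    then obtain c where "\<forall>i. x $ i = y $ i + c" by (auto simp: diag_rel_iff)
    then have "\<forall>i. y $ i = x $ i + (- c)" by simp
    then show "diag_rel y x" unfolding diag_rel_iff by blast
  qed
  show "transp (diag_rel :: complex ^ 'n \<Rightarrow> _)"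
  proof (rule transpI)
    fix x y z :: "complex ^ 'n"
    assume "diag_rel x y" "diag_rel y z"
    then obtain c d where "\<forall>i. x $ i = y $ i + c" "\<forall>i. y $ i = z $ i + d"
      by (auto simp: diag_rel_iff)
    then have "\<forall>i. x $ i = z $ i + (d + c)" by simp
    then show "diag_rel x z" unfolding diag_rel_iff by blast
  qed
qed

instantiation diag_quotient :: (finite) ab_group_add
begin

lift_definition zero_diag_quotient :: "'a diag_quotient" is 0 .

lift_definition plus_diag_quotient :: "'a diag_quotient \<Rightarrow> 'a diag_quotient \<Rightarrow> 'a diag_quotient"
  is "(+)"
proof -
  fix x x' y y' :: "complex ^ 'a"
  assume "diag_rel x x'" "diag_rel y y'"
  then obtain c d where "\<forall>i. x $ i = x' $ i + c" "\<forall>i. y $ i = y' $ i + d"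
    by (auto simp: diag_rel_iff)
  then have "\<forall>i. (x + y) $ i = (x' + y') $ i + (c + d)" by simp
  then show "diag_rel (x + y) (x' + y')" unfolding diag_rel_iff by blast
qed

lift_definition uminus_diag_quotient :: "'a diag_quotient \<Rightarrow> 'a diag_quotient" is uminus
proof -
  fix x x' :: "complex ^ 'a"
  assume "diag_rel x x'"
  then obtain c where "\<forall>i. x $ i = x' $ i + c" by (auto simp: diag_rel_iff)
  then have "\<forall>i. (- x) $ i = (- x') $ i + (- c)" by simp
  then show "diag_rel (- x) (- x')" unfolding diag_rel_iff by blast
qed

definition minus_diag_quotient :: "'a diag_quotient \<Rightarrow> 'a diag_quotient \<Rightarrow> 'a diag_quotient" where
  "minus_diag_quotient x y = x + (- y)"

instance
proof
  fix a b c :: "'a diag_quotient"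
  show "a + b + c = a + (b + c)"
    by transfer (auto simp: diag_rel_iff intro: exI[of _ 0])
  show "a + b = b + a"
    by transfer (auto simp: diag_rel_iff intro: exI[of _ 0])
  show "0 + a = a"
    by transfer (auto simp: diag_rel_iff intro: exI[of _ 0])
  show "- a + a = 0"
    by transfer (auto simp: diag_rel_iff intro: exI[of _ 0])
  show "a - b = a + - b"
    by (rule minus_diag_quotient_def)
qed

end

lift_definition scale_diag :: "complex \<Rightarrow> 'n::finite diag_quotient \<Rightarrow> 'n diag_quotient" is "(*s)"
proof -
  fix a :: complex and x x' :: "complex ^ 'n"
  assume "diag_rel x x'"
  then obtain c where "\<forall>i. x $ i = x' $ i + c" by (auto simp: diag_rel_iff)
  then have "\<forall>i. (a *s x) $ i = (a *s x') $ i + a * c" by (simp add: algebra_simps)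
  then show "diag_rel (a *s x) (a *s x')" unfolding diag_rel_iff by blast
qed

global_interpretation cquot: complex_space "scale_diag :: complex \<Rightarrow> 'n::finite diag_quotient \<Rightarrow> _"
proof (unfold_locales, goal_cases)
  case 1 show ?case
    by transfer (auto simp: diag_rel_iff algebra_simps intro: exI[of _ 0])
next
  case 2 show ?case
    by transfer (auto simp: diag_rel_iff algebra_simps intro: exI[of _ 0])
next
  case 3 show ?case
    by transfer (auto simp: diag_rel_iff algebra_simps intro: exI[of _ 0])
next
  case 4 show ?case
    by transfer (auto simp: diag_rel_iff algebra_simps intro: exI[of _ 0])
qed

text \<open>The linear form on the quotient induced by \<open>x\<^sub>i - x\<^sub>j\<close>.\<close>

lift_definition diff_form :: "'n::finite \<Rightarrow> 'n \<Rightarrow> 'n diag_quotient \<Rightarrow> complex"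
  is "\<lambda>i j x. x $ i - x $ j"
  by (auto simp: diag_rel_iff)

definition coxeter_A :: "'n::{finite,linorder} diag_quotient set set" where
  "coxeter_A = {{v. diff_form i j v = 0} | i j. i < j}"

end

theory Submission
  imports Defs "HOL-Computational_Algebra.Polynomial"
begin

text \<open>
  More generally, the multiplicity \<open>\<nu>\<^sub>i\<^sub>j = n\<^sub>i + n\<^sub>j + [ij \<in> G]\<close> is inductively free for every chordal
  graph \<open>G\<close>, with exponents \<open>N + e\<close>, where \<open>N = \<Sum> n\<^sub>i\<close> and \<open>e\<close> runs through the numbers of earlier
  neighbours in an elimination order. Let the last vertex \<open>v\<close> be attached to a clique containing \<open>s\<close>.
  Deleting the edge \<open>vs\<close> leaves a chordal graph, and the Euler restriction to \<open>x\<^sub>v = x\<^sub>s\<close> belongs to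
  \<open>G - v\<close> with \<open>n\<^sub>s\<close> replaced by \<open>n\<^sub>v + n\<^sub>s\<close>. The integrals \<open>h\<^sub>i = \<integral> \<Prod>\<^sub>l (t - x\<^sub>l)\<^bsup>k l\<^esup> dt\<close> from \<open>0\<close> to \<open>x\<^sub>i\<close>
  define a derivation \<open>x\<^sub>i \<mapsto> h\<^sub>i\<close>, for which \<open>x\<^sub>i - x\<^sub>j\<close> is mapped to a multiple of
  \<open>(x\<^sub>i - x\<^sub>j)\<^bsup>k i + k j + 1\<^esup>\<close>. Such derivations give the local bases of rank two, hence the Euler
  multiplicities, and one of them has the degree of the exponent that increases when the edge is
  added, so that a basis can be exchanged. The empty graph and the complete graph with constant
  \<open>n\<close> give the constant multiplicities.
\<close>

section \<open>Integration of polynomials over the unit interval\<close>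

text \<open>Hyperplanes enter one at a time, so the constant multiplicities \<open>m\<close> and
  \<open>m + 1\<close> are joined only through non-constant ones, and the induction needs a class
  closed under deletion and Euler restriction. Chordality provides it: \<open>v\<close> is attached
  to a clique, so in every triangle \<open>v, s, j\<close> the edge \<open>vj\<close> forces
  \<open>sj\<close>. The Euler multiplicity then equals n_v + n_s + n_j + [sj in G], which no longer
  mentions \<open>vj\<close>. Since n_v is moved to \<open>s\<close>, the restriction has the same
  total N, and its exponents are those of the deletion with one entry N + |J| left out, where J
  consists of the neighbours of \<open>v\<close> other than \<open>s\<close>. Freeness and exponents
  are carried along by an explicit exchange of basis elements. The potential for the vertex
  \<open>v\<close> has k_v = n_v - 1 and k_l = n_l + [l in J] otherwise, hence degree N + |J|. Its
  value on x_v - x_s, divided by (x_v - x_s)^(n_v + n_s), restricts to a nonzero multiple of a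
  polynomial \<open>B\<close> that divides all restrictions obtained in this way. For n_v = 0 a
  product replaces the integral.\<close>

definition unit_integral :: "complex poly \<Rightarrow> complex" where
  "unit_integral p = (\<Sum>k\<le>degree p. coeff p k / of_nat (Suc k))"

lemma unit_integral_eq:
  assumes "degree p \<le> n"
  shows "unit_integral p = (\<Sum>k\<le>n. coeff p k / of_nat (Suc k))"
  unfolding unit_integral_def
  by (rule sum.mono_neutral_left) (use assms in \<open>auto simp: coeff_eq_0\<close>)

lemma unit_integral_add: "unit_integral (p + q) = unit_integral p + unit_integral q"
proof -
  define n where "n = max (degree p) (degree q)"
  have "degree (p + q) \<le> n" "degree p \<le> n" "degree q \<le> n"
    by (auto simp: n_def degree_add_le_max)
  then show ?thesis
    by (simp add: unit_integral_eq[of _ n] sum.distrib add_divide_distrib)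
qed

lemma unit_integral_smult: "unit_integral (smult c p) = c * unit_integral p"
proof -
  have "degree (smult c p) \<le> degree p" by (rule degree_smult_le)
  then show ?thesis
    by (simp add: unit_integral_eq[of _ "degree p"] sum_distrib_left)
qed

lemma unit_integral_0 [simp]: "unit_integral 0 = 0"
  by (simp add: unit_integral_def)

lemma unit_integral_pderiv: "unit_integral (pderiv r) = poly r 1 - poly r 0"
proof -
  define n where "n = degree r"
  have "degree (pderiv r) \<le> n" by (simp add: n_def degree_pderiv)
  then have "unit_integral (pderiv r) = (\<Sum>k\<le>n. coeff r (Suc k))"
    by (simp add: unit_integral_eq coeff_pderiv del: of_nat_Suc)
  moreover have "poly r 1 = (\<Sum>k\<le>Suc n. coeff r k)"
    by (simp add: poly_altdef n_def coeff_eq_0)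
  moreover have "(\<Sum>k\<le>Suc n. coeff r k) = coeff r 0 + (\<Sum>k\<le>n. coeff r (Suc k))"
    by (rule sum.atMost_Suc_shift)
  ultimately show ?thesis by (simp add: poly_0_coeff_0)
qed

lemma ex_primitive: "\<exists>q::complex poly. pderiv q = p"
proof -
  have "pderiv (\<Sum>i\<le>degree p. monom (coeff p i / of_nat (Suc i)) (Suc i)) = p"
    by (simp add: higher_pderiv_sum[of 1, simplified] pderiv_monom poly_as_sum_of_monoms del: of_nat_Suc)
  then show ?thesis by blast
qed

text \<open>Substituting t = a + w s moves the integral from a to a + w to the unit interval. The
  factor \<open>w\<close> that comes out is later the form z_i - z_j, one of the factors in the
  divisibility of potentials.\<close>

lemma unit_integral_pcompose:
  assumes "pderiv q = p"
  shows "w * unit_integral (p \<circ>\<^sub>p [:a, w:]) = poly q (a + w) - poly q a"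
proof -
  have "pderiv (q \<circ>\<^sub>p [:a, w:]) = smult w (p \<circ>\<^sub>p [:a, w:])"
    by (simp add: pderiv_pcompose assms pderiv_pCons)
  then have "w * unit_integral (p \<circ>\<^sub>p [:a, w:]) = unit_integral (pderiv (q \<circ>\<^sub>p [:a, w:]))"
    by (simp add: unit_integral_smult)
  then show ?thesis by (simp add: unit_integral_pderiv poly_pcompose)
qed

text \<open>Additivity of the integral over adjacent intervals: from 0 to b minus from 0 to a is
  from a to b.\<close>

lemma unit_integral_diff:
  "b * unit_integral (p \<circ>\<^sub>p [:0, b:]) - a * unit_integral (p \<circ>\<^sub>p [:0, a:]) =
   (b - a) * unit_integral (p \<circ>\<^sub>p [:a, b - a:])"
proof -
  obtain q where "pderiv q = p" using ex_primitive by blast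
  from unit_integral_pcompose[OF this] show ?thesis by simp
qed

text \<open>Integration by parts: t^(p+1) (t-1)^(q+1) vanishes at 0 and 1, so the Beta integrals for
  (p, q+1) and (p+1, q) are proportional with a nonzero factor. These values become the constants
  \<kappa> of the potentials.\<close>

lemma unit_integral_beta_nonzero: "unit_integral ([:0, 1:] ^ p * [:-1, 1:] ^ q) \<noteq> 0"
proof (induction q arbitrary: p)
  case 0
  have *: "[:0, 1:] ^ p = monom (1::complex) p" by (simp add: monom_altdef)
  have "unit_integral ([:0, 1:] ^ p) = 1 / of_nat (Suc p)"
    unfolding * unit_integral_def by (subst sum.remove[of _ p]) (auto simp: degree_monom_eq)
  then show ?case by (simp del: of_nat_Suc)
next
  case (Suc q)
  let ?r = "[:0, 1:] ^ Suc p * [:-1, 1:] ^ Suc q :: complex poly"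
  have "pderiv ?r = smult (of_nat (Suc p)) ([:0, 1:] ^ p * [:-1, 1:] ^ Suc q)
          + smult (of_nat (Suc q)) ([:0, 1:] ^ Suc p * [:-1, 1:] ^ q)"
    unfolding pderiv_mult pderiv_power_Suc by (simp add: pderiv_pCons mult.commute del: power_Suc of_nat_Suc)
  moreover have "unit_integral (pderiv ?r) = 0"
    by (simp add: unit_integral_pderiv)
  ultimately have "of_nat (Suc p) * unit_integral ([:0, 1:] ^ p * [:-1, 1:] ^ Suc q)
      + of_nat (Suc q) * unit_integral ([:0, 1:] ^ Suc p * [:-1, 1:] ^ q) = 0"
    by (simp only: unit_integral_add unit_integral_smult)
  moreover have "unit_integral ([:0, 1:] ^ Suc p * [:-1, 1:] ^ q) \<noteq> 0" by (rule Suc.IH)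
  ultimately show ?case
    by (metis add_0 mult_eq_0_iff of_nat_eq_0_iff old.nat.distinct(2))
qed

section \<open>Polynomial functions on a subspace\<close>

context complex_space
begin

definition restr :: "'v set \<Rightarrow> ('v \<Rightarrow> complex) \<Rightarrow> 'v \<Rightarrow> complex" where
  "restr W f = (\<lambda>x. if x \<in> W then f x else 0)"

text \<open>Only the quotient has to lie in \<open>Sym V\<close>. Divisors such as
  \<open>\<alpha> x ^ 0\<close> or an empty product equal 1 off \<open>V\<close>, but their products
  with elements of \<open>Sym V\<close> vanish there.\<close>

definition sdvd :: "'v set \<Rightarrow> ('v \<Rightarrow> complex) \<Rightarrow> ('v \<Rightarrow> complex) \<Rightarrow> bool" where
  "sdvd V q f \<longleftrightarrow> (\<exists>g\<in>Sym V. f = (\<lambda>x. q x * g x))"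

lemma sdvdI: "g \<in> Sym V \<Longrightarrow> (\<And>x. f x = q x * g x) \<Longrightarrow> sdvd V q f"
  unfolding sdvd_def by blast

lemma sdvdE:
  assumes "sdvd V q f" obtains g where "g \<in> Sym V" "\<And>x. f x = q x * g x"
  using assms unfolding sdvd_def by blast

lemma fd_subspace_subspace: "fd_subspace V \<Longrightarrow> subspace V"
  unfolding fd_subspace_def by (auto simp: subspace_span)

lemma dual_add: "\<alpha> \<in> dual V \<Longrightarrow> x \<in> V \<Longrightarrow> y \<in> V \<Longrightarrow> \<alpha> (x + y) = \<alpha> x + \<alpha> y"
  and dual_scale: "\<alpha> \<in> dual V \<Longrightarrow> x \<in> V \<Longrightarrow> \<alpha> (c *\<^sub>V x) = c * \<alpha> x"
  and dual_outside: "\<alpha> \<in> dual V \<Longrightarrow> x \<notin> V \<Longrightarrow> \<alpha> x = 0"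
  unfolding dual_def by blast+

lemma dual_diff:
  assumes "\<alpha> \<in> dual V" "subspace V" "x \<in> V" "y \<in> V" shows "\<alpha> (x - y) = \<alpha> x - \<alpha> y"
proof -
  have "\<alpha> (x - y + y) = \<alpha> (x - y) + \<alpha> y"
    using assms by (intro dual_add) (auto intro: subspace_diff)
  then show ?thesis by simp
qed

lemma dual_zero: assumes "\<alpha> \<in> dual V" "subspace V" shows "\<alpha> 0 = 0"
  using dual_diff[OF assms subspace_0 subspace_0] assms(2) by simp

lemma dual_lincomb:
  assumes "\<alpha> \<in> dual V" "subspace V" "\<And>i. i \<in> K \<Longrightarrow> v i \<in> V"
  shows "\<alpha> (\<Sum>i\<in>K. c i *\<^sub>V v i) = (\<Sum>i\<in>K. c i * \<alpha> (v i))"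
  using assms(3)
proof (induction K rule: infinite_finite_induct)
  case (insert i K)
  then have "(\<Sum>i\<in>K. c i *\<^sub>V v i) \<in> V" using assms(2) by (auto intro!: subspace_sum subspace_scale)
  then show ?case using insert assms(1,2) by (simp add: dual_add dual_scale subspace_scale)
qed (use dual_zero[OF assms(1,2)] in auto)

lemma dual_combination:
  assumes "\<alpha> \<in> dual V" "\<beta> \<in> dual V" "subspace V"
  shows "(\<lambda>x. a * \<alpha> x + b * \<beta> x) \<in> dual V"
  using assms unfolding dual_def by (auto simp: algebra_simps)

lemma dual_minus: "\<alpha> \<in> dual V \<Longrightarrow> \<beta> \<in> dual V \<Longrightarrow> subspace V \<Longrightarrow> (\<lambda>x. \<alpha> x - \<beta> x) \<in> dual V"
  using dual_combination[of \<alpha> V \<beta> 1 "-1"] by simp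

lemma dual_cmult: "\<alpha> \<in> dual V \<Longrightarrow> subspace V \<Longrightarrow> (\<lambda>x. a * \<alpha> x) \<in> dual V"
  using dual_combination[of \<alpha> V \<alpha> a 0] by simp

lemma dual_zero_fun: "(\<lambda>x. 0) \<in> dual V"
  by (simp add: dual_def)

lemma dual_restr: "\<alpha> \<in> dual V \<Longrightarrow> W \<subseteq> V \<Longrightarrow> subspace W \<Longrightarrow> restr W \<alpha> \<in> dual W"
  unfolding dual_def restr_def by (auto simp: subspace_add subspace_scale subset_iff)

lemma subspace_ker: "\<alpha> \<in> dual V \<Longrightarrow> subspace V \<Longrightarrow> subspace (ker_on V \<alpha>)"
  unfolding ker_on_def
  by (rule subspaceI)
    (auto simp: subspace_0 subspace_add subspace_scale dual_zero dual_add dual_scale)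

lemma Sym_outside: "f \<in> Sym V \<Longrightarrow> x \<notin> V \<Longrightarrow> f x = 0"
  by (induction rule: Sym.induct) (auto simp: const_on_def dual_outside)

lemma Sym_cmult: "f \<in> Sym V \<Longrightarrow> (\<lambda>x. c * f x) \<in> Sym V"
proof -
  assume f: "f \<in> Sym V"
  have "(\<lambda>x. const_on V c x * f x) \<in> Sym V" by (intro Sym.mult Sym.const f)
  moreover have "(\<lambda>x. const_on V c x * f x) = (\<lambda>x. c * f x)"
    using Sym_outside[OF f] by (auto simp: const_on_def)
  ultimately show ?thesis by simp
qed

lemma Sym_0: "(\<lambda>x. 0) \<in> Sym V"
  using Sym.form[OF dual_zero_fun] .

lemma Sym_minus: "f \<in> Sym V \<Longrightarrow> g \<in> Sym V \<Longrightarrow> (\<lambda>x. f x - g x) \<in> Sym V"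
  using Sym.add[OF _ Sym_cmult[of g V "-1"], of f] by simp

lemma Sym_sum: "(\<And>i. i \<in> K \<Longrightarrow> f i \<in> Sym V) \<Longrightarrow> (\<lambda>x. \<Sum>i\<in>K. f i x) \<in> Sym V"
  by (induction K rule: infinite_finite_induct) (auto simp: Sym_0 intro: Sym.add)

lemma Sym_power_mult: "f \<in> Sym V \<Longrightarrow> g \<in> Sym V \<Longrightarrow> (\<lambda>x. f x ^ k * g x) \<in> Sym V"
proof (induction k)
  case (Suc k)
  from Sym.mult[OF Suc.prems(1) Suc.IH[OF Suc.prems]]
  have "(\<lambda>x. f x * (f x ^ k * g x)) \<in> Sym V" .
  then show ?case by (simp add: mult.assoc)
qed auto

lemma Sym_restr: "f \<in> Sym V \<Longrightarrow> W \<subseteq> V \<Longrightarrow> subspace W \<Longrightarrow> restr W f \<in> Sym W"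
proof (induction rule: Sym.induct)
  case (const c)
  then have "restr W (const_on V c) = const_on W c" by (fastforce simp: restr_def const_on_def)
  then show ?case by (simp add: Sym.const)
next
  case (form \<alpha>)
  then show ?case by (simp add: Sym.form dual_restr)
next
  case (add f g)
  then have "(\<lambda>x. restr W f x + restr W g x) \<in> Sym W" by (intro Sym.add) auto
  moreover have "(\<lambda>x. restr W f x + restr W g x) = restr W (\<lambda>x. f x + g x)"
    by (auto simp: restr_def)
  ultimately show ?case by simp
next
  case (mult f g)
  then have "(\<lambda>x. restr W f x * restr W g x) \<in> Sym W" by (intro Sym.mult) auto
  moreover have "(\<lambda>x. restr W f x * restr W g x) = restr W (\<lambda>x. f x * g x)"
    by (auto simp: restr_def)
  ultimately show ?case by simp
qed

lemma Sym_pullback: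
  assumes "f \<in> Sym W" and W: "\<And>x. x \<in> V \<Longrightarrow> p x \<in> W"
    and p: "\<And>\<alpha>. \<alpha> \<in> dual W \<Longrightarrow> restr V (\<lambda>x. \<alpha> (p x)) \<in> dual V"
  shows "restr V (\<lambda>x. f (p x)) \<in> Sym V"
  using assms(1)
proof (induction rule: Sym.induct)
  case (const c)
  then have "restr V (\<lambda>x. const_on W c (p x)) = const_on V c" using W by (auto simp: restr_def const_on_def)
  then show ?case by (metis Sym.const)
next
  case (form \<alpha>)
  then show ?case by (metis Sym.form p)
next
  case (add f g)
  then have "(\<lambda>x. restr V (\<lambda>x. f (p x)) x + restr V (\<lambda>x. g (p x)) x) \<in> Sym V" by (intro Sym.add) auto
  moreover have "(\<lambda>x. restr V (\<lambda>x. f (p x)) x + restr V (\<lambda>x. g (p x)) x) = restr V (\<lambda>x. f (p x) + g (p x))"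
    by (auto simp: restr_def)
  ultimately show ?case by simp
next
  case (mult f g)
  then have "(\<lambda>x. restr V (\<lambda>x. f (p x)) x * restr V (\<lambda>x. g (p x)) x) \<in> Sym V" by (intro Sym.mult) auto
  moreover have "(\<lambda>x. restr V (\<lambda>x. f (p x)) x * restr V (\<lambda>x. g (p x)) x) = restr V (\<lambda>x. f (p x) * g (p x))"
    by (auto simp: restr_def)
  ultimately show ?case by simp
qed

text \<open>Elements of \<open>Sym V\<close> are functions without a normal form. Lines supply the
  univariate polynomials from which integrality and directional derivatives are obtained.\<close>

lemma Sym_line:
  assumes "f \<in> Sym V" "subspace V" "x \<in> V" "v \<in> V"
  shows "\<exists>p. \<forall>t. f (x + t *\<^sub>V v) = poly p t"
  using assms(1)
proof (induction rule: Sym.induct)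
  case (const c)
  have "\<forall>t. const_on V c (x + t *\<^sub>V v) = poly [:c:] t"
    using assms by (auto simp: const_on_def subspace_add subspace_scale)
  then show ?case by blast
next
  case (form \<alpha>)
  have "\<forall>t. \<alpha> (x + t *\<^sub>V v) = poly [:\<alpha> x, \<alpha> v:] t"
    using assms form by (auto simp: dual_add dual_scale subspace_scale)
  then show ?case by blast
next
  case (add f g)
  then obtain p q where "\<forall>t. f (x + t *\<^sub>V v) = poly p t" "\<forall>t. g (x + t *\<^sub>V v) = poly q t" by blast
  then have "\<forall>t. f (x + t *\<^sub>V v) + g (x + t *\<^sub>V v) = poly (p + q) t" by simp
  then show ?case by blast
next
  case (mult f g)
  then obtain p q where "\<forall>t. f (x + t *\<^sub>V v) = poly p t" "\<forall>t. g (x + t *\<^sub>V v) = poly q t" by blast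
  then have "\<forall>t. f (x + t *\<^sub>V v) * g (x + t *\<^sub>V v) = poly (p * q) t" by simp
  then show ?case by blast
qed

text \<open>On the line through \<open>a\<close> and \<open>b\<close> both factors are nonzero
  univariate polynomials, so their product is nonzero. A subspace \<open>W\<close> is allowed
  because the lemma is applied on hyperplanes.\<close>

lemma Sym_mult_nonzero_on:
  assumes V: "subspace V" and W: "subspace W" "W \<subseteq> V" and fg: "f \<in> Sym V" "g \<in> Sym V"
    and a: "a \<in> W" "f a \<noteq> 0" and b: "b \<in> W" "g b \<noteq> 0"
  shows "\<exists>x\<in>W. f x * g x \<noteq> 0"
proof -
  obtain p where p: "\<forall>t. f (a + t *\<^sub>V (b - a)) = poly p t"
    using Sym_line[OF fg(1) V, of a "b - a"] a b W V by (blast intro: subspace_diff)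
  obtain q where q: "\<forall>t. g (a + t *\<^sub>V (b - a)) = poly q t"
    using Sym_line[OF fg(2) V, of a "b - a"] a b W V by (blast intro: subspace_diff)
  have "poly p 0 \<noteq> 0" using p[rule_format, of 0] a by simp
  moreover have "poly q 1 \<noteq> 0" using q[rule_format, of 1] b by simp
  ultimately have "p * q \<noteq> 0" by auto
  then obtain t where "poly (p * q) t \<noteq> 0" by (metis poly_all_0_iff_0)
  then have "f (a + t *\<^sub>V (b - a)) * g (a + t *\<^sub>V (b - a)) \<noteq> 0" using p q by simp
  moreover have "a + t *\<^sub>V (b - a) \<in> W" using a b W by (intro subspace_add subspace_scale subspace_diff)
  ultimately show ?thesis by blast
qed

lemma Sym_power_nonzero_on:
  assumes V: "subspace V" and W: "subspace W" "W \<subseteq> V" and fg: "f \<in> Sym V" "g \<in> Sym V"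
    and a: "a \<in> W" "f a \<noteq> 0" and b: "b \<in> W" "g b \<noteq> 0"
  shows "\<exists>x\<in>W. f x ^ k * g x \<noteq> 0"
proof (induction k)
  case 0
  then show ?case using b by auto
next
  case (Suc k)
  then obtain x where x: "x \<in> W" "f x ^ k * g x \<noteq> 0" by blast
  from Sym_mult_nonzero_on[OF V W fg(1) Sym_power_mult[OF fg] a x]
  show ?case by (simp add: mult.assoc)
qed

lemma Sym_cancel:
  assumes V: "subspace V" and q: "q \<in> Sym V" "q a \<noteq> 0" and f: "f \<in> Sym V" and g: "g \<in> Sym V"
    and eq: "\<And>x. x \<in> V \<Longrightarrow> q x ^ k * f x = q x ^ k * g x"
  shows "f = g"
proof (rule ccontr)
  assume "f \<noteq> g"
  then obtain b where b: "f b - g b \<noteq> 0" by (metis eq_iff_diff_eq_0 ext)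
  then have "b \<in> V" using Sym_outside[OF Sym_minus[OF f g]] by blast
  moreover have "a \<in> V" using q Sym_outside by blast
  ultimately obtain x where "x \<in> V" "q x ^ k * (f x - g x) \<noteq> 0"
    using Sym_power_nonzero_on[OF V V order_refl q(1) Sym_minus[OF f g] _ q(2) _ b] by blast
  then show False using eq by (auto simp: algebra_simps)
qed

section \<open>Projection onto a hyperplane and divisibility by linear forms\<close>

lemma projection_facts:
  assumes V: "subspace V" and \<alpha>: "\<alpha> \<in> dual V" and v: "v \<in> V" "\<alpha> v = 1"
  defines "p \<equiv> \<lambda>x. x - \<alpha> x *\<^sub>V v"
  shows "x \<in> V \<Longrightarrow> p x \<in> ker_on V \<alpha>"
    and "x \<in> ker_on V \<alpha> \<Longrightarrow> p x = x"
    and "\<beta> \<in> dual (ker_on V \<alpha>) \<Longrightarrow> restr V (\<lambda>x. \<beta> (p x)) \<in> dual V"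
proof -
  show 1: "p x \<in> ker_on V \<alpha>" if "x \<in> V" for x
    using that assms by (auto simp: ker_on_def dual_diff dual_scale subspace_diff subspace_scale)
  show "p x = x" if "x \<in> ker_on V \<alpha>"
    using that by (simp add: p_def ker_on_def)
  have add: "p (x + y) = p x + p y" if "x \<in> V" "y \<in> V" for x y
    using that \<alpha> by (simp add: p_def dual_add scale_left_distrib)
  have scale: "p (c *\<^sub>V x) = c *\<^sub>V p x" if "x \<in> V" for x c
    using that \<alpha> by (simp add: p_def dual_scale scale_right_diff_distrib)
  show "restr V (\<lambda>x. \<beta> (p x)) \<in> dual V" if "\<beta> \<in> dual (ker_on V \<alpha>)"
    using that V 1 unfolding dual_def restr_def
    by (auto simp: add scale subspace_add subspace_scale)
qed

lemma ex_dual_one: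
  assumes "\<alpha> \<in> dual V" "subspace V" "\<alpha> x \<noteq> 0"
  shows "\<exists>v\<in>V. \<alpha> v = 1"
proof -
  have "x \<in> V" using assms dual_outside by blast
  then show ?thesis using assms
    by (intro bexI[of _ "inverse (\<alpha> x) *\<^sub>V x"]) (auto simp: dual_scale subspace_scale)
qed

text \<open>The projection along \<open>v\<close> is the identity modulo \<alpha>, hence so is
  composition with it. For products this is the telescoping of fg - f'g' as (f - f')g + f'(g -
  g').\<close>

lemma form_dvd_diff_projection:
  assumes V: "subspace V" and \<alpha>: "\<alpha> \<in> dual V" and v: "v \<in> V" "\<alpha> v = 1" and f: "f \<in> Sym V"
  shows "sdvd V \<alpha> (\<lambda>x. f x - restr V (\<lambda>x. f (x - \<alpha> x *\<^sub>V v)) x)"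
proof -
  define p where "p = (\<lambda>x. x - \<alpha> x *\<^sub>V v)"
  have pf: "p x \<in> ker_on V \<alpha>" if "x \<in> V" for x
    using projection_facts(1)[OF V \<alpha> v that] by (simp add: p_def)
  have pf3: "restr V (\<lambda>x. \<beta> (p x)) \<in> dual V" if "\<beta> \<in> dual (ker_on V \<alpha>)" for \<beta>
    using projection_facts(3)[OF V \<alpha> v that] by (simp add: p_def)
  have pV: "p x \<in> V" if "x \<in> V" for x using pf[OF that] unfolding ker_on_def by blast
  have dualp: "restr V (\<lambda>x. \<beta> (p x)) \<in> dual V" if b: "\<beta> \<in> dual V" for \<beta>
  proof -
    have K: "subspace (ker_on V \<alpha>)" "ker_on V \<alpha> \<subseteq> V"
      using subspace_ker[OF \<alpha> V] by (auto simp: ker_on_def)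
    have "restr V (\<lambda>x. restr (ker_on V \<alpha>) \<beta> (p x)) \<in> dual V"
      by (rule pf3[OF dual_restr[OF b K(2,1)]])
    moreover have "restr V (\<lambda>x. restr (ker_on V \<alpha>) \<beta> (p x)) = restr V (\<lambda>x. \<beta> (p x))"
      using pf by (auto simp: restr_def)
    ultimately show ?thesis by simp
  qed
  have symp: "restr V (\<lambda>x. g (p x)) \<in> Sym V" if "g \<in> Sym V" for g
    by (rule Sym_pullback[of g V V p, OF that pV dualp])
  from f have "sdvd V \<alpha> (\<lambda>x. f x - restr V (\<lambda>x. f (p x)) x)"
  proof (induction rule: Sym.induct)
    case (const c)
    show ?case by (rule sdvdI[OF Sym_0]) (use pV in \<open>auto simp: restr_def const_on_def\<close>)
  next
    case (form \<beta>)
    show ?case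
    proof (rule sdvdI[OF Sym.const])
      show "\<beta> x - restr V (\<lambda>x. \<beta> (p x)) x = \<alpha> x * const_on V (\<beta> v) x" for x
        using form V v by (auto simp: restr_def const_on_def p_def dual_diff dual_scale subspace_scale dual_outside)
    qed
  next
    case (add f g)
    obtain f1 where f1: "f1 \<in> Sym V" "\<And>x. f x - restr V (\<lambda>x. f (p x)) x = \<alpha> x * f1 x"
      using sdvdE[OF add.IH(1)] by metis
    obtain g1 where g1: "g1 \<in> Sym V" "\<And>x. g x - restr V (\<lambda>x. g (p x)) x = \<alpha> x * g1 x"
      using sdvdE[OF add.IH(2)] by metis
    show ?case
    proof (rule sdvdI[OF Sym.add[OF f1(1) g1(1)]])
      fix x show "f x + g x - restr V (\<lambda>x. f (p x) + g (p x)) x = \<alpha> x * (f1 x + g1 x)"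
        using f1(2)[of x] g1(2)[of x] by (auto simp: restr_def algebra_simps split: if_splits)
    qed
  next
    case (mult f g)
    obtain f1 where f1: "f1 \<in> Sym V" "\<And>x. f x - restr V (\<lambda>x. f (p x)) x = \<alpha> x * f1 x"
      using sdvdE[OF mult.IH(1)] by metis
    obtain g1 where g1: "g1 \<in> Sym V" "\<And>x. g x - restr V (\<lambda>x. g (p x)) x = \<alpha> x * g1 x"
      using sdvdE[OF mult.IH(2)] by metis
    show ?case
    proof (rule sdvdI[OF Sym.add[OF Sym.mult[OF f1(1) mult.hyps(2)] Sym.mult[OF symp[OF mult.hyps(1)] g1(1)]]])
      fix x
      have "f x * g x - restr V (\<lambda>x. f (p x) * g (p x)) x =
        (f x - restr V (\<lambda>x. f (p x)) x) * g x + restr V (\<lambda>x. f (p x)) x * (g x - restr V (\<lambda>x. g (p x)) x)"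
        by (auto simp: restr_def algebra_simps)
      then show "f x * g x - restr V (\<lambda>x. f (p x) * g (p x)) x = \<alpha> x * (f1 x * g x + restr V (\<lambda>x. f (p x)) x * g1 x)"
        unfolding f1(2) g1(2) by (simp add: algebra_simps)
    qed
  qed
  then show ?thesis by (simp add: p_def)
qed

text \<open>If \<open>f\<close> vanishes on the kernel, then its composition with the projection
  onto the kernel is zero, and \<open>f\<close> itself is the multiple of \<alpha> found
  above.\<close>

lemma form_dvd:
  assumes V: "subspace V" and \<alpha>: "\<alpha> \<in> dual V" "\<alpha> a \<noteq> 0" and f: "f \<in> Sym V"
    and zero: "\<And>x. x \<in> ker_on V \<alpha> \<Longrightarrow> f x = 0"
  shows "sdvd V \<alpha> f"
proof -
  obtain v where v: "v \<in> V" "\<alpha> v = 1" using ex_dual_one[OF \<alpha>(1) V \<alpha>(2)] by blast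
  have "restr V (\<lambda>x. f (x - \<alpha> x *\<^sub>V v)) x = 0" for x
    using zero projection_facts(1)[OF V \<alpha>(1) v] by (auto simp: restr_def)
  then show ?thesis using form_dvd_diff_projection[OF V \<alpha>(1) v f] by simp
qed

text \<open>A linear form is prime: \<open>q\<close> does not vanish identically on the kernel of
  \<alpha>, so \<open>f\<close> must, and one factor \<alpha> is removed from both sides at a
  time.\<close>

lemma form_power_dvd_cancel:
  assumes V: "subspace V" and \<alpha>: "\<alpha> \<in> dual V" "\<alpha> a \<noteq> 0" and f: "f \<in> Sym V" and q: "q \<in> Sym V"
    and b: "b \<in> ker_on V \<alpha>" "q b \<noteq> 0"
    and dvd: "sdvd V (\<lambda>x. \<alpha> x ^ k) (\<lambda>x. q x ^ m * f x)"
  shows "sdvd V (\<lambda>x. \<alpha> x ^ k) f"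
  using f dvd
proof (induction k arbitrary: f)
  case 0
  show ?case by (rule sdvdI[OF 0(1)]) simp
next
  case (Suc k)
  obtain g where g: "g \<in> Sym V" "\<And>x. q x ^ m * f x = \<alpha> x ^ Suc k * g x"
    using sdvdE[OF Suc.prems(2)] by metis
  note K = subspace_ker[OF \<alpha>(1) V]
  have KV: "ker_on V \<alpha> \<subseteq> V" by (auto simp: ker_on_def)
  have "f x = 0" if x: "x \<in> ker_on V \<alpha>" for x
  proof (rule ccontr)
    assume "f x \<noteq> 0"
    then obtain y where "y \<in> ker_on V \<alpha>" "q y ^ m * f y \<noteq> 0"
      using Sym_power_nonzero_on[OF V K KV q Suc.prems(1) b x] by blast
    then show False using g(2)[of y] by (simp add: ker_on_def)
  qed
  then obtain f' where f': "f' \<in> Sym V" "\<And>x. f x = \<alpha> x * f' x"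
    using sdvdE[OF form_dvd[OF V \<alpha> Suc.prems(1)]] by metis
  have "(\<lambda>x. q x ^ m * f' x) = (\<lambda>x. \<alpha> x ^ k * g x)"
  proof (rule Sym_cancel[OF V Sym.form[OF \<alpha>(1)] \<alpha>(2), where k = 1])
    show "(\<lambda>x. q x ^ m * f' x) \<in> Sym V" by (rule Sym_power_mult[OF q f'(1)])
    show "(\<lambda>x. \<alpha> x ^ k * g x) \<in> Sym V" by (rule Sym_power_mult[OF Sym.form[OF \<alpha>(1)] g(1)])
    show "\<alpha> x ^ 1 * (q x ^ m * f' x) = \<alpha> x ^ 1 * (\<alpha> x ^ k * g x)" for x
      using g(2)[of x] f'(2)[of x] by (simp add: algebra_simps)
  qed
  then have "sdvd V (\<lambda>x. \<alpha> x ^ k) (\<lambda>x. q x ^ m * f' x)" using g(1) unfolding sdvd_def by blast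
  then have "sdvd V (\<lambda>x. \<alpha> x ^ k) f'" by (rule Suc.IH[OF f'(1)])
  then obtain h where h: "h \<in> Sym V" "\<And>x. f' x = \<alpha> x ^ k * h x" by (auto elim: sdvdE)
  show ?case by (rule sdvdI[OF h(1)]) (simp add: f'(2) h(2))
qed

text \<open>Powers of pairwise non-proportional forms are coprime, so divisibility by each gives
  divisibility by the product. Non-proportionality is expressed by points on one kernel where the
  other form is nonzero.\<close>

lemma form_powers_dvd:
  assumes V: "subspace V" and "finite K"
    and \<alpha>: "\<And>i. i \<in> K \<Longrightarrow> \<alpha> i \<in> dual V"
    and indep: "\<And>i j. i \<in> K \<Longrightarrow> j \<in> K \<Longrightarrow> i \<noteq> j \<Longrightarrow> \<exists>x\<in>ker_on V (\<alpha> i). \<alpha> j x \<noteq> 0"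
    and nz: "\<And>i. i \<in> K \<Longrightarrow> \<exists>x. \<alpha> i x \<noteq> 0"
    and f: "f \<in> Sym V" and dvd: "\<And>i. i \<in> K \<Longrightarrow> sdvd V (\<lambda>x. \<alpha> i x ^ k i) f"
  shows "sdvd V (\<lambda>x. \<Prod>i\<in>K. \<alpha> i x ^ k i) f"
  using \<open>finite K\<close> \<alpha> indep nz f dvd
proof (induction K arbitrary: f rule: finite_induct)
  case empty
  show ?case by (rule sdvdI[OF empty(4)]) simp
next
  case (insert j K)
  obtain g where g: "g \<in> Sym V" "\<And>x. f x = \<alpha> j x ^ k j * g x"
    using insert.prems(5)[of j] by (auto elim: sdvdE)
  have "sdvd V (\<lambda>x. \<alpha> i x ^ k i) g" if i: "i \<in> K" for i
  proof -
    obtain b where b: "b \<in> ker_on V (\<alpha> i)" "\<alpha> j b \<noteq> 0"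
      using insert.prems(2)[of i j] i insert.hyps by blast
    obtain a where a: "\<alpha> i a \<noteq> 0" using insert.prems(3) i by blast
    have "sdvd V (\<lambda>x. \<alpha> i x ^ k i) (\<lambda>x. \<alpha> j x ^ k j * g x)"
      using insert.prems(5)[of i] i by (simp flip: g(2))
    from form_power_dvd_cancel[OF V _ a g(1) Sym.form b this] show ?thesis
      using insert.prems(1) i by blast
  qed
  then have "sdvd V (\<lambda>x. \<Prod>i\<in>K. \<alpha> i x ^ k i) g"
    using insert.prems g by (intro insert.IH) auto
  then obtain h where h: "h \<in> Sym V" "\<And>x. g x = (\<Prod>i\<in>K. \<alpha> i x ^ k i) * h x" by (auto elim: sdvdE)
  show ?case using insert.hyps by (intro sdvdI[OF h(1)]) (simp add: g(2) h(2))
qed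

section \<open>Homogeneous polynomial functions\<close>

lemma homogeneous_Sym: "homogeneous V p f \<Longrightarrow> f \<in> Sym V"
  by (induction rule: homogeneous.induct) (auto intro: Sym.intros)

lemma homogeneous_scale:
  "homogeneous V p f \<Longrightarrow> subspace V \<Longrightarrow> x \<in> V \<Longrightarrow> f (c *\<^sub>V x) = c ^ p * f x"
  by (induction rule: homogeneous.induct)
    (auto simp: const_on_def dual_scale subspace_scale algebra_simps)

lemma homogeneous_0: "homogeneous V p (\<lambda>x. 0)"
proof (induction p)
  case 0
  then show ?case using homogeneous.const[of V 0] by (simp add: const_on_def)
next
  case (Suc p)
  then show ?case using homogeneous.mult[OF dual_zero_fun Suc] by simp
qed

lemma homogeneous_mult:
  "homogeneous V p f \<Longrightarrow> homogeneous V q g \<Longrightarrow> homogeneous V (p + q) (\<lambda>x. f x * g x)"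
proof (induction arbitrary: rule: homogeneous.induct)
  case (const c)
  from const show ?case
  proof (induction rule: homogeneous.induct)
    case (const d)
    have "(\<lambda>x. const_on V c x * const_on V d x) = const_on V (c * d)" by (auto simp: const_on_def)
    then show ?case using homogeneous.const by simp
  next
    case (mult \<alpha> p f)
    from homogeneous.mult[OF mult.hyps(1) mult.IH]
    show ?case by (simp add: mult_ac)
  next
    case (add p f g)
    from homogeneous.add[OF add.IH] show ?case by (simp add: algebra_simps)
  qed
next
  case (mult \<alpha> p f)
  from homogeneous.mult[OF mult.hyps(1) mult.IH[OF mult.prems]]
  show ?case by (simp add: mult_ac)
next
  case (add p f g)
  from homogeneous.add[OF add.IH(1)[OF add.prems] add.IH(2)[OF add.prems]]
  show ?case by (simp add: algebra_simps)
qed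

lemma homogeneous_cmult: "homogeneous V p f \<Longrightarrow> homogeneous V p (\<lambda>x. c * f x)"
proof -
  assume f: "homogeneous V p f"
  have "(\<lambda>x. const_on V c x * f x) = (\<lambda>x. c * f x)"
    using Sym_outside[OF homogeneous_Sym[OF f]] by (auto simp: const_on_def)
  then show ?thesis using homogeneous_mult[OF homogeneous.const[of V c] f] by simp
qed

lemma homogeneous_minus:
  "homogeneous V p f \<Longrightarrow> homogeneous V p g \<Longrightarrow> homogeneous V p (\<lambda>x. f x - g x)"
  using homogeneous.add[OF _ homogeneous_cmult[of V p g "-1"], of f] by simp

lemma homogeneous_sum:
  "(\<And>i. i \<in> K \<Longrightarrow> homogeneous V p (f i)) \<Longrightarrow> homogeneous V p (\<lambda>x. \<Sum>i\<in>K. f i x)"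
  by (induction K rule: infinite_finite_induct) (auto simp: homogeneous_0 intro: homogeneous.add)

lemma homogeneous_form: "\<alpha> \<in> dual V \<Longrightarrow> homogeneous V (Suc 0) \<alpha>"
proof -
  assume a: "\<alpha> \<in> dual V"
  have "(\<lambda>x. \<alpha> x * const_on V 1 x) = \<alpha>" using dual_outside[OF a] by (auto simp: const_on_def)
  then show ?thesis using homogeneous.mult[OF a homogeneous.const[of V 1]] by simp
qed

lemma homogeneous_power_mult:
  assumes "\<alpha> \<in> dual V" "homogeneous V p f"
  shows "homogeneous V (k + p) (\<lambda>x. \<alpha> x ^ k * f x)"
proof (induction k)
  case (Suc k)
  from homogeneous.mult[OF assms(1) Suc] show ?case by (simp add: mult_ac)
qed (use assms in simp)

lemma homogeneous_prod_powers:
  assumes "finite K" "\<And>i. i \<in> K \<Longrightarrow> \<alpha> i \<in> dual V"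
  shows "homogeneous V (\<Sum>i\<in>K. k i) (restr V (\<lambda>x. \<Prod>i\<in>K. \<alpha> i x ^ k i))"
  using assms
proof (induction K rule: finite_induct)
  case empty
  have "restr V (\<lambda>x. 1) = const_on V 1" by (auto simp: restr_def const_on_def)
  then show ?case using homogeneous.const[of V 1] by simp
next
  case (insert i K)
  have "restr V (\<lambda>x. \<Prod>i\<in>insert i K. \<alpha> i x ^ k i) =
      (\<lambda>x. \<alpha> i x ^ k i * restr V (\<lambda>x. \<Prod>i\<in>K. \<alpha> i x ^ k i) x)"
    using insert.hyps by (auto simp: restr_def)
  then show ?case
    using homogeneous_power_mult[of "\<alpha> i" V _ _ "k i"] insert by simp
qed

lemma homogeneous_pullback:
  assumes "homogeneous W d f" and W: "\<And>x. x \<in> V \<Longrightarrow> p x \<in> W"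
    and p: "\<And>\<alpha>. \<alpha> \<in> dual W \<Longrightarrow> restr V (\<lambda>x. \<alpha> (p x)) \<in> dual V"
  shows "homogeneous V d (restr V (\<lambda>x. f (p x)))"
  using assms(1)
proof (induction rule: homogeneous.induct)
  case (const c)
  then have "restr V (\<lambda>x. const_on W c (p x)) = const_on V c" using W by (auto simp: restr_def const_on_def)
  then show ?case by (metis homogeneous.const)
next
  case (mult \<alpha> d f)
  from homogeneous.mult[OF p[OF mult.hyps(1)] mult.IH]
  have "homogeneous V (Suc d) (\<lambda>x. restr V (\<lambda>x. \<alpha> (p x)) x * restr V (\<lambda>x. f (p x)) x)" .
  moreover have "(\<lambda>x. restr V (\<lambda>x. \<alpha> (p x)) x * restr V (\<lambda>x. f (p x)) x) = restr V (\<lambda>x. \<alpha> (p x) * f (p x))"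
    by (auto simp: restr_def)
  ultimately show ?case by simp
next
  case (add d f g)
  from homogeneous.add[OF add.IH]
  have "homogeneous V d (\<lambda>x. restr V (\<lambda>x. f (p x)) x + restr V (\<lambda>x. g (p x)) x)" .
  moreover have "(\<lambda>x. restr V (\<lambda>x. f (p x)) x + restr V (\<lambda>x. g (p x)) x) = restr V (\<lambda>x. f (p x) + g (p x))"
    by (auto simp: restr_def)
  ultimately show ?case by simp
qed

lemma Sym_homogeneous_components:
  assumes "f \<in> Sym V"
  shows "\<exists>g K. (\<forall>k. homogeneous V k (g k)) \<and> f = (\<lambda>x. \<Sum>k\<le>(K::nat). g k x)"
  using assms
proof (induction rule: Sym.induct)
  case (const c)
  show ?case
    by (rule exI[of _ "\<lambda>k. if k = 0 then const_on V c else (\<lambda>x. 0)"], rule exI[of _ 0])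
      (auto simp: homogeneous_0 homogeneous.const)
next
  case (form \<alpha>)
  then show ?case
    by (intro exI[of _ "\<lambda>k. if k = Suc 0 then \<alpha> else (\<lambda>x. 0)"] exI[of _ "Suc 0"])
      (auto simp: homogeneous_0 homogeneous_form)
next
  case (add f1 f2)
  obtain g1 K1 where 1: "\<And>k. homogeneous V k (g1 k)" "f1 = (\<lambda>x. \<Sum>k\<le>K1. g1 k x)" using add.IH(1) by blast
  obtain g2 K2 where 2: "\<And>k. homogeneous V k (g2 k)" "f2 = (\<lambda>x. \<Sum>k\<le>K2. g2 k x)" using add.IH(2) by blast
  let ?g = "\<lambda>k x. (if k \<le> K1 then g1 k x else 0) + (if k \<le> K2 then g2 k x else 0)"
  have "homogeneous V k (?g k)" for k
    using 1(1)[of k] 2(1)[of k]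
    by (intro homogeneous.add) (cases "k \<le> K1", simp_all add: homogeneous_0, cases "k \<le> K2", simp_all add: homogeneous_0)
  moreover have "f1 x + f2 x = (\<Sum>k\<le>max K1 K2. ?g k x)" for x
  proof -
    have "(\<Sum>k\<le>max K1 K2. if k \<le> K1 then g1 k x else 0) = f1 x"
      unfolding 1(2) by (subst sum.inter_filter[symmetric]) (auto intro!: sum.cong)
    moreover have "(\<Sum>k\<le>max K1 K2. if k \<le> K2 then g2 k x else 0) = f2 x"
      unfolding 2(2) by (subst sum.inter_filter[symmetric]) (auto intro!: sum.cong)
    ultimately show ?thesis by (simp add: sum.distrib)
  qed
  ultimately show ?case by (intro exI[of _ ?g] exI[of _ "max K1 K2"]) auto
next
  case (mult f1 f2)
  obtain g1 K1 where 1: "\<And>k. homogeneous V k (g1 k)" "f1 = (\<lambda>x. \<Sum>k\<le>K1. g1 k x)" using mult.IH(1) by blast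
  obtain g2 K2 where 2: "\<And>k. homogeneous V k (g2 k)" "f2 = (\<lambda>x. \<Sum>k\<le>K2. g2 k x)" using mult.IH(2) by blast
  let ?g = "\<lambda>k x. \<Sum>ij\<in>{ij\<in>{..K1} \<times> {..K2}. fst ij + snd ij = k}. g1 (fst ij) x * g2 (snd ij) x"
  have "homogeneous V k (?g k)" for k
    by (rule homogeneous_sum) (use homogeneous_mult[OF 1(1) 2(1)] in auto)
  moreover have "f1 x * f2 x = (\<Sum>k\<le>K1 + K2. ?g k x)" for x
  proof -
    have "f1 x * f2 x = (\<Sum>ij\<in>{..K1} \<times> {..K2}. g1 (fst ij) x * g2 (snd ij) x)"
      unfolding 1(2) 2(2) sum_product sum.cartesian_product by (simp add: case_prod_beta)
    also have "\<dots> = (\<Sum>k\<le>K1 + K2. ?g k x)"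
      by (rule sum.group[symmetric]) auto
    finally show ?thesis .
  qed
  ultimately show ?case by (intro exI[of _ ?g] exI[of _ "K1 + K2"]) auto
qed

text \<open>Recovers the inductively defined \<open>homogeneous\<close> from a scaling law of
  values. The power \<open>c ^ d\<close> on the left allows the degree p - d of a quotient,
  including the case where it would be negative.\<close>

lemma homogeneous_of_scaling:
  assumes V: "subspace V" and f: "f \<in> Sym V"
    and scaling: "\<And>c x. c \<noteq> 0 \<Longrightarrow> x \<in> V \<Longrightarrow> c ^ d * f (c *\<^sub>V x) = c ^ p * f x"
  shows "d \<le> p \<Longrightarrow> homogeneous V (p - d) f" and "p < d \<Longrightarrow> f = (\<lambda>x. 0)"
proof -
  obtain g K where g: "\<And>k. homogeneous V k (g k)" "f = (\<lambda>x. \<Sum>k\<le>(K::nat). g k x)"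
    using Sym_homogeneous_components[OF f] by blast
  \<comment> \<open>For fixed \<open>x\<close> both sides are polynomials in the scaling factor that
    agree at all nonzero \<open>c\<close>. Comparing the coefficients at \<open>p\<close> isolates
    the component of degree p - d.\<close>
  have key: "(\<Sum>k\<le>K. monom (g k x) (k + d)) = monom (f x) p" if x: "x \<in> V" for x
  proof (rule ccontr)
    let ?P = "(\<Sum>k\<le>K. monom (g k x) (k + d)) - monom (f x) p"
    assume "\<not> ?thesis"
    then have "?P \<noteq> 0" by simp
    then have "finite {c. poly ?P c = 0}" by (rule poly_roots_finite)
    moreover have "c \<in> {c. poly ?P c = 0}" if "c \<noteq> 0" for c
    proof -
      have "c ^ d * f (c *\<^sub>V x) = (\<Sum>k\<le>K. g k x * c ^ (k + d))"
        unfolding g(2) using homogeneous_scale[OF g(1) V x]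
        by (simp add: sum_distrib_left power_add mult_ac)
      then show ?thesis using scaling[OF that x] by (simp add: poly_monom poly_sum mult_ac)
    qed
    ultimately have "finite (UNIV - {0::complex})" by (elim finite_subset[rotated]) auto
    then show False by (simp add: infinite_UNIV_char_0)
  qed
  have out: "f x = 0" "g k x = 0" if "x \<notin> V" for x k
    using that Sym_outside f homogeneous_Sym[OF g(1)] by blast+
  have coeff: "(\<Sum>k\<le>K. if k + d = p then g k x else 0) = f x" if "x \<in> V" for x
    using arg_cong[OF key[OF that], of "\<lambda>P. coeff P p"] by (simp add: coeff_sum)
  show "homogeneous V (p - d) f" if "d \<le> p"
  proof -
    have eq: "(k + d = p) = (k = p - d)" for k using that by auto
    have "f = (\<lambda>x. if p - d \<le> K then g (p - d) x else 0)"
    proof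
      fix x show "f x = (if p - d \<le> K then g (p - d) x else 0)"
        using coeff[of x] out[of x] by (cases "x \<in> V") (auto simp: eq sum.delta')
    qed
    then show ?thesis using g(1)[of "p - d"] homogeneous_0 by (cases "p - d \<le> K") auto
  qed
  show "f = (\<lambda>x. 0)" if "p < d"
  proof
    fix x show "f x = 0" using coeff[of x] out[of x] that by (cases "x \<in> V") auto
  qed
qed

lemma homogeneous_0_const:
  assumes "homogeneous V 0 f" "subspace V" "x \<in> V"
  shows "f x = f 0"
  \<comment> \<open>Scaling by 0 with \<open>0 ^ 0 = 1\<close> compares every value with the one at
    the origin.\<close>
  using homogeneous_scale[OF assms, of 0] by simp

end

section \<open>Dual bases and derivations\<close>

context complex_space
begin

text \<open>With the vectors \<open>u\<close> at hand the coefficients of a form are its values on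
  them, and a derivation can be prescribed freely on the coordinates \<open>y\<close>.\<close>

definition dual_basis :: "'v set \<Rightarrow> nat \<Rightarrow> (nat \<Rightarrow> 'v \<Rightarrow> complex) \<Rightarrow> (nat \<Rightarrow> 'v) \<Rightarrow> bool" where
  "dual_basis V n y u \<longleftrightarrow>
     (\<forall>i\<in>{1..n}. y i \<in> dual V \<and> u i \<in> V) \<and>
     (\<forall>i\<in>{1..n}. \<forall>j\<in>{1..n}. y i (u j) = (if i = j then 1 else 0)) \<and>
     (\<forall>x\<in>V. x = (\<Sum>i=1..n. y i x *\<^sub>V u i))"

lemma dual_basisD:
  assumes "dual_basis V n y u"
  shows "i \<in> {1..n} \<Longrightarrow> y i \<in> dual V" "i \<in> {1..n} \<Longrightarrow> u i \<in> V"
    "i \<in> {1..n} \<Longrightarrow> j \<in> {1..n} \<Longrightarrow> y i (u j) = (if i = j then 1 else 0)"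
    "x \<in> V \<Longrightarrow> x = (\<Sum>i=1..n. y i x *\<^sub>V u i)"
  using assms unfolding dual_basis_def by blast+

lemma dual_basis_form:
  assumes db: "dual_basis V n y u" and V: "subspace V" and \<alpha>: "\<alpha> \<in> dual V"
  shows "\<alpha> = (\<lambda>x. \<Sum>i=1..n. \<alpha> (u i) * y i x)"
proof
  fix x
  show "\<alpha> x = (\<Sum>i=1..n. \<alpha> (u i) * y i x)"
  proof (cases "x \<in> V")
    case True
    have "\<alpha> x = \<alpha> (\<Sum>i=1..n. y i x *\<^sub>V u i)" using dual_basisD(4)[OF db True] by simp
    also have "\<dots> = (\<Sum>i=1..n. y i x * \<alpha> (u i))"
      by (rule dual_lincomb[OF \<alpha> V dual_basisD(2)[OF db]])
    finally show ?thesis by (simp add: mult.commute)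
  next
    case False
    have "y i x = 0" if "i \<in> {1..n}" for i by (rule dual_outside[OF dual_basisD(1)[OF db that] False])
    then have "(\<Sum>i=1..n. \<alpha> (u i) * y i x) = 0" by (intro sum.neutral) auto
    then show ?thesis using dual_outside[OF \<alpha> False] by simp
  qed
qed

lemma dual_basis_coordinates:
  assumes db: "dual_basis V n y u" and V: "subspace V"
  shows "coordinates V n y"
  unfolding coordinates_def
proof (intro conjI ballI)
  show "y i \<in> dual V" if "i \<in> {1..n}" for i using dual_basisD(1)[OF db that] .
  fix \<alpha> assume \<alpha>: "\<alpha> \<in> dual V"
  show "\<exists>!c. (\<forall>i. i \<notin> {1..n} \<longrightarrow> c i = 0) \<and> \<alpha> = (\<lambda>x. \<Sum>i=1..n. c i * y i x)"
  proof (rule ex1I[of _ "\<lambda>i. if i \<in> {1..n} then \<alpha> (u i) else 0"])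
    have "(\<lambda>x. \<Sum>i=1..n. (if i \<in> {1..n} then \<alpha> (u i) else 0) * y i x) =
        (\<lambda>x. \<Sum>i=1..n. \<alpha> (u i) * y i x)"
      by (intro ext sum.cong) auto
    also have "\<dots> = \<alpha>" by (rule dual_basis_form[OF db V \<alpha>, symmetric])
    finally show "(\<forall>i. i \<notin> {1..n} \<longrightarrow> (if i \<in> {1..n} then \<alpha> (u i) else 0) = 0) \<and>
        \<alpha> = (\<lambda>x. \<Sum>i=1..n. (if i \<in> {1..n} then \<alpha> (u i) else 0) * y i x)"
      by simp
    fix c assume c: "(\<forall>i. i \<notin> {1..n} \<longrightarrow> c i = 0) \<and> \<alpha> = (\<lambda>x. \<Sum>i=1..n. c i * y i x)"
    show "c = (\<lambda>i. if i \<in> {1..n} then \<alpha> (u i) else 0)"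
    proof
      fix j show "c j = (if j \<in> {1..n} then \<alpha> (u j) else 0)"
      proof (cases "j \<in> {1..n}")
        case True
        have "\<alpha> (u j) = (\<Sum>i=1..n. c i * y i (u j))" using c by simp
        also have "\<dots> = (\<Sum>i=1..n. if i = j then c i else 0)"
          by (rule sum.cong) (use dual_basisD(3)[OF db _ True] in auto)
        also have "\<dots> = c j" using True by simp
        finally show ?thesis using True by simp
      qed (use c in auto)
    qed
  qed
qed

lemma dual_basis_dim:
  assumes db: "dual_basis V n y u" and V: "subspace V"
  shows "dim V = n"
proof -
  have inj: "inj_on u {1..n}"
  proof (rule inj_onI)
    fix i j assume ij: "i \<in> {1..n}" "j \<in> {1..n}" "u i = u j"
    then have "y i (u i) = y i (u j)" by simp
    then show "i = j" unfolding dual_basisD(3)[OF db ij(1,1)] dual_basisD(3)[OF db ij(1,2)]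
      by (auto split: if_splits)
  qed
  have "independent (u ` {1..n})"
  proof (rule independent_if_scalars_zero)
    show "finite (u ` {1..n})" by simp
    fix f x assume s: "(\<Sum>x\<in>u ` {1..n}. f x *\<^sub>V x) = 0" and x: "x \<in> u ` {1..n}"
    obtain j where j: "j \<in> {1..n}" "x = u j" using x by blast
    have "(\<Sum>i=1..n. f (u i) *\<^sub>V u i) = 0"
      using s unfolding sum.reindex[OF inj] by (simp add: o_def)
    then have "0 = y j (\<Sum>i=1..n. f (u i) *\<^sub>V u i)"
      using dual_zero[OF dual_basisD(1)[OF db j(1)] V] by simp
    also have "\<dots> = (\<Sum>i=1..n. f (u i) * y j (u i))"
      by (rule dual_lincomb[OF dual_basisD(1)[OF db j(1)] V dual_basisD(2)[OF db]])
    also have "\<dots> = (\<Sum>i=1..n. if i = j then f (u i) else 0)"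
      by (rule sum.cong) (use dual_basisD(3)[OF db j(1)] in auto)
    also have "\<dots> = f (u j)" using j by simp
    finally show "f x = 0" using j by simp
  qed
  moreover have "span (u ` {1..n}) = V"
  proof
    show "span (u ` {1..n}) \<subseteq> V" by (rule span_minimal[OF _ V]) (use dual_basisD(2)[OF db] in blast)
    show "V \<subseteq> span (u ` {1..n})"
    proof
      fix x assume "x \<in> V"
      note x = dual_basisD(4)[OF db this, symmetric]
      have "(\<Sum>i=1..n. y i x *\<^sub>V u i) \<in> span (u ` {1..n})"
        by (intro span_sum span_scale span_base imageI)
      then show "x \<in> span (u ` {1..n})" unfolding x .
    qed
  qed
  ultimately have "dim V = card (u ` {1..n})" by (metis dim_span_eq_card_independent)
  then show ?thesis using inj by (simp add: card_image)
qed

lemma ex_dual_basis: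
  assumes "fd_subspace V"
  shows "\<exists>y u. dual_basis V (dim V) y u"
proof -
  have V: "subspace V" by (rule fd_subspace_subspace[OF assms])
  obtain B where "finite B" "span B = V" using assms unfolding fd_subspace_def by blast
  then obtain C where C: "independent C" "span C = V" "finite C"
    by (metis finite_subset maximal_independent_subset span_mono span_span subset_antisym span_superset subset_trans)
  obtain u where u: "bij_betw u {1..card C} C"
    using ex_bij_betw_nat_finite_1[OF C(3)] by blast
  define y where "y i = restr V (\<lambda>x. representation C x (u i))" for i
  have uC: "u i \<in> C" if "i \<in> {1..card C}" for i using u that by (auto simp: bij_betw_def)
  have "dual_basis V (card C) y u"
    unfolding dual_basis_def
  proof (intro conjI ballI)
    fix i assume i: "i \<in> {1..card C}"
    show "y i \<in> dual V" unfolding dual_def y_def restr_def using V C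
      by (auto simp: subspace_add subspace_scale representation_add representation_scale)
    show "u i \<in> V" using uC[OF i] C span_base by blast
    fix j assume j: "j \<in> {1..card C}"
    have "u j \<in> V" using uC[OF j] C span_base by blast
    moreover have "u j = u i \<longleftrightarrow> i = j"
      using inj_on_eq_iff[OF bij_betw_imp_inj_on[OF u] j i] by auto
    ultimately show "y i (u j) = (if i = j then 1 else 0)"
      using representation_basis[OF C(1) uC[OF j]] by (auto simp: y_def restr_def)
  next
    fix x assume x: "x \<in> V"
    have "x = (\<Sum>b\<in>C. representation C x b *\<^sub>V b)"
      using sum_representation_eq[OF C(1) _ C(3) order_refl, of x] x C(2) by simp
    also have "\<dots> = (\<Sum>i=1..card C. representation C x (u i) *\<^sub>V u i)"
      by (rule sum.reindex_bij_betw[OF u, symmetric])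
    finally show "x = (\<Sum>i=1..card C. y i x *\<^sub>V u i)" using x by (simp add: y_def restr_def)
  qed
  moreover from dual_basis_dim[OF this V] have "dim V = card C" .
  ultimately show ?thesis by auto
qed

lemma fd_subspace_ker:
  assumes V: "fd_subspace V" and \<alpha>: "\<alpha> \<in> dual V" and v: "v \<in> V" "\<alpha> v = 1"
  shows "fd_subspace (ker_on V \<alpha>)"
proof -
  have sV: "subspace V" by (rule fd_subspace_subspace[OF V])
  obtain B where B: "finite B" "span B = V" using V unfolding fd_subspace_def by blast
  define p where "p x = x - \<alpha> x *\<^sub>V v" for x
  have pk: "p x \<in> ker_on V \<alpha>" if "x \<in> V" for x
    using projection_facts(1)[OF sV \<alpha> v that] by (simp add: p_def)
  have "span (p ` B) = ker_on V \<alpha>"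
  proof
    have "p ` B \<subseteq> ker_on V \<alpha>" using pk B span_superset by blast
    then show "span (p ` B) \<subseteq> ker_on V \<alpha>" by (rule span_minimal[OF _ subspace_ker[OF \<alpha> sV]])
    have "x \<in> V \<and> p x \<in> span (p ` B)" if "x \<in> span B" for x
      using that
    proof (induction rule: span_induct_alt)
      case base
      then show ?case using sV \<alpha> by (auto simp: p_def dual_zero subspace_0 span_zero)
    next
      case (step c x y)
      have x: "x \<in> V" using step B span_base by blast
      have "p (c *\<^sub>V x + y) = c *\<^sub>V p x + p y"
        using x step \<alpha> sV by (simp add: p_def dual_add dual_scale subspace_scale algebra_simps)
      moreover have "c *\<^sub>V p x + p y \<in> span (p ` B)"
        using step by (intro span_add span_scale) (auto intro: span_base)
      ultimately show ?case using x step sV by (auto intro: subspace_add subspace_scale)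
    qed
    then have "p x \<in> span (p ` B)" if "x \<in> ker_on V \<alpha>" for x
      using that B by (auto simp: ker_on_def)
    moreover have "p x = x" if "x \<in> ker_on V \<alpha>" for x using that by (simp add: p_def ker_on_def)
    ultimately show "ker_on V \<alpha> \<subseteq> span (p ` B)" by force
  qed
  then show ?thesis unfolding fd_subspace_def using B by blast
qed

text \<open>The coordinates of the kernel are pulled back along the projection that kills
  \<open>v\<close>, so they vanish at \<open>v\<close>. The shift of indices makes \<alpha> the
  first coordinate.\<close>

lemma dual_basis_extend:
  assumes V: "subspace V" and \<alpha>: "\<alpha> \<in> dual V" and v: "v \<in> V" "\<alpha> v = 1"
    and db: "dual_basis (ker_on V \<alpha>) n y u"
  shows "dual_basis V (Suc n)
     (\<lambda>i. if i = 1 then \<alpha> else restr V (\<lambda>x. y (i - 1) (x - \<alpha> x *\<^sub>V v)))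
     (\<lambda>i. if i = 1 then v else u (i - 1))" (is "dual_basis V _ ?y ?u")
  unfolding dual_basis_def
proof (intro conjI ballI)
  have K: "subspace (ker_on V \<alpha>)" by (rule subspace_ker[OF \<alpha> V])
  have dom: "i = 1 \<or> (i \<noteq> 1 \<and> i - 1 \<in> {1..n})" if "i \<in> {1..Suc n}" for i using that by auto
  have uV: "u i \<in> V" "\<alpha> (u i) = 0" if "i \<in> {1..n}" for i
    using dual_basisD(2)[OF db that] by (auto simp: ker_on_def)
  fix i assume "i \<in> {1..Suc n}"
  note i = dom[OF this]
  show "?y i \<in> dual V" using i \<alpha> projection_facts(3)[OF V \<alpha> v dual_basisD(1)[OF db]] by auto
  show "?u i \<in> V" using i v uV by auto
  fix j assume "j \<in> {1..Suc n}"
  note j = dom[OF this]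
  have z: "y (i - 1) 0 = 0" if "i - 1 \<in> {1..n}" using dual_zero[OF dual_basisD(1)[OF db that] K] .
  have "i - 1 = j - 1 \<longleftrightarrow> i = j" if "i - 1 \<in> {1..n}" "j - 1 \<in> {1..n}" using that by auto
  then show "?y i (?u j) = (if i = j then 1 else 0)"
    using i j v uV[of "j - 1"] z dual_basisD(3)[OF db, of "i - 1" "j - 1"] by (auto simp: restr_def)
next
  fix x assume x: "x \<in> V"
  define p where "p = x - \<alpha> x *\<^sub>V v"
  have "p \<in> ker_on V \<alpha>" unfolding p_def by (rule projection_facts(1)[OF V \<alpha> v x])
  from dual_basisD(4)[OF db this] have p: "p = (\<Sum>i=1..n. y i p *\<^sub>V u i)" .
  have "(\<Sum>i=1..Suc n. ?y i x *\<^sub>V ?u i) = \<alpha> x *\<^sub>V v + (\<Sum>i=2..Suc n. ?y i x *\<^sub>V ?u i)"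
    by (subst sum.atLeast_Suc_atMost) (auto simp: numeral_2_eq_2)
  also have "(\<Sum>i=2..Suc n. ?y i x *\<^sub>V ?u i) = (\<Sum>i=1..n. y i p *\<^sub>V u i)"
    unfolding numeral_2_eq_2 One_nat_def sum.atLeast_Suc_atMost_Suc_shift
    using x by (intro sum.cong) (auto simp: restr_def p_def)
  also have "\<dots> = p" using p by simp
  finally show "x = (\<Sum>i=1..Suc n. ?y i x *\<^sub>V ?u i)" by (simp add: p_def)
qed

lemma dim_ker:
  assumes V: "fd_subspace V" and \<alpha>: "\<alpha> \<in> dual V" and v: "v \<in> V" "\<alpha> v = 1"
  shows "dim V = Suc (dim (ker_on V \<alpha>))"
proof -
  have sV: "subspace V" by (rule fd_subspace_subspace[OF V])
  obtain y u where "dual_basis (ker_on V \<alpha>) (dim (ker_on V \<alpha>)) y u"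
    using ex_dual_basis[OF fd_subspace_ker[OF assms]] by blast
  from dual_basis_dim[OF dual_basis_extend[OF sV \<alpha> v this] sV] show ?thesis .
qed

text \<open>Two extensions, by \<beta> inside the kernel of \<alpha> and then by \<alpha>, give the
  coordinates required by \<open>euler_multiplicity\<close>. Since \<beta> vanishes at
  \<open>a\<close>, pulling back along \<open>a\<close> returns \<beta> itself and not \<beta> plus
  a multiple of \<alpha>.\<close>

lemma ex_dual_basis_two:
  assumes V: "fd_subspace V" and \<alpha>: "\<alpha> \<in> dual V" and \<beta>: "\<beta> \<in> dual V"
    and a: "a \<in> V" "\<alpha> a = 1" "\<beta> a = 0" and b: "b \<in> V" "\<alpha> b = 0" "\<beta> b = 1"
  shows "\<exists>n y u. dual_basis V n y u \<and> 2 \<le> n \<and> y 1 = \<alpha> \<and> y 2 = \<beta>"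
proof -
  have sV: "subspace V" by (rule fd_subspace_subspace[OF V])
  define K where "K = ker_on V \<alpha>"
  have K: "fd_subspace K" unfolding K_def by (rule fd_subspace_ker[OF V \<alpha> a(1,2)])
  have sK: "subspace K" by (rule fd_subspace_subspace[OF K])
  have KV: "K \<subseteq> V" by (auto simp: K_def ker_on_def)
  have bK: "b \<in> K" using b by (simp add: K_def ker_on_def)
  have \<beta>': "restr K \<beta> \<in> dual K" "restr K \<beta> b = 1"
    using dual_restr[OF \<beta> KV sK] b bK by (auto simp: restr_def)
  obtain y u n where "dual_basis (ker_on K (restr K \<beta>)) n y u"
    using ex_dual_basis[OF fd_subspace_ker[OF K \<beta>'(1) bK \<beta>'(2)]] by blast
  from dual_basis_extend[OF sK \<beta>'(1) bK \<beta>'(2) this]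
  obtain y u where db: "dual_basis (ker_on V \<alpha>) (Suc n) y u" "y 1 = restr K \<beta>" unfolding K_def by fastforce
  let ?y = "\<lambda>i. if i = 1 then \<alpha> else restr V (\<lambda>x. y (i - 1) (x - \<alpha> x *\<^sub>V a))"
  have "?y 2 = \<beta>"
  proof
    fix x show "?y 2 x = \<beta> x"
    proof (cases "x \<in> V")
      case True
      then have "x - \<alpha> x *\<^sub>V a \<in> K" using projection_facts(1)[OF sV \<alpha> a(1,2)] by (simp add: K_def)
      then show ?thesis using True a \<beta> sV db(2)
        by (simp add: restr_def dual_diff dual_scale subspace_scale)
    qed (use dual_outside[OF \<beta>] in \<open>simp add: restr_def\<close>)
  qed
  moreover have "?y 1 = \<alpha>" by simp
  moreover have "2 \<le> Suc (Suc n)" by simp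
  ultimately show ?thesis using dual_basis_extend[OF sV \<alpha> a(1,2) db(1)] by blast
qed

text \<open>The derivative along \<open>v\<close> is the linear coefficient of the polynomial \<open>t \<mapsto> f (x + t v)\<close>.\<close>

definition dir_deriv :: "'v set \<Rightarrow> 'v \<Rightarrow> ('v \<Rightarrow> complex) \<Rightarrow> 'v \<Rightarrow> complex" where
  "dir_deriv V v f x =
     (if x \<in> V then coeff (THE p. \<forall>t. f (x + t *\<^sub>V v) = poly p t) 1 else 0)"

lemma dir_deriv_eq:
  assumes "x \<in> V" "\<And>t. f (x + t *\<^sub>V v) = poly p t"
  shows "dir_deriv V v f x = coeff p 1"
proof -
  have "(THE p. \<forall>t. f (x + t *\<^sub>V v) = poly p t) = p"
  proof (rule the_equality)
    fix q assume "\<forall>t. f (x + t *\<^sub>V v) = poly q t"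
    then have "poly q = poly p" using assms by auto
    then show "q = p" by (simp add: poly_eq_poly_eq_iff)
  qed (use assms in auto)
  then show ?thesis using assms by (simp add: dir_deriv_def)
qed

lemma dir_deriv_const:
  assumes "subspace V" "v \<in> V" shows "dir_deriv V v (const_on V c) = (\<lambda>x. 0)"
proof
  fix x show "dir_deriv V v (const_on V c) x = 0"
  proof (cases "x \<in> V")
    case True
    then have "dir_deriv V v (const_on V c) x = coeff [:c:] 1"
      using assms by (intro dir_deriv_eq) (auto simp: const_on_def subspace_add subspace_scale)
    then show ?thesis by simp
  qed (simp add: dir_deriv_def)
qed

lemma dir_deriv_form:
  assumes "subspace V" "v \<in> V" "\<alpha> \<in> dual V"
  shows "dir_deriv V v \<alpha> = const_on V (\<alpha> v)"
proof
  fix x show "dir_deriv V v \<alpha> x = const_on V (\<alpha> v) x"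
  proof (cases "x \<in> V")
    case True
    then have "dir_deriv V v \<alpha> x = coeff [:\<alpha> x, \<alpha> v:] 1"
      using assms by (intro dir_deriv_eq) (auto simp: dual_add dual_scale subspace_scale)
    then show ?thesis using True by (simp add: const_on_def)
  qed (simp add: dir_deriv_def const_on_def)
qed

lemma dir_deriv_add:
  assumes "subspace V" "v \<in> V" "f \<in> Sym V" "g \<in> Sym V"
  shows "dir_deriv V v (\<lambda>x. f x + g x) = (\<lambda>x. dir_deriv V v f x + dir_deriv V v g x)"
proof
  fix x show "dir_deriv V v (\<lambda>x. f x + g x) x = dir_deriv V v f x + dir_deriv V v g x"
  proof (cases "x \<in> V")
    case True
    obtain p where p: "\<And>t. f (x + t *\<^sub>V v) = poly p t" using Sym_line[OF assms(3,1) True assms(2)] by blast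
    obtain q where q: "\<And>t. g (x + t *\<^sub>V v) = poly q t" using Sym_line[OF assms(4,1) True assms(2)] by blast
    have "dir_deriv V v (\<lambda>x. f x + g x) x = coeff (p + q) 1"
      by (rule dir_deriv_eq[OF True]) (simp add: p q)
    then show ?thesis by (simp add: dir_deriv_eq[OF True p] dir_deriv_eq[OF True q])
  qed (simp add: dir_deriv_def)
qed

lemma dir_deriv_mult:
  assumes "subspace V" "v \<in> V" "f \<in> Sym V" "g \<in> Sym V"
  shows "dir_deriv V v (\<lambda>x. f x * g x) = (\<lambda>x. dir_deriv V v f x * g x + f x * dir_deriv V v g x)"
proof
  fix x show "dir_deriv V v (\<lambda>x. f x * g x) x = dir_deriv V v f x * g x + f x * dir_deriv V v g x"
  proof (cases "x \<in> V")
    case True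
    obtain p where p: "\<And>t. f (x + t *\<^sub>V v) = poly p t" using Sym_line[OF assms(3,1) True assms(2)] by blast
    obtain q where q: "\<And>t. g (x + t *\<^sub>V v) = poly q t" using Sym_line[OF assms(4,1) True assms(2)] by blast
    have "dir_deriv V v (\<lambda>x. f x * g x) x = coeff (p * q) 1"
      by (rule dir_deriv_eq[OF True]) (simp add: p q)
    also have "\<dots> = coeff p 0 * coeff q 1 + coeff p 1 * coeff q 0" by (simp add: coeff_mult)
    also have "coeff p 0 = f x" using p[of 0] by (simp add: poly_0_coeff_0)
    also have "coeff q 0 = g x" using q[of 0] by (simp add: poly_0_coeff_0)
    finally show ?thesis by (simp add: dir_deriv_eq[OF True p] dir_deriv_eq[OF True q])
  qed (simp add: dir_deriv_def)
qed

lemma dir_deriv_Sym: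
  assumes "subspace V" "v \<in> V" "f \<in> Sym V"
  shows "dir_deriv V v f \<in> Sym V"
  using assms(3)
proof (induction rule: Sym.induct)
  case (const c)
  then show ?case by (simp add: dir_deriv_const assms Sym_0)
next
  case (form \<alpha>)
  then show ?case by (simp add: dir_deriv_form assms Sym.const)
next
  case (add f g)
  then show ?case by (simp add: dir_deriv_add assms Sym.add)
next
  case (mult f g)
  then show ?case unfolding dir_deriv_mult[OF assms(1,2) mult.hyps] by (intro Sym.add Sym.mult)
qed

text \<open>The vectors \<open>e k\<close> may be linearly dependent. This permits one vector for
  each vertex of \<open>I\<close>, although the differences of the forms span a space of dimension
  less than \<open>card I\<close>.\<close>

lemma vector_field_Der:
  assumes V: "subspace V" and e: "\<And>k. k \<in> K \<Longrightarrow> e k \<in> V" and h: "\<And>k. k \<in> K \<Longrightarrow> h k \<in> Sym V"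
  shows "\<exists>\<theta>\<in>Der V. \<forall>\<alpha>\<in>dual V. \<theta> \<alpha> = (\<lambda>x. \<Sum>k\<in>K. h k x * \<alpha> (e k))"
proof -
  define \<theta> where "\<theta> f = (if f \<in> Sym V then (\<lambda>x. \<Sum>k\<in>K. h k x * dir_deriv V (e k) f x) else (\<lambda>x. 0))" for f
  have cm: "dir_deriv V (e k) (\<lambda>x. c * f x) = (\<lambda>x. c * dir_deriv V (e k) f x)"
    if f: "f \<in> Sym V" and k: "k \<in> K" for c f k
  proof -
    have *: "(\<lambda>x. c * f x) = (\<lambda>x. const_on V c x * f x)"
      using Sym_outside[OF f] by (auto simp: const_on_def)
    show ?thesis unfolding * dir_deriv_mult[OF V e[OF k] Sym.const f]
      unfolding dir_deriv_const[OF V e[OF k]] by (auto simp: const_on_def dir_deriv_def)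
  qed
  have "\<theta> \<in> Der V"
    unfolding Der_def
  proof (intro CollectI conjI ballI allI impI)
    fix f assume f: "f \<in> Sym V"
    have "(\<lambda>x. \<Sum>k\<in>K. h k x * dir_deriv V (e k) f x) \<in> Sym V"
      by (intro Sym_sum Sym.mult h dir_deriv_Sym[OF V e f])
    then show "\<theta> f \<in> Sym V" using f by (simp add: \<theta>_def)
    show "\<theta> (\<lambda>x. c * f x) = (\<lambda>x. c * \<theta> f x)" for c
      by (simp add: \<theta>_def Sym_cmult f cm[OF f] sum_distrib_left mult_ac cong: sum.cong)
    fix g assume g: "g \<in> Sym V"
    show "\<theta> (\<lambda>x. f x + g x) = (\<lambda>x. \<theta> f x + \<theta> g x)"
      by (simp add: \<theta>_def Sym.add f g dir_deriv_add[OF V e f g] sum.distrib distrib_left cong: sum.cong)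
    show "\<theta> (\<lambda>x. f x * g x) = (\<lambda>x. \<theta> f x * g x + f x * \<theta> g x)"
      by (simp add: \<theta>_def Sym.mult f g dir_deriv_mult[OF V e f g] sum.distrib distrib_left
          sum_distrib_left sum_distrib_right mult_ac cong: sum.cong)
  next
    fix f assume "f \<notin> Sym V" then show "\<theta> f = (\<lambda>x. 0)" by (simp add: \<theta>_def)
  qed
  moreover have "\<theta> \<alpha> = (\<lambda>x. \<Sum>k\<in>K. h k x * \<alpha> (e k))" if \<alpha>: "\<alpha> \<in> dual V" for \<alpha>
  proof
    fix x
    have "h k x * const_on V (\<alpha> (e k)) x = h k x * \<alpha> (e k)" if "k \<in> K" for k
      using Sym_outside[OF h[OF that], of x] by (simp add: const_on_def)
    then have "(\<Sum>k\<in>K. h k x * const_on V (\<alpha> (e k)) x) = (\<Sum>k\<in>K. h k x * \<alpha> (e k))"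
      by (rule sum.cong[OF refl])
    then show "\<theta> \<alpha> x = (\<Sum>k\<in>K. h k x * \<alpha> (e k))"
      by (simp add: \<theta>_def Sym.form \<alpha> dir_deriv_form[OF V e \<alpha>] cong: sum.cong)
  qed
  ultimately show ?thesis by blast
qed

section \<open>Derivations and their values on linear forms\<close>

lemma Der_Sym: "\<theta> \<in> Der V \<Longrightarrow> f \<in> Sym V \<Longrightarrow> \<theta> f \<in> Sym V"
  and Der_add: "\<theta> \<in> Der V \<Longrightarrow> f \<in> Sym V \<Longrightarrow> g \<in> Sym V \<Longrightarrow> \<theta> (\<lambda>x. f x + g x) = (\<lambda>x. \<theta> f x + \<theta> g x)"
  and Der_cmult: "\<theta> \<in> Der V \<Longrightarrow> f \<in> Sym V \<Longrightarrow> \<theta> (\<lambda>x. c * f x) = (\<lambda>x. c * \<theta> f x)"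
  and Der_mult: "\<theta> \<in> Der V \<Longrightarrow> f \<in> Sym V \<Longrightarrow> g \<in> Sym V \<Longrightarrow>
      \<theta> (\<lambda>x. f x * g x) = (\<lambda>x. \<theta> f x * g x + f x * \<theta> g x)"
  and Der_outside: "\<theta> \<in> Der V \<Longrightarrow> f \<notin> Sym V \<Longrightarrow> \<theta> f = (\<lambda>x. 0)"
  unfolding Der_def by blast+

lemma Der_const:
  assumes "\<theta> \<in> Der V" shows "\<theta> (const_on V c) = (\<lambda>x. 0)"
proof -
  have "(\<lambda>x. const_on V 1 x * const_on V 1 x) = const_on V 1" by (auto simp: const_on_def)
  then have e: "\<theta> (const_on V 1) = (\<lambda>x. \<theta> (const_on V 1) x * const_on V 1 x + const_on V 1 x * \<theta> (const_on V 1) x)"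
    using Der_mult[OF assms Sym.const Sym.const, of 1 1] by simp
  have 1: "\<theta> (const_on V 1) = (\<lambda>x. 0)"
  proof
    fix x show "\<theta> (const_on V 1) x = 0"
      using fun_cong[OF e, of x] Sym_outside[OF Der_Sym[OF assms Sym.const], of x 1]
      by (cases "x \<in> V") (auto simp: const_on_def)
  qed
  have "(\<lambda>x. c * const_on V 1 x) = const_on V c" by (auto simp: const_on_def)
  then show ?thesis using Der_cmult[OF assms Sym.const, of c 1] 1 by simp
qed

lemma Der_sum:
  assumes "\<theta> \<in> Der V" "\<And>i. i \<in> K \<Longrightarrow> f i \<in> Sym V"
  shows "\<theta> (\<lambda>x. \<Sum>i\<in>K. c i * f i x) = (\<lambda>x. \<Sum>i\<in>K. c i * \<theta> (f i) x)"
  using assms(2)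
proof (induction K rule: infinite_finite_induct)
  case (insert i K)
  have *: "(\<lambda>x. \<Sum>i\<in>K. c i * f i x) \<in> Sym V" using insert by (intro Sym_sum Sym_cmult) auto
  have "\<theta> (\<lambda>x. c i * f i x + (\<Sum>i\<in>K. c i * f i x)) = (\<lambda>x. c i * \<theta> (f i) x + (\<Sum>i\<in>K. c i * \<theta> (f i) x))"
    using Der_add[OF assms(1) Sym_cmult[of "f i" V "c i"] *] Der_cmult[OF assms(1), of "f i"] insert by simp
  then show ?case using insert by simp
qed (use Der_const[OF assms(1), of 0] in \<open>auto simp: const_on_def\<close>)

lemma Der_dual_diff:
  assumes "\<theta> \<in> Der V" "\<alpha> \<in> dual V" "\<beta> \<in> dual V"
  shows "\<theta> (\<lambda>x. \<alpha> x - \<beta> x) = (\<lambda>x. \<theta> \<alpha> x - \<theta> \<beta> x)"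
  using Der_add[OF assms(1) Sym.form[OF assms(2)] Sym_cmult[OF Sym.form[OF assms(3)], of "-1"]]
    Der_cmult[OF assms(1) Sym.form[OF assms(3)], of "-1"] by simp

lemma Der_eqI:
  assumes \<theta>: "\<theta> \<in> Der V" "\<theta>' \<in> Der V" and eq: "\<And>\<alpha>. \<alpha> \<in> dual V \<Longrightarrow> \<theta> \<alpha> = \<theta>' \<alpha>"
  shows "\<theta> = \<theta>'"
proof
  fix f show "\<theta> f = \<theta>' f"
  proof (cases "f \<in> Sym V")
    case True
    then show ?thesis
    proof (induction rule: Sym.induct)
      case (const c) then show ?case using \<theta> by (simp add: Der_const)
    next
      case (form \<alpha>) then show ?case by (rule eq)
    next
      case (add f g) then show ?case using \<theta> by (simp add: Der_add)
    next
      case (mult f g) then show ?case using \<theta> by (simp add: Der_mult)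
    qed
  qed (use Der_outside \<theta> in auto)
qed

lemma Der_basis_form:
  assumes db: "dual_basis V n y u" and V: "subspace V" and \<theta>: "\<theta> \<in> Der V" and \<alpha>: "\<alpha> \<in> dual V"
  shows "\<theta> \<alpha> = (\<lambda>x. \<Sum>i=1..n. \<alpha> (u i) * \<theta> (y i) x)"
proof -
  have "\<theta> \<alpha> = \<theta> (\<lambda>x. \<Sum>i=1..n. \<alpha> (u i) * y i x)"
    by (rule arg_cong[OF dual_basis_form[OF db V \<alpha>]])
  also have "\<dots> = (\<lambda>x. \<Sum>i=1..n. \<alpha> (u i) * \<theta> (y i) x)"
    by (rule Der_sum[OF \<theta>]) (rule Sym.form[OF dual_basisD(1)[OF db]])
  finally show ?thesis .
qed

lemma Der_eqI_basis:
  assumes db: "dual_basis V n y u" and V: "subspace V"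
    and \<theta>: "\<theta> \<in> Der V" "\<theta>' \<in> Der V" and eq: "\<And>i. i \<in> {1..n} \<Longrightarrow> \<theta> (y i) = \<theta>' (y i)"
  shows "\<theta> = \<theta>'"
proof (rule Der_eqI[OF \<theta>])
  fix \<alpha> assume \<alpha>: "\<alpha> \<in> dual V"
  show "\<theta> \<alpha> = \<theta>' \<alpha>"
    unfolding Der_basis_form[OF db V \<theta>(1) \<alpha>] Der_basis_form[OF db V \<theta>(2) \<alpha>]
    by (intro ext sum.cong) (simp_all add: eq)
qed

lemma Der_lincomb:
  assumes "\<And>i. i \<in> K \<Longrightarrow> c i \<in> Sym V" "\<And>i. i \<in> K \<Longrightarrow> b i \<in> Der V"
  shows "(\<lambda>f x. \<Sum>i\<in>K. c i x * b i f x) \<in> Der V"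
  unfolding Der_def
proof (intro CollectI conjI ballI allI impI)
  fix f assume f: "f \<in> Sym V"
  show "(\<lambda>x. \<Sum>i\<in>K. c i x * b i f x) \<in> Sym V"
    using assms Der_Sym[OF _ f] by (intro Sym_sum Sym.mult) auto
  show "(\<lambda>x. \<Sum>i\<in>K. c i x * b i (\<lambda>x. a * f x) x) = (\<lambda>x. a * (\<Sum>i\<in>K. c i x * b i f x))" for a
    by (simp add: Der_cmult[OF assms(2) f] sum_distrib_left mult_ac cong: sum.cong)
  fix g assume g: "g \<in> Sym V"
  show "(\<lambda>x. \<Sum>i\<in>K. c i x * b i (\<lambda>x. f x + g x) x) = (\<lambda>x. (\<Sum>i\<in>K. c i x * b i f x) + (\<Sum>i\<in>K. c i x * b i g x))"
    by (simp add: Der_add[OF assms(2) f g] sum.distrib distrib_left cong: sum.cong)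
  show "(\<lambda>x. \<Sum>i\<in>K. c i x * b i (\<lambda>x. f x * g x) x) =
     (\<lambda>x. (\<Sum>i\<in>K. c i x * b i f x) * g x + f x * (\<Sum>i\<in>K. c i x * b i g x))"
    by (simp add: Der_mult[OF assms(2) f g] sum.distrib distrib_left
        sum_distrib_left sum_distrib_right mult_ac cong: sum.cong)
next
  fix f assume "f \<notin> Sym V"
  then show "(\<lambda>x. \<Sum>i\<in>K. c i x * b i f x) = (\<lambda>x. 0)"
    using Der_outside[OF assms(2)] by (intro ext sum.neutral) auto
qed

lemma Der_scale:
  assumes "g \<in> Sym V" "\<theta> \<in> Der V"
  shows "(\<lambda>f x. g x * \<theta> f x) \<in> Der V"
  using Der_lincomb[of "{()}" "\<lambda>_. g" V "\<lambda>_. \<theta>"] assms by simp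

lemma ex_Der_basis:
  assumes db: "dual_basis V n y u" and V: "subspace V" and h: "\<And>i. i \<in> {1..n} \<Longrightarrow> h i \<in> Sym V"
  shows "\<exists>\<theta>\<in>Der V. \<forall>i\<in>{1..n}. \<theta> (y i) = h i"
proof -
  obtain \<theta> where \<theta>: "\<theta> \<in> Der V" "\<And>\<alpha>. \<alpha> \<in> dual V \<Longrightarrow> \<theta> \<alpha> = (\<lambda>x. \<Sum>k=1..n. h k x * \<alpha> (u k))"
    using vector_field_Der[OF V, of "{1..n}" u h] dual_basisD(2)[OF db] h by blast
  have "\<theta> (y i) = h i" if i: "i \<in> {1..n}" for i
  proof -
    have "(\<Sum>k=1..n. h k x * y i (u k)) = (\<Sum>k=1..n. if k = i then h k x else 0)" for x
      by (rule sum.cong) (use dual_basisD(3)[OF db i] in auto)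
    then show ?thesis using \<theta>(2)[OF dual_basisD(1)[OF db i]] i by simp
  qed
  then show ?thesis using \<theta>(1) by blast
qed

lemma pdeg_basis:
  assumes db: "dual_basis V n y u" and V: "subspace V" and \<theta>: "\<theta> \<in> Der V"
    and h: "\<And>i. i \<in> {1..n} \<Longrightarrow> homogeneous V d (\<theta> (y i))"
  shows "pdeg V \<theta> d"
  unfolding pdeg_def
proof (intro conjI ballI \<theta>)
  fix \<alpha> assume \<alpha>: "\<alpha> \<in> dual V"
  show "homogeneous V d (\<theta> \<alpha>)"
    unfolding Der_basis_form[OF db V \<theta> \<alpha>] by (intro homogeneous_sum homogeneous_cmult h)
qed

end

section \<open>Potentials\<close>

context complex_space
begin

text \<open>\<open>R x\<close> is a product of \<open>d\<close> factors \<open>u x + t w x\<close> with forms \<open>u, w\<close>, as a polynomial in \<open>t\<close>.\<close>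

definition integral_homogeneous :: "'v set \<Rightarrow> nat \<Rightarrow> ('v \<Rightarrow> complex poly) \<Rightarrow> bool" where
  "integral_homogeneous V d R \<longleftrightarrow> (\<forall>g. homogeneous V d (restr V (\<lambda>x. unit_integral (g * R x))))"

lemma integral_homogeneous_1: "integral_homogeneous V 0 (\<lambda>x. 1)"
proof -
  have "restr V (\<lambda>x. unit_integral (g * 1)) = const_on V (unit_integral g)" for g
    by (auto simp: restr_def const_on_def)
  then show ?thesis by (simp add: integral_homogeneous_def homogeneous.const)
qed

text \<open>The factor \<open>u x + t w x\<close> splits the integral in two, and the
  \<open>t\<close> of the second part is absorbed into the weight as \<open>pCons 0 g\<close>. This
  is why the weight \<open>g\<close> is arbitrary in the definition.\<close>

lemma integral_homogeneous_step:
  assumes "u \<in> dual V" "w \<in> dual V" "integral_homogeneous V d R"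
  shows "integral_homogeneous V (Suc d) (\<lambda>x. [:u x, w x:] * R x)"
  unfolding integral_homogeneous_def
proof
  fix g
  have "homogeneous V (Suc d) (\<lambda>x. u x * restr V (\<lambda>x. unit_integral (g * R x)) x +
      w x * restr V (\<lambda>x. unit_integral (pCons 0 g * R x)) x)"
    using assms(3) unfolding integral_homogeneous_def
    by (intro homogeneous.add homogeneous.mult assms(1,2)) blast+
  also have "(\<lambda>x. u x * restr V (\<lambda>x. unit_integral (g * R x)) x +
      w x * restr V (\<lambda>x. unit_integral (pCons 0 g * R x)) x) =
      restr V (\<lambda>x. unit_integral (g * ([:u x, w x:] * R x)))"
  proof
    fix x
    have eq: "g * ([:u x, w x:] * R x) = smult (u x) (g * R x) + smult (w x) (pCons 0 g * R x)"
      by (simp add: algebra_simps)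
    show "u x * restr V (\<lambda>x. unit_integral (g * R x)) x +
      w x * restr V (\<lambda>x. unit_integral (pCons 0 g * R x)) x =
      restr V (\<lambda>x. unit_integral (g * ([:u x, w x:] * R x))) x"
      unfolding restr_def eq by (simp only: unit_integral_add unit_integral_smult) simp
  qed
  finally show "homogeneous V (Suc d) (restr V (\<lambda>x. unit_integral (g * ([:u x, w x:] * R x))))" .
qed

lemma integral_homogeneous_power:
  assumes "u \<in> dual V" "w \<in> dual V" "integral_homogeneous V d R"
  shows "integral_homogeneous V (k + d) (\<lambda>x. [:u x, w x:] ^ k * R x)"
proof (induction k)
  case (Suc k)
  from integral_homogeneous_step[OF assms(1,2) Suc] show ?case by (simp only: power_Suc mult.assoc add_Suc)
qed (use assms in simp)

lemma integral_homogeneous_prod: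
  assumes "finite K" "\<And>l. l \<in> K \<Longrightarrow> u l \<in> dual V" "w \<in> dual V"
  shows "integral_homogeneous V (\<Sum>l\<in>K. k l) (\<lambda>x. \<Prod>l\<in>K. [:u l x, w x:] ^ k l)"
  using assms(1,2)
proof (induction K rule: finite_induct)
  case empty
  then show ?case by (simp add: integral_homogeneous_1)
next
  case (insert l K)
  then have "integral_homogeneous V (k l + (\<Sum>l\<in>K. k l)) (\<lambda>x. [:u l x, w x:] ^ k l * (\<Prod>l\<in>K. [:u l x, w x:] ^ k l))"
    using assms(3) by (intro integral_homogeneous_power) auto
  then show ?case using insert.hyps by simp
qed

text \<open>
  \<open>h i\<close> is the integral of \<open>\<Prod>\<^sub>l (t - z\<^sub>l)\<^bsup>k l\<^esup>\<close> over \<open>t\<close> from \<open>0\<close> to \<open>z\<^sub>i\<close>; substituting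
  \<open>t = z\<^sub>j + s (z\<^sub>i - z\<^sub>j)\<close> shows the divisibility of \<open>h i - h j\<close>.
\<close>

lemma ex_integral_potential:
  fixes T :: "'i set" and z :: "'i \<Rightarrow> 'v \<Rightarrow> complex"
  assumes V: "subspace V" and T: "finite T" and z: "\<And>i. i \<in> T \<Longrightarrow> z i \<in> dual V"
  obtains h where "\<And>i. i \<in> T \<Longrightarrow> homogeneous V (Suc (\<Sum>l\<in>T. k l)) (h i)"
    and "\<And>i j. i \<in> T \<Longrightarrow> j \<in> T \<Longrightarrow> i \<noteq> j \<Longrightarrow> \<exists>u\<in>Sym V. \<exists>\<kappa>. \<kappa> \<noteq> 0 \<and>
        (\<forall>x. h i x - h j x = (z i x - z j x) ^ Suc (k i + k j) * u x) \<and>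
        (\<forall>x\<in>V. z i x = z j x \<longrightarrow> u x = \<kappa> * (\<Prod>l\<in>T - {i, j}. (z i x - z l x) ^ k l))"
    and "\<And>x i j. x \<in> V \<Longrightarrow> i \<in> T \<Longrightarrow> j \<in> T \<Longrightarrow> \<forall>l\<in>T. z l x \<in> {z i x, z j x} \<Longrightarrow> z i x \<noteq> z j x \<Longrightarrow>
        h i x \<noteq> h j x"
proof -
  define P where "P x = (\<Prod>l\<in>T. [:- z l x, 1:] ^ k l)" for x
  \<comment> \<open>The integral from 0 to z_i after t = s z_i; the leading \<open>z i x\<close> is
    the derivative of this substitution and contributes the extra degree.\<close>
  define h where "h i = restr V (\<lambda>x. z i x * unit_integral (P x \<circ>\<^sub>p [:0, z i x:]))" for i
  have pow: "(p ^ m) \<circ>\<^sub>p q = (p \<circ>\<^sub>p q) ^ m" for p q :: "complex poly" and m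
    by (induction m) (simp_all add: pcompose_mult pcompose_1)
  have pc: "(\<Prod>l\<in>A. [:f l:]) = [:\<Prod>l\<in>A. f l:]" for A :: "'i set" and f :: "'i \<Rightarrow> complex"
    by (induction A rule: infinite_finite_induct) (simp_all add: one_pCons)
  have Pc: "P x \<circ>\<^sub>p [:a, w:] = (\<Prod>l\<in>T. [:a - z l x, w:] ^ k l)" for x a w
    unfolding P_def pcompose_prod pow by (simp add: pcompose_pCons)
  have hom: "homogeneous V (Suc (\<Sum>l\<in>T. k l)) (h i)" if i: "i \<in> T" for i
  proof -
    have "integral_homogeneous V (\<Sum>l\<in>T. k l) (\<lambda>x. \<Prod>l\<in>T. [:-1 * z l x, z i x:] ^ k l)"
      by (intro integral_homogeneous_prod T dual_cmult z i V)
    then have "homogeneous V (\<Sum>l\<in>T. k l) (restr V (\<lambda>x. unit_integral (1 * (\<Prod>l\<in>T. [:-1 * z l x, z i x:] ^ k l))))"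
      unfolding integral_homogeneous_def by blast
    from homogeneous.mult[OF z[OF i] this]
    have "homogeneous V (Suc (\<Sum>l\<in>T. k l))
      (\<lambda>x. z i x * restr V (\<lambda>x. unit_integral (1 * (\<Prod>l\<in>T. [:-1 * z l x, z i x:] ^ k l))) x)" .
    also have "(\<lambda>x. z i x * restr V (\<lambda>x. unit_integral (1 * (\<Prod>l\<in>T. [:-1 * z l x, z i x:] ^ k l))) x) = h i"
      by (auto simp: h_def restr_def Pc)
    finally show ?thesis .
  qed
  have diff: "h i x - h j x = (z i x - z j x) * unit_integral (\<Prod>l\<in>T. [:z j x - z l x, z i x - z j x:] ^ k l)"
    if "x \<in> V" for i j x
    using that unit_integral_diff[of "z i x" "P x" "z j x"] by (simp add: h_def restr_def Pc)
  \<comment> \<open>After t = z_j + s w with w = z_i - z_j, the factors for j and i become w s and w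
    (s - 1). Together with the \<open>w\<close> of the substitution they account for the exponent k
    i + k j + 1.\<close>
  have fac0: "[:0, w:] = smult w [:0, 1:]" and fac1: "[:- w, w:] = smult w [:-1, 1:]" for w :: complex by simp_all
  have H2: "\<exists>u\<in>Sym V. \<exists>\<kappa>. \<kappa> \<noteq> 0 \<and>
        (\<forall>x. h i x - h j x = (z i x - z j x) ^ Suc (k i + k j) * u x) \<and>
        (\<forall>x\<in>V. z i x = z j x \<longrightarrow> u x = \<kappa> * (\<Prod>l\<in>T - {i, j}. (z i x - z l x) ^ k l))"
    if ij: "i \<in> T" "j \<in> T" "i \<noteq> j" for i j
  proof -
    define w where "w x = z i x - z j x" for x
    \<comment> \<open>What remains of the factors for i and j; its integral is the constant
      \<kappa>.\<close>
    define g :: "complex poly" where "g = [:0, 1:] ^ k j * [:-1, 1:] ^ k i"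
    define R where "R x = (\<Prod>l\<in>T - {i, j}. [:z j x - z l x, w x:] ^ k l)" for x
    define u where "u = restr V (\<lambda>x. unit_integral (g * R x))"
    have "integral_homogeneous V (\<Sum>l\<in>T - {i, j}. k l) (\<lambda>x. \<Prod>l\<in>T - {i, j}. [:z j x - z l x, w x:] ^ k l)"
      unfolding w_def using T z ij V by (intro integral_homogeneous_prod dual_minus) auto
    then have u: "u \<in> Sym V"
      unfolding integral_homogeneous_def u_def R_def using homogeneous_Sym by blast
    have prod: "(\<Prod>l\<in>T. [:z j x - z l x, z i x - z j x:] ^ k l) = smult (w x ^ (k i + k j)) (g * R x)" for x
    proof -
      have "T = insert i (insert j (T - {i, j}))" using ij by auto
      then have "(\<Prod>l\<in>T. [:z j x - z l x, w x:] ^ k l) =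
          (\<Prod>l\<in>insert i (insert j (T - {i, j})). [:z j x - z l x, w x:] ^ k l)" by simp
      also have "\<dots> = [:z j x - z i x, w x:] ^ k i * ([:0, w x:] ^ k j * R x)"
        unfolding R_def using ij T by (subst prod.insert; simp)+
      also have "z j x - z i x = - w x" by (simp add: w_def)
      also have "[:- w x, w x:] ^ k i = smult (w x ^ k i) ([:-1, 1:] ^ k i)"
        by (subst fac1) (simp only: smult_power)
      also have "[:0, w x:] ^ k j = smult (w x ^ k j) ([:0, 1:] ^ k j)"
        by (subst fac0) (simp only: smult_power)
      finally show ?thesis unfolding w_def[symmetric]
        by (simp add: g_def power_add mult_ac)
    qed
    have 1: "h i x - h j x = (z i x - z j x) ^ Suc (k i + k j) * u x" for x
    proof (cases "x \<in> V")
      case True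
      then show ?thesis by (simp add: diff prod unit_integral_smult u_def restr_def w_def)
    qed (simp add: u_def h_def restr_def)
    \<comment> \<open>For z_i = z_j the interval of integration degenerates, and all factors in
      \<open>R\<close> are constant in the integration variable.\<close>
    have 2: "u x = unit_integral g * (\<Prod>l\<in>T - {i, j}. (z i x - z l x) ^ k l)" if x: "x \<in> V" "z i x = z j x" for x
    proof -
      have "R x = (\<Prod>l\<in>T - {i, j}. [:(z i x - z l x) ^ k l:])"
        unfolding R_def w_def using x by (intro prod.cong refl) (simp add: poly_const_pow)
      also have "\<dots> = [:\<Prod>l\<in>T - {i, j}. (z i x - z l x) ^ k l:]"
        by (rule pc)
      finally show ?thesis using x by (simp add: u_def restr_def unit_integral_smult)
    qed
    have "unit_integral g \<noteq> 0" unfolding g_def by (rule unit_integral_beta_nonzero)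
    with u 1 2 show ?thesis by blast
  qed
  \<comment> \<open>When the z_l take only the two end values, the integrand is a power of
    \<open>w\<close> times a Beta integrand.\<close>
  have H3: "h i x \<noteq> h j x"
    if x: "x \<in> V" "\<forall>l\<in>T. z l x \<in> {z i x, z j x}" "z i x \<noteq> z j x" for x i j
  proof -
    define w where "w = z i x - z j x"
    define A where "A = {l\<in>T. z l x = z j x}"
    define B where "B = {l\<in>T. z l x = z i x}"
    have AB: "T = A \<union> B" "A \<inter> B = {}" "finite A" "finite B" using x T unfolding A_def B_def by auto
    have "(\<Prod>l\<in>T. [:z j x - z l x, w:] ^ k l) = (\<Prod>l\<in>A. [:0, w:] ^ k l) * (\<Prod>l\<in>B. [:- w, w:] ^ k l)"
      unfolding AB(1) using AB
      by (subst prod.union_disjoint) (auto intro!: arg_cong2[of _ _ _ _ times] prod.cong simp: A_def B_def w_def)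
    also have "\<dots> = [:0, w:] ^ sum k A * [:- w, w:] ^ sum k B" by (simp only: power_sum)
    also have "[:0, w:] ^ sum k A = smult (w ^ sum k A) ([:0, 1:] ^ sum k A)"
      by (subst fac0) (simp only: smult_power)
    also have "[:- w, w:] ^ sum k B = smult (w ^ sum k B) ([:-1, 1:] ^ sum k B)"
      by (subst fac1) (simp only: smult_power)
    also have "smult (w ^ sum k A) ([:0, 1:] ^ sum k A) * smult (w ^ sum k B) ([:-1, 1:] ^ sum k B) =
        smult (w ^ (sum k A + sum k B)) ([:0, 1:] ^ sum k A * [:-1, 1:] ^ sum k B)"
            by (simp add: power_add mult_ac)
    finally have "h i x - h j x = w * (w ^ (sum k A + sum k B) * unit_integral ([:0, 1:] ^ sum k A * [:-1, 1:] ^ sum k B))"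
      using diff[OF x(1)] by (simp add: w_def unit_integral_smult)
    moreover have "w \<noteq> 0" using x by (simp add: w_def)
    ultimately have "h i x - h j x \<noteq> 0" using unit_integral_beta_nonzero by simp
    then show ?thesis by simp
  qed
  show ?thesis by (rule that[of h]) (rule hom H2 H3; assumption)+
qed

lemma sdvd_power_le:
  assumes q: "q \<in> Sym V" and d: "sdvd V (\<lambda>x. q x ^ m) f" and le: "k \<le> m"
  shows "sdvd V (\<lambda>x. q x ^ k) f"
proof -
  obtain g where g: "g \<in> Sym V" "\<And>x. f x = q x ^ m * g x" using d by (auto elim: sdvdE)
  show ?thesis
  proof (rule sdvdI[OF Sym_power_mult[OF q g(1)]])
    show "f x = q x ^ k * (q x ^ (m - k) * g x)" for x
      using le by (simp add: g(2) mult.assoc[symmetric] power_add[symmetric])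
  qed
qed

text \<open>The differences with \<open>v\<close> must be divisible by exactly prescribed powers,
  while those among other vertices gain one whether or not there is an edge. Lowering the exponent
  at \<open>v\<close> by one and raising those in \<open>J\<close> achieves this, and the degree
  becomes the total of \<open>n\<close> plus \<open>card J\<close>.\<close>

lemma ex_vertex_potential:
  fixes T :: "'i set" and n :: "'i \<Rightarrow> nat" and z :: "'i \<Rightarrow> 'v \<Rightarrow> complex"
  assumes V: "subspace V" and T: "finite T" and z: "\<And>i. i \<in> T \<Longrightarrow> z i \<in> dual V"
    and v: "v \<in> T" and J: "J \<subseteq> T - {v}"
  defines "n' \<equiv> \<lambda>l. n l + (if l \<in> J then 1 else 0 :: nat)"
  obtains h where "\<And>i. i \<in> T \<Longrightarrow> homogeneous V ((\<Sum>l\<in>T. n l) + card J) (h i)"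
    and "\<And>i j. i \<in> T - {v} \<Longrightarrow> j \<in> T - {v} \<Longrightarrow> i \<noteq> j \<Longrightarrow>
        sdvd V (\<lambda>x. (z i x - z j x) ^ Suc (n i + n j)) (\<lambda>x. h i x - h j x)"
    and "\<And>j. j \<in> T - {v} \<Longrightarrow> \<exists>u\<in>Sym V. \<exists>\<kappa>. \<kappa> \<noteq> 0 \<and>
        (\<forall>x. h v x - h j x = (z v x - z j x) ^ (n v + n' j) * u x) \<and>
        (\<forall>x\<in>V. z v x = z j x \<longrightarrow> u x = \<kappa> * (\<Prod>l\<in>T - {v, j}. (z v x - z l x) ^ n' l))"
    and "\<And>x j. x \<in> V \<Longrightarrow> j \<in> T - {v} \<Longrightarrow> \<forall>l\<in>T - {v}. z l x = z j x \<Longrightarrow> z v x \<noteq> z j x \<Longrightarrow> h v x \<noteq> h j x"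
proof -
  have sumJ: "(\<Sum>l\<in>T. n' l) = (\<Sum>l\<in>T. n l) + card J"
  proof -
    have "{l\<in>T. l \<in> J} = J" using J by auto
    then have "(\<Sum>l\<in>T. if l \<in> J then 1 else 0 :: nat) = card J"
      using T by (simp add: sum.If_cases Int_def)
    then show ?thesis by (simp add: n'_def sum.distrib)
  qed
  have n'v: "n' v = n v" using J by (auto simp: n'_def)
  show ?thesis
  proof (cases "n v = 0")
    case True
    \<comment> \<open>For \<open>n v = 0\<close> the exponent at \<open>v\<close> would be -1. The
      substitute is supported at \<open>v\<close> alone, and the differences among the other
      vertices are zero.\<close>
    define h where "h i = (if i = v then restr V (\<lambda>x. \<Prod>l\<in>T - {v}. (z v x - z l x) ^ n' l) else (\<lambda>x. 0))" for i
    have "homogeneous V (\<Sum>l\<in>T - {v}. n' l) (restr V (\<lambda>x. \<Prod>l\<in>T - {v}. (z v x - z l x) ^ n' l))"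
      using T z v V by (intro homogeneous_prod_powers dual_minus) auto
    moreover have "(\<Sum>l\<in>T - {v}. n' l) = (\<Sum>l\<in>T. n l) + card J"
      using T v True n'v sum.remove[OF T v, of n'] sumJ by simp
    ultimately have H1: "homogeneous V ((\<Sum>l\<in>T. n l) + card J) (h i)" for i
      by (simp add: h_def homogeneous_0)
    have H2: "sdvd V (\<lambda>x. (z i x - z j x) ^ Suc (n i + n j)) (\<lambda>x. h i x - h j x)"
      if "i \<in> T - {v}" "j \<in> T - {v}" "i \<noteq> j" for i j
      using that by (intro sdvdI[OF Sym_0]) (simp add: h_def)
    have H3: "\<exists>u\<in>Sym V. \<exists>\<kappa>. \<kappa> \<noteq> 0 \<and>
        (\<forall>x. h v x - h j x = (z v x - z j x) ^ (n v + n' j) * u x) \<and>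
        (\<forall>x\<in>V. z v x = z j x \<longrightarrow> u x = \<kappa> * (\<Prod>l\<in>T - {v, j}. (z v x - z l x) ^ n' l))"
      if j: "j \<in> T - {v}" for j
    proof (intro bexI[of _ "restr V (\<lambda>x. \<Prod>l\<in>T - {v, j}. (z v x - z l x) ^ n' l)"] exI[of _ 1] conjI allI ballI impI)
      have "homogeneous V (\<Sum>l\<in>T - {v, j}. n' l) (restr V (\<lambda>x. \<Prod>l\<in>T - {v, j}. (z v x - z l x) ^ n' l))"
        using T z v V by (intro homogeneous_prod_powers dual_minus) auto
      then show "restr V (\<lambda>x. \<Prod>l\<in>T - {v, j}. (z v x - z l x) ^ n' l) \<in> Sym V" by (rule homogeneous_Sym)
      fix x
      have "T - {v} = insert j (T - {v, j})" using j by auto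
      then have "(\<Prod>l\<in>T - {v}. (z v x - z l x) ^ n' l) = (z v x - z j x) ^ n' j * (\<Prod>l\<in>T - {v, j}. (z v x - z l x) ^ n' l)"
        using T by simp
      then show "h v x - h j x = (z v x - z j x) ^ (n v + n' j) * restr V (\<lambda>x. \<Prod>l\<in>T - {v, j}. (z v x - z l x) ^ n' l) x"
        using j True by (simp add: h_def restr_def)
    qed (auto simp: restr_def)
    have H4: "h v x \<noteq> h j x" if "x \<in> V" "j \<in> T - {v}" "\<forall>l\<in>T - {v}. z l x = z j x" "z v x \<noteq> z j x" for x j
    proof -
      have "(\<Prod>l\<in>T - {v}. (z v x - z l x) ^ n' l) = (\<Prod>l\<in>T - {v}. (z v x - z j x) ^ n' l)"
        by (rule prod.cong[OF refl]) (metis that(3))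
      also have "\<dots> \<noteq> 0" using that(4) T by simp
      finally show ?thesis using that(1,2) by (simp add: h_def restr_def)
    qed
    show ?thesis by (rule that[of h]) (rule H1 H2 H3 H4; assumption)+
  next
    case False
    define k where "k l = (if l = v then n v - 1 else n' l)" for l
    obtain h where h1: "\<And>i. i \<in> T \<Longrightarrow> homogeneous V (Suc (\<Sum>l\<in>T. k l)) (h i)"
      and h2: "\<And>i j. i \<in> T \<Longrightarrow> j \<in> T \<Longrightarrow> i \<noteq> j \<Longrightarrow> \<exists>u\<in>Sym V. \<exists>\<kappa>. \<kappa> \<noteq> 0 \<and>
        (\<forall>x. h i x - h j x = (z i x - z j x) ^ Suc (k i + k j) * u x) \<and>
        (\<forall>x\<in>V. z i x = z j x \<longrightarrow> u x = \<kappa> * (\<Prod>l\<in>T - {i, j}. (z i x - z l x) ^ k l))"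
      and h3: "\<And>x i j. x \<in> V \<Longrightarrow> i \<in> T \<Longrightarrow> j \<in> T \<Longrightarrow> \<forall>l\<in>T. z l x \<in> {z i x, z j x} \<Longrightarrow> z i x \<noteq> z j x \<Longrightarrow>
        h i x \<noteq> h j x"
      by (rule ex_integral_potential[OF V T z]) (assumption | rule that)+
    have "Suc (\<Sum>l\<in>T. k l) = (\<Sum>l\<in>T. n l) + card J"
    proof -
      have "(\<Sum>l\<in>T - {v}. k l) = (\<Sum>l\<in>T - {v}. n' l)" by (rule sum.cong) (auto simp: k_def)
      then show ?thesis
        using False n'v sum.remove[OF T v, of n'] sum.remove[OF T v, of k] sumJ by (simp add: k_def)
    qed
    then have H1: "homogeneous V ((\<Sum>l\<in>T. n l) + card J) (h i)" if "i \<in> T" for i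
      using h1 that by simp
    have H2: "sdvd V (\<lambda>x. (z i x - z j x) ^ Suc (n i + n j)) (\<lambda>x. h i x - h j x)"
      if ij: "i \<in> T - {v}" "j \<in> T - {v}" "i \<noteq> j" for i j
    proof (rule sdvd_power_le)
      show "(\<lambda>x. z i x - z j x) \<in> Sym V" using ij z V by (intro Sym.form dual_minus) auto
      obtain u where "u \<in> Sym V" "\<And>x. h i x - h j x = (z i x - z j x) ^ Suc (k i + k j) * u x"
        using h2[of i j] ij by blast
      then show "sdvd V (\<lambda>x. (z i x - z j x) ^ Suc (k i + k j)) (\<lambda>x. h i x - h j x)" by (rule sdvdI)
      show "Suc (n i + n j) \<le> Suc (k i + k j)" using ij by (auto simp: k_def n'_def)
    qed
    have H3: "\<exists>u\<in>Sym V. \<exists>\<kappa>. \<kappa> \<noteq> 0 \<and>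
        (\<forall>x. h v x - h j x = (z v x - z j x) ^ (n v + n' j) * u x) \<and>
        (\<forall>x\<in>V. z v x = z j x \<longrightarrow> u x = \<kappa> * (\<Prod>l\<in>T - {v, j}. (z v x - z l x) ^ n' l))"
      if j: "j \<in> T - {v}" for j
    proof -
      have a: "Suc (k v + k j) = n v + n' j" using j False by (simp add: k_def)
      have b: "(\<Prod>l\<in>T - {v, j}. (z v x - z l x) ^ k l) = (\<Prod>l\<in>T - {v, j}. (z v x - z l x) ^ n' l)" for x
        by (rule prod.cong) (auto simp: k_def)
      have "j \<in> T" "v \<noteq> j" using j by auto
      from h2[OF v this] show ?thesis unfolding a b .
    qed
    have H4: "h v x \<noteq> h j x" if "x \<in> V" "j \<in> T - {v}" "\<forall>l\<in>T - {v}. z l x = z j x" "z v x \<noteq> z j x" for x j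
    proof (rule h3[OF that(1) v _ ballI that(4)])
      show "j \<in> T" using that(2) by simp
      show "z l x \<in> {z v x, z j x}" if "l \<in> T" for l
        using \<open>\<forall>l\<in>T - {v}. z l x = z j x\<close>[THEN bspec, of l] that by (cases "l = v") simp_all
    qed
    show ?thesis by (rule that[of h]) (rule H1 H2 H3 H4; assumption)+
  qed
qed

end

section \<open>Bases of modules of logarithmic derivations\<close>

context complex_space
begin

text \<open>Comparing the scaling laws of \<open>q\<close> and of the product gives c^m q(x) g(cx) =
  c^p q(x) g(x), and \<open>q\<close> can be cancelled.\<close>

lemma homogeneous_quotient:
  assumes V: "subspace V" and q: "homogeneous V m q" "q a \<noteq> 0" and g: "g \<in> Sym V"
    and f: "homogeneous V p (\<lambda>x. q x * g x)"
  shows "m \<le> p \<Longrightarrow> homogeneous V (p - m) g" and "p < m \<Longrightarrow> g = (\<lambda>x. 0)"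
proof -
  have "c ^ m * g (c *\<^sub>V x) = c ^ p * g x" if c: "c \<noteq> 0" and x: "x \<in> V" for c x
  proof -
    \<comment> \<open>Cancellation works for elements of \<open>Sym V\<close> only, not pointwise,
      as \<open>q\<close> has zeros; so x \<mapsto> g (c x) must be polynomial.\<close>
    have "restr V (\<lambda>x. g (c *\<^sub>V x)) \<in> Sym V"
    proof (rule Sym_pullback[OF g])
      show "x \<in> V \<Longrightarrow> c *\<^sub>V x \<in> V" for x using V by (rule subspace_scale)
      show "restr V (\<lambda>x. \<alpha> (c *\<^sub>V x)) \<in> dual V" if "\<alpha> \<in> dual V" for \<alpha>
      proof -
        have "restr V (\<lambda>x. \<alpha> (c *\<^sub>V x)) = (\<lambda>x. c * \<alpha> x)"
          using that by (auto simp: restr_def dual_scale dual_outside)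
        then show ?thesis using dual_cmult[OF that V] by simp
      qed
    qed
    then have "(\<lambda>x. c ^ m * restr V (\<lambda>x. g (c *\<^sub>V x)) x) \<in> Sym V" by (rule Sym_cmult)
    then have "(\<lambda>x. c ^ m * restr V (\<lambda>x. g (c *\<^sub>V x)) x) = (\<lambda>x. c ^ p * g x)"
    proof (rule Sym_cancel[OF V homogeneous_Sym[OF q(1)] q(2) _ Sym_cmult[OF g], where k = 1])
      fix x assume x: "x \<in> V"
      have "q (c *\<^sub>V x) * g (c *\<^sub>V x) = c ^ p * (q x * g x)" by (rule homogeneous_scale[OF f V x])
      then show "q x ^ 1 * (c ^ m * restr V (\<lambda>x. g (c *\<^sub>V x)) x) = q x ^ 1 * (c ^ p * g x)"
        using homogeneous_scale[OF q(1) V x, of c] x by (simp add: restr_def mult_ac)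
    qed
    from fun_cong[OF this, of x] show ?thesis using x by (simp add: restr_def)
  qed
  from homogeneous_of_scaling[OF V g this]
  show "m \<le> p \<Longrightarrow> homogeneous V (p - m) g" and "p < m \<Longrightarrow> g = (\<lambda>x. 0)" by blast+
qed

lemma module_basisI:
  assumes b: "\<And>i. i \<in> {1..r} \<Longrightarrow> b i \<in> D"
    and gen: "\<And>\<theta>. \<theta> \<in> D \<Longrightarrow> \<exists>c. (\<forall>i\<in>{1..r}. c i \<in> Sym V) \<and> \<theta> = (\<lambda>f x. \<Sum>i=1..r. c i x * b i f x)"
    and ind: "\<And>c i. \<forall>i\<in>{1..r}. c i \<in> Sym V \<Longrightarrow> (\<And>f x. (\<Sum>i=1..r. c i x * b i f x) = 0) \<Longrightarrow>
      i \<in> {1..r} \<Longrightarrow> c i = (\<lambda>x. 0)"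
  shows "module_basis V D r b"
  unfolding module_basis_def
proof (intro conjI ballI b, assumption)
  fix \<theta> assume "\<theta> \<in> D"
  then obtain c where c: "\<forall>i\<in>{1..r}. c i \<in> Sym V" "\<theta> = (\<lambda>f x. \<Sum>i=1..r. c i x * b i f x)" using gen by blast
  define c' where "c' i = (if i \<in> {1..r} then c i else (\<lambda>x. 0))" for i
  have c': "(\<forall>i\<in>{1..r}. c' i \<in> Sym V) \<and> (\<forall>i. i \<notin> {1..r} \<longrightarrow> c' i = (\<lambda>x. 0)) \<and>
      \<theta> = (\<lambda>f x. \<Sum>i=1..r. c' i x * b i f x)"
  proof -
    have "(\<Sum>i=1..r. c i x * b i f x) = (\<Sum>i=1..r. c' i x * b i f x)" for f x
      by (rule sum.cong) (simp_all add: c'_def)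
    then show ?thesis using c by (simp add: c'_def)
  qed
  show "\<exists>!c. (\<forall>i\<in>{1..r}. c i \<in> Sym V) \<and> (\<forall>i. i \<notin> {1..r} \<longrightarrow> c i = (\<lambda>x. 0)) \<and>
                  \<theta> = (\<lambda>f x. \<Sum>i=1..r. c i x * b i f x)"
  proof (rule ex1I, rule c')
    fix e assume e: "(\<forall>i\<in>{1..r}. e i \<in> Sym V) \<and> (\<forall>i. i \<notin> {1..r} \<longrightarrow> e i = (\<lambda>x. 0)) \<and>
                  \<theta> = (\<lambda>f x. \<Sum>i=1..r. e i x * b i f x)"
    show "e = c'"
    proof
      fix i show "e i = c' i"
      proof (cases "i \<in> {1..r}")
        case True
        have "(\<lambda>x. e i x - c' i x) = (\<lambda>x. 0)"
        proof (rule ind[of "\<lambda>i x. e i x - c' i x", OF _ _ True])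
          show "\<forall>i\<in>{1..r}. (\<lambda>x. e i x - c' i x) \<in> Sym V" using e c' by (auto intro: Sym_minus)
          fix f x
          have "(\<Sum>i=1..r. e i x * b i f x) = (\<Sum>i=1..r. c' i x * b i f x)"
            using e c' by (metis (no_types, lifting))
          then show "(\<Sum>i=1..r. (e i x - c' i x) * b i f x) = 0"
            by (simp add: left_diff_distrib sum_subtractf)
        qed
        then show ?thesis by (auto simp: fun_eq_iff)
      next
        case False
        then have "c' i = (\<lambda>x. 0)" by (simp only: c'_def if_False)
        then show ?thesis using e False by metis
      qed
    qed
  qed
qed

lemma module_basis_mem: "module_basis V D r b \<Longrightarrow> i \<in> {1..r} \<Longrightarrow> b i \<in> D"
  unfolding module_basis_def by blast

lemma module_basis_generate:
  assumes "module_basis V D r b" "\<theta> \<in> D"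
  obtains c where "\<And>i. i \<in> {1..r} \<Longrightarrow> c i \<in> Sym V" "\<theta> = (\<lambda>f x. \<Sum>i=1..r. c i x * b i f x)"
  using assms unfolding module_basis_def by blast

text \<open>The zero derivation is represented by \<open>c\<close> and by zero coefficients, so
  uniqueness applies. This is why \<open>D\<close> has to contain it.\<close>

lemma module_basis_independent:
  assumes mb: "module_basis V D r b" and zero: "(\<lambda>f x. 0) \<in> D"
    and c: "\<And>i. i \<in> {1..r} \<Longrightarrow> c i \<in> Sym V" and s: "\<And>f x. (\<Sum>i=1..r. c i x * b i f x) = 0"
    and i: "i \<in> {1..r}"
  shows "c i = (\<lambda>x. 0)"
proof -
  define c' where "c' i = (if i \<in> {1..r} then c i else (\<lambda>x. 0))" for i
  define z :: "nat \<Rightarrow> 'v \<Rightarrow> complex" where "z = (\<lambda>i x. 0)"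
  let ?P = "\<lambda>c. (\<forall>i\<in>{1..r}. c i \<in> Sym V) \<and> (\<forall>i. i \<notin> {1..r} \<longrightarrow> c i = (\<lambda>x. 0)) \<and>
                  (\<lambda>f x. 0) = (\<lambda>f x. \<Sum>i=1..r. c i x * b i f x)"
  have "(\<Sum>i=1..r. c' i x * b i f x) = (\<Sum>i=1..r. c i x * b i f x)" for f x
    by (rule sum.cong) (auto simp: c'_def)
  then have "?P c'" using c s by (simp add: c'_def)
  moreover have "?P z" by (simp add: z_def Sym_0)
  moreover have "\<exists>!c. ?P c" using mb zero unfolding module_basis_def by blast
  ultimately have "c' = z" by blast
  then show ?thesis using i by (auto simp: c'_def z_def fun_eq_iff split: if_splits)
qed

lemma same_kernel_proportional:
  assumes V: "subspace V" and \<alpha>: "\<alpha> \<in> dual V" "\<alpha> a \<noteq> 0" and \<beta>: "\<beta> \<in> dual V"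
    and ker: "ker_on V \<beta> = ker_on V \<alpha>"
  obtains c where "c \<noteq> 0" "\<beta> = (\<lambda>x. c * \<alpha> x)"
proof -
  obtain v where v: "v \<in> V" "\<alpha> v = 1" using ex_dual_one[OF \<alpha>(1) V \<alpha>(2)] by blast
  have "v \<notin> ker_on V \<beta>" unfolding ker using v by (simp add: ker_on_def)
  then have c: "\<beta> v \<noteq> 0" using v by (simp add: ker_on_def)
  have "\<beta> x = \<beta> v * \<alpha> x" for x
  proof (cases "x \<in> V")
    case True
    then have "x - \<alpha> x *\<^sub>V v \<in> ker_on V \<beta>" unfolding ker by (rule projection_facts(1)[OF V \<alpha>(1) v])
    then show ?thesis using True \<beta> V v
      by (simp add: ker_on_def dual_diff dual_scale subspace_scale mult.commute)
  qed (simp add: dual_outside[OF \<alpha>(1)] dual_outside[OF \<beta>])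
  with c show ?thesis using that by blast
qed

section \<open>Logarithmic derivations\<close>

lemma log_der_Der: "\<theta> \<in> log_der V M \<Longrightarrow> \<theta> \<in> Der V"
  by (simp add: log_der_def)

lemma log_der_dvd:
  assumes "\<theta> \<in> log_der V M" "\<alpha> \<in> dual V"
  shows "sdvd V (\<lambda>x. \<alpha> x ^ count M (ker_on V \<alpha>)) (\<theta> \<alpha>)"
proof (cases "ker_on V \<alpha> \<in># M")
  case True
  then have "\<exists>g\<in>Sym V. \<theta> \<alpha> = (\<lambda>x. \<alpha> x ^ count M (ker_on V \<alpha>) * g x)"
    using assms unfolding log_der_def by blast
  then show ?thesis unfolding sdvd_def .
next
  case False
  then show ?thesis using Der_Sym[OF log_der_Der[OF assms(1)] Sym.form[OF assms(2)]]
    by (intro sdvdI[of "\<theta> \<alpha>"]) (auto simp: not_in_iff)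
qed

text \<open>One form per hyperplane suffices: every other form with the same kernel is a scalar
  multiple, and the scalar is absorbed into the quotient.\<close>

lemma log_derI:
  assumes V: "subspace V" and \<theta>: "\<theta> \<in> Der V"
    and A: "\<And>H. H \<in># M \<Longrightarrow> \<exists>\<alpha>\<in>dual V. (\<exists>x. \<alpha> x \<noteq> 0) \<and> H = ker_on V \<alpha> \<and> sdvd V (\<lambda>x. \<alpha> x ^ count M H) (\<theta> \<alpha>)"
  shows "\<theta> \<in> log_der V M"
  unfolding log_der_def
proof (intro CollectI conjI ballI impI \<theta>)
  fix H \<beta> assume H: "H \<in># M" and \<beta>: "\<beta> \<in> dual V" "ker_on V \<beta> = H"
  obtain \<alpha> a g where \<alpha>: "\<alpha> \<in> dual V" "\<alpha> a \<noteq> 0" "H = ker_on V \<alpha>"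
    and g: "g \<in> Sym V" "\<And>x. \<theta> \<alpha> x = \<alpha> x ^ count M H * g x"
    using A[OF H] by (auto elim!: sdvdE)
  obtain c where c: "c \<noteq> 0" "\<beta> = (\<lambda>x. c * \<alpha> x)"
    using same_kernel_proportional[OF V \<alpha>(1,2) \<beta>(1)] \<alpha>(3) \<beta>(2) by metis
  have "\<theta> \<beta> = (\<lambda>x. \<beta> x ^ count M H * (c / c ^ count M H * g x))"
    unfolding c(2) Der_cmult[OF \<theta> Sym.form[OF \<alpha>(1)]] using c(1) by (auto simp: g(2) power_mult_distrib)
  then show "\<exists>g\<in>Sym V. \<theta> \<beta> = (\<lambda>x. \<beta> x ^ count M H * g x)"
    using Sym_cmult[OF g(1)] by (intro bexI[of _ "\<lambda>x. c / c ^ count M H * g x"])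
qed

lemma zero_Der: "(\<lambda>f x. 0) \<in> Der V"
  by (simp add: Der_def Sym_0)

lemma zero_log_der: "(\<lambda>f x. 0) \<in> log_der V M"
  unfolding log_der_def using zero_Der Sym_0 by fastforce

lemma log_der_lincomb:
  assumes c: "\<And>i. i \<in> K \<Longrightarrow> c i \<in> Sym V" and b: "\<And>i. i \<in> K \<Longrightarrow> b i \<in> log_der V M"
  shows "(\<lambda>f x. \<Sum>i\<in>K. c i x * b i f x) \<in> log_der V M"
  unfolding log_der_def
proof (intro CollectI conjI ballI impI)
  show "(\<lambda>f x. \<Sum>i\<in>K. c i x * b i f x) \<in> Der V"
    by (intro Der_lincomb c log_der_Der[OF b])
  fix H \<alpha> assume H: "H \<in># M" "\<alpha> \<in> dual V" "ker_on V \<alpha> = H"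
  have "\<exists>g. i \<in> K \<longrightarrow> g \<in> Sym V \<and> b i \<alpha> = (\<lambda>x. \<alpha> x ^ count M H * g x)" for i
    using b[of i] H unfolding log_der_def by blast
  then obtain g where g: "\<And>i. i \<in> K \<Longrightarrow> g i \<in> Sym V" "\<And>i. i \<in> K \<Longrightarrow> b i \<alpha> = (\<lambda>x. \<alpha> x ^ count M H * g i x)"
    by metis
  show "\<exists>g\<in>Sym V. (\<lambda>x. \<Sum>i\<in>K. c i x * b i \<alpha> x) = (\<lambda>x. \<alpha> x ^ count M H * g x)"
  proof (intro bexI ext)
    show "(\<lambda>x. \<Sum>i\<in>K. c i x * g i x) \<in> Sym V" using c g(1) by (intro Sym_sum Sym.mult) auto
    show "(\<Sum>i\<in>K. c i x * b i \<alpha> x) = \<alpha> x ^ count M H * (\<Sum>i\<in>K. c i x * g i x)" for x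
      by (simp add: g(2) sum_distrib_left mult_ac cong: sum.cong)
  qed
qed

end

section \<open>Multiarrangements of rank two\<close>

text \<open>
  \<open>(P1, P2)\<close> and \<open>(R1, R2)\<close> are the values on \<open>\<alpha>\<close> and \<open>\<beta>\<close> of derivations \<open>\<theta>\<close> and \<open>\<psi>\<close> that
  are logarithmic for \<open>\<alpha>\<^bsup>a+1\<^esup> \<beta>\<^sup>b (\<beta> - \<alpha>)\<^sup>c\<close> and \<open>\<alpha>\<^sup>a \<beta>\<^sup>b (\<beta> - \<alpha>)\<^sup>c\<close> respectively.
\<close>

locale local_pair = complex_space +
  fixes V :: "'a set" and \<alpha> \<beta> :: "'a \<Rightarrow> complex" and a b c d e :: nat
    and P1 P2 R1 R2 r :: "'a \<Rightarrow> complex" and \<kappa> :: complex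
  assumes subspace_V: "subspace V" and alpha: "\<alpha> \<in> dual V" and beta: "\<beta> \<in> dual V"
    and ex_10: "\<exists>x\<in>V. \<alpha> x = 1 \<and> \<beta> x = 0" and ex_01: "\<exists>x\<in>V. \<alpha> x = 0 \<and> \<beta> x = 1"
    and P_hom: "homogeneous V d P1" "homogeneous V d P2"
    and R_hom: "homogeneous V e R1" "homogeneous V e R2"
    and P1: "sdvd V (\<lambda>x. \<alpha> x ^ Suc a) P1" and P2: "sdvd V (\<lambda>x. \<beta> x ^ b) P2"
    and P12: "sdvd V (\<lambda>x. (\<beta> x - \<alpha> x) ^ c) (\<lambda>x. P2 x - P1 x)"
    and P2_nz: "\<exists>x\<in>V. \<alpha> x = 0 \<and> P2 x \<noteq> 0"
    and r: "r \<in> Sym V" and R1: "R1 = (\<lambda>x. \<alpha> x ^ a * r x)"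
    and r_ker: "\<And>x. x \<in> V \<Longrightarrow> \<alpha> x = 0 \<Longrightarrow> r x = \<kappa> * \<beta> x ^ (e - a)" and kappa: "\<kappa> \<noteq> 0"
    and R2: "sdvd V (\<lambda>x. \<beta> x ^ b) R2" and R12: "sdvd V (\<lambda>x. (\<beta> x - \<alpha> x) ^ c) (\<lambda>x. R2 x - R1 x)"
    and degrees: "d + e = a + b + c"
begin

abbreviation "Q x \<equiv> \<alpha> x ^ a * \<beta> x ^ b * (\<beta> x - \<alpha> x) ^ c"

lemma P_Sym: "P1 \<in> Sym V" "P2 \<in> Sym V" and R_Sym: "R1 \<in> Sym V" "R2 \<in> Sym V"
  using P_hom R_hom by (auto intro: homogeneous_Sym)

text \<open>The determinant is unchanged when the second entry of each pair is replaced by its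
  difference with the first. So the power of each of the three forms divides an entire column, and
  the forms are pairwise independent.\<close>

lemma det_dvd:
  assumes X: "X1 \<in> Sym V" "X2 \<in> Sym V" and Y: "Y1 \<in> Sym V" "Y2 \<in> Sym V"
    and "sdvd V (\<lambda>x. \<alpha> x ^ a) X1" "sdvd V (\<lambda>x. \<beta> x ^ b) X2" "sdvd V (\<lambda>x. (\<beta> x - \<alpha> x) ^ c) (\<lambda>x. X2 x - X1 x)"
    and "sdvd V (\<lambda>x. \<alpha> x ^ a) Y1" "sdvd V (\<lambda>x. \<beta> x ^ b) Y2" "sdvd V (\<lambda>x. (\<beta> x - \<alpha> x) ^ c) (\<lambda>x. Y2 x - Y1 x)"
  shows "sdvd V Q (\<lambda>x. X1 x * Y2 x - X2 x * Y1 x)"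
proof -
  obtain f1 f2 f3 where f: "f1 \<in> Sym V" "\<And>x. X1 x = \<alpha> x ^ a * f1 x" "f2 \<in> Sym V" "\<And>x. X2 x = \<beta> x ^ b * f2 x"
     "f3 \<in> Sym V" "\<And>x. X2 x - X1 x = (\<beta> x - \<alpha> x) ^ c * f3 x"
    using assms by (auto elim!: sdvdE)
  obtain g1 g2 g3 where g: "g1 \<in> Sym V" "\<And>x. Y1 x = \<alpha> x ^ a * g1 x" "g2 \<in> Sym V" "\<And>x. Y2 x = \<beta> x ^ b * g2 x"
     "g3 \<in> Sym V" "\<And>x. Y2 x - Y1 x = (\<beta> x - \<alpha> x) ^ c * g3 x"
    using assms by (auto elim!: sdvdE)
  obtain p where p: "p \<in> V" "\<alpha> p = 1" "\<beta> p = 0" using ex_10 by blast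
  obtain q where q: "q \<in> V" "\<alpha> q = 0" "\<beta> q = 1" using ex_01 by blast
  define s where "s = p + q"
  have s: "s \<in> V" "\<alpha> s = 1" "\<beta> s = 1"
    using p q subspace_V alpha beta by (auto simp: s_def subspace_add dual_add)
  define l where "l i = (if i = 0 then \<alpha> else if i = 1 then \<beta> else (\<lambda>x. \<beta> x - \<alpha> x))" for i :: nat
  define k where "k i = (if i = 0 then a else if i = 1 then b else c)" for i :: nat
  let ?D = "\<lambda>x. X1 x * Y2 x - X2 x * Y1 x"
  have D: "?D \<in> Sym V" using X Y by (intro Sym_minus Sym.mult)
  have "sdvd V (\<lambda>x. \<Prod>i\<in>{0, 1, 2}. l i x ^ k i) ?D"
  proof (rule form_powers_dvd[OF subspace_V])
    show "l i \<in> dual V" for i using alpha beta subspace_V by (auto simp: l_def intro: dual_minus)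
    show "\<exists>x. l i x \<noteq> 0" for i using p q s by (auto simp: l_def intro: exI[of _ p] exI[of _ q])
    show "\<exists>x\<in>ker_on V (l i). l j x \<noteq> 0" if "i \<in> {0, 1, 2}" "j \<in> {0, 1, 2}" "i \<noteq> j" for i j
      using that p q s by (auto simp: l_def ker_on_def intro: bexI[of _ p] bexI[of _ q] bexI[of _ s])
    show "?D \<in> Sym V" by (rule D)
    have 0: "sdvd V (\<lambda>x. \<alpha> x ^ a) ?D"
      by (rule sdvdI[OF Sym_minus[OF Sym.mult[OF f(1) Y(2)] Sym.mult[OF X(2) g(1)]]]) (simp add: f(2) g(2) algebra_simps)
    have 1: "sdvd V (\<lambda>x. \<beta> x ^ b) ?D"
      by (rule sdvdI[OF Sym_minus[OF Sym.mult[OF X(1) g(3)] Sym.mult[OF f(3) Y(1)]]]) (simp add: f(4) g(4) algebra_simps)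
    have 2: "sdvd V (\<lambda>x. (\<beta> x - \<alpha> x) ^ c) ?D"
    proof (rule sdvdI[OF Sym_minus[OF Sym.mult[OF X(1) g(5)] Sym.mult[OF f(5) Y(1)]]])
      fix x
      have "?D x = X1 x * (Y2 x - Y1 x) - (X2 x - X1 x) * Y1 x" by (simp add: algebra_simps)
      then show "?D x = (\<beta> x - \<alpha> x) ^ c * (X1 x * g3 x - f3 x * Y1 x)"
        unfolding f(6) g(6) by (simp add: algebra_simps)
    qed
    show "sdvd V (\<lambda>x. l i x ^ k i) ?D" if "i \<in> {0, 1, 2}" for i
      using that 0 1 2 by (auto simp: l_def k_def)
  qed simp
  then show ?thesis by (simp add: l_def k_def mult.assoc)
qed

lemma Q_homogeneous: "homogeneous V (a + b + c) (restr V Q)"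
proof -
  have "homogeneous V (a + (b + (c + 0))) (\<lambda>x. \<alpha> x ^ a * (\<beta> x ^ b * ((\<beta> x - \<alpha> x) ^ c * const_on V 1 x)))"
    using alpha beta subspace_V by (intro homogeneous_power_mult homogeneous.const dual_minus)
  moreover have "(\<lambda>x. \<alpha> x ^ a * (\<beta> x ^ b * ((\<beta> x - \<alpha> x) ^ c * const_on V 1 x))) = restr V Q"
    by (auto simp: restr_def const_on_def mult.assoc)
  ultimately show ?thesis by (simp add: add.assoc)
qed

lemma Q_nonzero: "\<exists>x\<in>V. Q x \<noteq> 0"
proof -
  obtain p where p: "p \<in> V" "\<alpha> p = 1" "\<beta> p = 0" using ex_10 by blast
  obtain q where q: "q \<in> V" "\<alpha> q = 0" "\<beta> q = 1" using ex_01 by blast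
  have "Q (p + (q + q)) \<noteq> 0" "p + (q + q) \<in> V"
    using p q subspace_V alpha beta by (auto simp: subspace_add dual_add)
  then show ?thesis by blast
qed

text \<open>After division by \<alpha>^a the determinant restricts to -P2 r on the kernel of
  \<alpha>, where neither \<open>P2\<close> nor \<open>r\<close> is identically zero. Hence it is
  nonzero and can be cancelled.\<close>

lemma det_nonzero_multiple:
  assumes f: "f \<in> Sym V" and zero: "\<And>x. x \<in> V \<Longrightarrow> (P1 x * R2 x - P2 x * R1 x) * f x = 0"
  shows "f = (\<lambda>x. 0)"
proof -
  obtain P1' where P1': "P1' \<in> Sym V" "\<And>x. P1 x = \<alpha> x ^ Suc a * P1' x" using P1 by (auto elim: sdvdE)
  define g where "g x = \<alpha> x * P1' x * R2 x - P2 x * r x" for x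
  have g: "g \<in> Sym V" unfolding g_def using P1' P_Sym R_Sym r Sym.form[OF alpha] by (intro Sym_minus Sym.mult)
  obtain p where p: "p \<in> V" "\<alpha> p = 1" using ex_10 by blast
  obtain q where q: "q \<in> V" "\<alpha> q = 0" "\<beta> q = 1" using ex_01 by blast
  obtain s where s: "s \<in> V" "\<alpha> s = 0" "P2 s \<noteq> 0" using P2_nz by blast
  have "subspace (ker_on V \<alpha>)" "ker_on V \<alpha> \<subseteq> V" using subspace_ker[OF alpha subspace_V] by (auto simp: ker_on_def)
  from Sym_mult_nonzero_on[OF subspace_V this P_Sym(2) r, of s q]
  obtain t where t: "t \<in> ker_on V \<alpha>" "P2 t * r t \<noteq> 0" using q s r_ker kappa by (auto simp: ker_on_def)
  then have t: "t \<in> V" "g t \<noteq> 0" by (auto simp: g_def ker_on_def)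
  have "(\<lambda>x. g x * f x) = (\<lambda>x. 0)"
  proof (rule Sym_cancel[OF subspace_V Sym.form[OF alpha], of p, where k = a])
    fix x assume "x \<in> V"
    from zero[OF this] show "\<alpha> x ^ a * (g x * f x) = \<alpha> x ^ a * 0"
      by (simp add: g_def P1'(2) R1 algebra_simps)
  qed (use p g f in \<open>auto intro: Sym.mult Sym_0\<close>)
  then have *: "g x * f x = 0" for x by (metis (no_types))
  show ?thesis
    by (rule Sym_cancel[OF subspace_V g t(2) f Sym_0, where k = 1]) (use * in simp)
qed

text \<open>Saito's criterion in rank two: the determinant is a multiple of \<open>Q\<close>, and by
  \<open>degrees\<close> the quotient has degree 0.\<close>

lemma det_eq: "\<exists>k. k \<noteq> 0 \<and> (\<forall>x\<in>V. P1 x * R2 x - P2 x * R1 x = k * Q x)"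
proof -
  have aS: "\<alpha> \<in> Sym V" by (rule Sym.form[OF alpha])
  have "sdvd V (\<lambda>x. \<alpha> x ^ a) P1" by (rule sdvd_power_le[OF aS P1]) simp
  moreover have "sdvd V (\<lambda>x. \<alpha> x ^ a) R1" by (rule sdvdI[OF r]) (simp add: R1)
  ultimately have "sdvd V Q (\<lambda>x. P1 x * R2 x - P2 x * R1 x)"
    using P2 P12 R2 R12 P_Sym R_Sym by (intro det_dvd)
  then obtain g where g: "g \<in> Sym V" "\<And>x. P1 x * R2 x - P2 x * R1 x = Q x * g x" by (auto elim: sdvdE)
  obtain q where q: "q \<in> V" "Q q \<noteq> 0" using Q_nonzero by blast
  have "homogeneous V (d + e) (\<lambda>x. P1 x * R2 x - P2 x * R1 x)"
    using P_hom R_hom by (intro homogeneous_minus homogeneous_mult)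
  moreover have "(\<lambda>x. P1 x * R2 x - P2 x * R1 x) = (\<lambda>x. restr V Q x * g x)"
    using g Sym_outside[OF g(1)] by (auto simp: restr_def)
  ultimately have "homogeneous V (a + b + c) (\<lambda>x. restr V Q x * g x)" using degrees by simp
  from homogeneous_quotient(1)[OF subspace_V Q_homogeneous _ g(1) this, of q] q
  have "homogeneous V 0 g" by (simp add: restr_def)
  then have gc: "g x = g 0" if "x \<in> V" for x using homogeneous_0_const subspace_V that by blast
  have "g 0 \<noteq> 0"
  proof
    assume "g 0 = 0"
    then have "g x = 0" for x using gc Sym_outside[OF g(1)] by (cases "x \<in> V") auto
    then have "const_on V 1 = (\<lambda>x. 0)" by (intro det_nonzero_multiple Sym.const) (simp add: g(2))
    then have "const_on V 1 q = 0" by (rule fun_cong)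
    then show False using q(1) by (simp add: const_on_def)
  qed
  moreover have "\<forall>x\<in>V. P1 x * R2 x - P2 x * R1 x = g 0 * Q x"
  proof
    fix x assume x: "x \<in> V"
    then show "P1 x * R2 x - P2 x * R1 x = g 0 * Q x" unfolding g(2)[of x] gc[OF x] by simp
  qed
  ultimately show ?thesis by blast
qed

text \<open>Cramer's rule: the numerators are determinants of logarithmic pairs, hence divisible by
  \<open>Q\<close>, which is the denominator up to a constant.\<close>

lemma generate:
  assumes X: "X1 \<in> Sym V" "X2 \<in> Sym V"
    and "sdvd V (\<lambda>x. \<alpha> x ^ a) X1" "sdvd V (\<lambda>x. \<beta> x ^ b) X2" "sdvd V (\<lambda>x. (\<beta> x - \<alpha> x) ^ c) (\<lambda>x. X2 x - X1 x)"
  shows "\<exists>f\<in>Sym V. \<exists>g\<in>Sym V. X1 = (\<lambda>x. f x * P1 x + g x * R1 x) \<and> X2 = (\<lambda>x. f x * P2 x + g x * R2 x)"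
proof -
  obtain k where k: "k \<noteq> 0" "\<And>x. x \<in> V \<Longrightarrow> P1 x * R2 x - P2 x * R1 x = k * Q x" using det_eq by blast
  obtain q where q: "q \<in> V" "Q q \<noteq> 0" using Q_nonzero by blast
  have aS: "\<alpha> \<in> Sym V" by (rule Sym.form[OF alpha])
  have Pa: "sdvd V (\<lambda>x. \<alpha> x ^ a) P1" by (rule sdvd_power_le[OF aS P1]) simp
  have Ra: "sdvd V (\<lambda>x. \<alpha> x ^ a) R1" by (rule sdvdI[OF r]) (simp add: R1)
  have "sdvd V Q (\<lambda>x. X1 x * R2 x - X2 x * R1 x)"
    using assms R_Sym Ra R2 R12 by (intro det_dvd)
  then obtain f where f: "f \<in> Sym V" "\<And>x. X1 x * R2 x - X2 x * R1 x = Q x * f x" by (auto elim: sdvdE)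
  have "sdvd V Q (\<lambda>x. P1 x * X2 x - P2 x * X1 x)"
    using assms P_Sym Pa P2 P12 by (intro det_dvd)
  then obtain g where g: "g \<in> Sym V" "\<And>x. P1 x * X2 x - P2 x * X1 x = Q x * g x" by (auto elim: sdvdE)
  have QS: "restr V Q \<in> Sym V" by (rule homogeneous_Sym[OF Q_homogeneous])
  have fS: "(\<lambda>x. 1 / k * f x) \<in> Sym V" and gS: "(\<lambda>x. 1 / k * g x) \<in> Sym V"
    using f g by (auto intro: Sym_cmult simp del: times_divide_eq_left)
  have "X1 = (\<lambda>x. 1 / k * f x * P1 x + 1 / k * g x * R1 x)"
  proof (rule Sym_cancel[OF subspace_V QS _ X(1), of q, where k = 1])
    show "(\<lambda>x. 1 / k * f x * P1 x + 1 / k * g x * R1 x) \<in> Sym V"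
      by (intro Sym.add Sym.mult[OF fS] Sym.mult[OF gS] P_Sym R_Sym)
    fix x assume x: "x \<in> V"
    have "k * Q x * X1 x = (X1 x * R2 x - X2 x * R1 x) * P1 x + (P1 x * X2 x - P2 x * X1 x) * R1 x"
      unfolding k(2)[OF x, symmetric] by (simp add: algebra_simps)
    then have "k * Q x * X1 x = Q x * f x * P1 x + Q x * g x * R1 x" by (simp only: f(2) g(2))
    then show "restr V Q x ^ 1 * X1 x = restr V Q x ^ 1 * (1 / k * f x * P1 x + 1 / k * g x * R1 x)"
      using k(1) x by (simp add: restr_def field_simps)
  qed (use q in \<open>simp add: restr_def\<close>)
  moreover have "X2 = (\<lambda>x. 1 / k * f x * P2 x + 1 / k * g x * R2 x)"
  proof (rule Sym_cancel[OF subspace_V QS _ X(2), of q, where k = 1])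
    show "(\<lambda>x. 1 / k * f x * P2 x + 1 / k * g x * R2 x) \<in> Sym V"
      by (intro Sym.add Sym.mult[OF fS] Sym.mult[OF gS] P_Sym R_Sym)
    fix x assume x: "x \<in> V"
    have "k * Q x * X2 x = (X1 x * R2 x - X2 x * R1 x) * P2 x + (P1 x * X2 x - P2 x * X1 x) * R2 x"
      unfolding k(2)[OF x, symmetric] by (simp add: algebra_simps)
    then have "k * Q x * X2 x = Q x * f x * P2 x + Q x * g x * R2 x" by (simp only: f(2) g(2))
    then show "restr V Q x ^ 1 * X2 x = restr V Q x ^ 1 * (1 / k * f x * P2 x + 1 / k * g x * R2 x)"
      using k(1) x by (simp add: restr_def field_simps)
  qed (use q in \<open>simp add: restr_def\<close>)
  ultimately show ?thesis using fS gS by (intro bexI[of _ "\<lambda>x. 1 / k * f x"] bexI[of _ "\<lambda>x. 1 / k * g x"] conjI)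
qed

lemma independent_pair:
  assumes f: "f \<in> Sym V" and g: "g \<in> Sym V"
    and 1: "\<And>x. f x * P1 x + g x * R1 x = 0" and 2: "\<And>x. f x * P2 x + g x * R2 x = 0"
  shows "f = (\<lambda>x. 0)" "g = (\<lambda>x. 0)"
proof -
  show "f = (\<lambda>x. 0)"
  proof (rule det_nonzero_multiple[OF f])
    fix x
    have "(P1 x * R2 x - P2 x * R1 x) * f x = (f x * P1 x + g x * R1 x) * R2 x - (f x * P2 x + g x * R2 x) * R1 x"
      by (simp add: algebra_simps)
    then show "(P1 x * R2 x - P2 x * R1 x) * f x = 0" using 1 2 by simp
  qed
  show "g = (\<lambda>x. 0)"
  proof (rule det_nonzero_multiple[OF g])
    fix x
    have "(P1 x * R2 x - P2 x * R1 x) * g x = (f x * P2 x + g x * R2 x) * P1 x - (f x * P1 x + g x * R1 x) * P2 x"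
      by (simp add: algebra_simps)
    then show "(P1 x * R2 x - P2 x * R1 x) * g x = 0" using 1 2 by simp
  qed
qed

text \<open>Passing from \<alpha>^a to \<alpha>^(a+1) replaces \<psi> by \<alpha>\<psi>. As
  \<theta>(\<alpha>) has the extra factor already and \<psi>(\<alpha>) = \<alpha>^a r with
  \<open>r\<close> nonzero on the kernel, the coefficient of \<psi> must vanish on the
  kernel.\<close>

lemma generate_Suc:
  assumes X: "X1 \<in> Sym V" "X2 \<in> Sym V"
    and X1: "sdvd V (\<lambda>x. \<alpha> x ^ Suc a) X1"
    and "sdvd V (\<lambda>x. \<beta> x ^ b) X2" "sdvd V (\<lambda>x. (\<beta> x - \<alpha> x) ^ c) (\<lambda>x. X2 x - X1 x)"
  shows "\<exists>f\<in>Sym V. \<exists>g\<in>Sym V. X1 = (\<lambda>x. f x * P1 x + g x * (\<alpha> x * R1 x)) \<and>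
     X2 = (\<lambda>x. f x * P2 x + g x * (\<alpha> x * R2 x))"
proof -
  have aS: "\<alpha> \<in> Sym V" by (rule Sym.form[OF alpha])
  obtain p where p: "p \<in> V" "\<alpha> p = 1" using ex_10 by blast
  obtain q where q: "q \<in> V" "\<alpha> q = 0" "\<beta> q = 1" using ex_01 by blast
  have "sdvd V (\<lambda>x. \<alpha> x ^ a) X1" by (rule sdvd_power_le[OF aS X1]) simp
  from generate[OF X this assms(4,5)]
  obtain f g where fg: "f \<in> Sym V" "g \<in> Sym V" "X1 = (\<lambda>x. f x * P1 x + g x * R1 x)"
    "X2 = (\<lambda>x. f x * P2 x + g x * R2 x)" by blast
  obtain X1' where X1': "X1' \<in> Sym V" "\<And>x. X1 x = \<alpha> x ^ Suc a * X1' x" using X1 by (auto elim: sdvdE)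
  obtain P1' where P1': "P1' \<in> Sym V" "\<And>x. P1 x = \<alpha> x ^ Suc a * P1' x" using P1 by (auto elim: sdvdE)
  have "(\<lambda>x. g x * r x) = (\<lambda>x. \<alpha> x * (X1' x - f x * P1' x))"
  proof (rule Sym_cancel[OF subspace_V aS, of p, where k = a])
    fix x
    have "\<alpha> x ^ Suc a * X1' x = f x * (\<alpha> x ^ Suc a * P1' x) + g x * (\<alpha> x ^ a * r x)"
      using fun_cong[OF fg(3), of x] by (simp only: X1' P1' R1)
    then show "\<alpha> x ^ a * (g x * r x) = \<alpha> x ^ a * (\<alpha> x * (X1' x - f x * P1' x))"
      by (simp add: algebra_simps)
  qed (use p fg X1' P1' r aS in \<open>auto intro!: Sym.mult Sym_minus\<close>)
  then have gr: "g x * r x = \<alpha> x * (X1' x - f x * P1' x)" for x by (rule fun_cong)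
  have "g x = 0" if x: "x \<in> ker_on V \<alpha>" for x
  proof (rule ccontr)
    assume "g x \<noteq> 0"
    have "r q \<noteq> 0" "q \<in> ker_on V \<alpha>" using q r_ker kappa by (auto simp: ker_on_def)
    moreover have "subspace (ker_on V \<alpha>)" "ker_on V \<alpha> \<subseteq> V"
      using subspace_ker[OF alpha subspace_V] by (auto simp: ker_on_def)
    ultimately obtain y where "y \<in> ker_on V \<alpha>" "g y * r y \<noteq> 0"
      using Sym_mult_nonzero_on[OF subspace_V _ _ fg(2) r x \<open>g x \<noteq> 0\<close>, of q] by blast
    then show False using gr[of y] by (simp add: ker_on_def)
  qed
  then have "sdvd V \<alpha> g" using p by (intro form_dvd[OF subspace_V alpha _ fg(2), of p]) auto
  then obtain g' where g': "g' \<in> Sym V" "\<And>x. g x = \<alpha> x * g' x" by (auto elim: sdvdE)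
  show ?thesis
    using fg g' by (intro bexI[of _ f] bexI[of _ g']) (auto simp: mult_ac)
qed

lemma independent_pair_Suc:
  assumes f: "f \<in> Sym V" and g: "g \<in> Sym V"
    and 1: "\<And>x. f x * P1 x + g x * (\<alpha> x * R1 x) = 0" and 2: "\<And>x. f x * P2 x + g x * (\<alpha> x * R2 x) = 0"
  shows "f = (\<lambda>x. 0)" "g = (\<lambda>x. 0)"
proof -
  have aS: "\<alpha> \<in> Sym V" by (rule Sym.form[OF alpha])
  obtain p where p: "p \<in> V" "\<alpha> p = 1" using ex_10 by blast
  have ag: "(\<lambda>x. \<alpha> x * g x) \<in> Sym V" by (rule Sym.mult[OF aS g])
  have z: "f x * P1 x + \<alpha> x * g x * R1 x = 0" "f x * P2 x + \<alpha> x * g x * R2 x = 0" for x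
    using 1[of x] 2[of x] by (simp_all add: mult_ac)
  show "f = (\<lambda>x. 0)" by (rule independent_pair(1)[OF f ag z])
  have "(\<lambda>x. \<alpha> x * g x) = (\<lambda>x. 0)" by (rule independent_pair(2)[OF f ag z])
  then have "\<alpha> x * g x = 0" for x by (rule fun_cong)
  then show "g = (\<lambda>x. 0)"
    using p by (intro Sym_cancel[OF subspace_V aS _ g Sym_0, of p, where k = 1]) auto
qed

lemma sum_from_3:
  fixes n :: nat and f :: "nat \<Rightarrow> complex"
  assumes "2 \<le> n" shows "(\<Sum>i=1..n. f i) = f 1 + f 2 + (\<Sum>i=3..n. f i)"
proof -
  have "{1..n} = {1, 2} \<union> {3..n}" using assms by auto
  then show ?thesis by (simp add: sum.union_disjoint)
qed

text \<open>The basis required by the definition is \<theta>, \<alpha>\<psi> and the remaining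
  partial derivatives. Since \<open>P2\<close> is nonzero somewhere on the kernel of \<alpha>,
  \<theta> is not a multiple of \<alpha>; so the multiplicity is its degree
  \<open>d\<close>.\<close>

lemma euler_multiplicity_pair:
  assumes db: "dual_basis V n y u" and n: "2 \<le> n" and y: "y 1 = \<alpha>" "y 2 = \<beta>"
    and M: "\<And>H. H \<in># M \<Longrightarrow> Y \<subseteq> H \<Longrightarrow> H \<in> {ker_on V \<alpha>, ker_on V \<beta>, ker_on V (\<lambda>x. \<beta> x - \<alpha> x)}"
    and Y: "Y = {x \<in> V. \<alpha> x = 0 \<and> \<beta> x = 0}"
    and count: "count M (ker_on V \<alpha>) = Suc a" "count M (ker_on V \<beta>) = b" "count M (ker_on V (\<lambda>x. \<beta> x - \<alpha> x)) = c"
  shows "euler_multiplicity V M (ker_on V \<alpha>) Y d"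
proof -
  note V = subspace_V
  define \<gamma> where "\<gamma> x = \<beta> x - \<alpha> x" for x
  have \<gamma>_fun: "\<gamma> = (\<lambda>x. \<beta> x - \<alpha> x)" by (simp add: \<gamma>_def fun_eq_iff)
  have gamma: "\<gamma> \<in> dual V" unfolding \<gamma>_def by (rule dual_minus[OF beta alpha V])
  have aS: "\<alpha> \<in> Sym V" by (rule Sym.form[OF alpha])
  obtain p where p: "p \<in> V" "\<alpha> p = 1" "\<beta> p = 0" using ex_10 by blast
  obtain q where q: "q \<in> V" "\<alpha> q = 0" "\<beta> q = 1" using ex_01 by blast
  define N where "N = filter_mset (\<lambda>H. Y \<subseteq> H) M"
  have N: "set_mset N \<subseteq> {ker_on V \<alpha>, ker_on V \<beta>, ker_on V \<gamma>}"
  proof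
    fix H assume "H \<in># N"
    then show "H \<in> {ker_on V \<alpha>, ker_on V \<beta>, ker_on V \<gamma>}"
      unfolding \<gamma>_fun N_def by (intro M) simp_all
  qed
  have Yk: "Y \<subseteq> ker_on V \<alpha>" "Y \<subseteq> ker_on V \<beta>" "Y \<subseteq> ker_on V \<gamma>" by (auto simp: Y ker_on_def \<gamma>_def)
  then have cN: "count N (ker_on V \<alpha>) = Suc a" "count N (ker_on V \<beta>) = b" "count N (ker_on V \<gamma>) = c"
    using count unfolding N_def \<gamma>_fun by simp_all
  have mem_iff: "\<theta> \<in> log_der V N" if "\<theta> \<in> Der V" "sdvd V (\<lambda>x. \<alpha> x ^ Suc a) (\<theta> \<alpha>)"
     "sdvd V (\<lambda>x. \<beta> x ^ b) (\<theta> \<beta>)" "sdvd V (\<lambda>x. \<gamma> x ^ c) (\<theta> \<gamma>)" for \<theta>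
  proof (rule log_derI[OF V that(1)])
    fix H assume "H \<in># N"
    then have "H \<in> {ker_on V \<alpha>, ker_on V \<beta>, ker_on V \<gamma>}" using N by blast
    moreover have "\<gamma> q \<noteq> 0" using q by (simp add: \<gamma>_def)
    ultimately show "\<exists>\<alpha>\<in>dual V. (\<exists>x. \<alpha> x \<noteq> 0) \<and> H = ker_on V \<alpha> \<and> sdvd V (\<lambda>x. \<alpha> x ^ count N H) (\<theta> \<alpha>)"
      using that(2-4) alpha beta gamma p q cN
      by (elim insertE emptyE; intro bexI[of _ \<alpha>] bexI[of _ \<beta>] bexI[of _ \<gamma>])
        (auto intro: exI[of _ p] exI[of _ q])
  qed
  have Der_\<gamma>: "\<theta> \<gamma> = (\<lambda>x. \<theta> \<beta> x - \<theta> \<alpha> x)" if "\<theta> \<in> Der V" for \<theta>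
    using Der_dual_diff[OF that beta alpha] by (simp add: \<gamma>_fun)
  \<comment> \<open>\<open>h i j\<close> is the value of the i-th basis element on the j-th
    coordinate.\<close>
  define h where "h i j = (if i = 1 then if j = 1 then P1 else if j = 2 then P2 else (\<lambda>x. 0)
     else if i = 2 then if j = 1 then (\<lambda>x. \<alpha> x * R1 x) else if j = 2 then (\<lambda>x. \<alpha> x * R2 x) else (\<lambda>x. 0)
     else const_on V (if j = i then 1 else 0))" for i j :: nat
  have hS: "h i j \<in> Sym V" for i j
    using P_Sym R_Sym aS by (auto simp: h_def intro: Sym_0 Sym.mult Sym.const)
  have "\<exists>\<theta>\<in>Der V. \<forall>j\<in>{1..n}. \<theta> (y j) = h i j" for i by (rule ex_Der_basis[OF db V hS])
  then obtain B where B: "\<And>i. B i \<in> Der V" "\<And>i j. j \<in> {1..n} \<Longrightarrow> B i (y j) = h i j" by metis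
  have B1: "B i \<alpha> = h i 1" and B2: "B i \<beta> = h i 2" for i using B(2)[of 1 i] B(2)[of 2 i] y n by simp_all
  have zero: "(\<lambda>x. 0) \<in> Sym V" "sdvd V f (\<lambda>x. 0)" for f by (auto intro: Sym_0 sdvdI[OF Sym_0])
  have B_mem: "B i \<in> log_der V N" if i: "i \<in> {1..n}" for i
  proof -
    consider "i = 1" | "i = 2" | "3 \<le> i" using i by fastforce
    then show ?thesis
    proof cases
      case 1
      then show ?thesis
        using P1 P2 P12 B1[of 1] B2[of 1] B(1)[of 1]
        by (intro mem_iff) (simp_all add: Der_\<gamma> h_def, simp add: \<gamma>_def)
    next
      case 2
      obtain g where g: "g \<in> Sym V" "\<And>x. R2 x = \<beta> x ^ b * g x" using R2 by (auto elim: sdvdE)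
      obtain g' where g': "g' \<in> Sym V" "\<And>x. R2 x - R1 x = (\<beta> x - \<alpha> x) ^ c * g' x" using R12 by (auto elim: sdvdE)
      have e: "B i \<alpha> = (\<lambda>x. \<alpha> x * R1 x)" "B i \<beta> = (\<lambda>x. \<alpha> x * R2 x)" using 2 B1 B2 by (simp_all add: h_def)
      show ?thesis
      proof (rule mem_iff[OF B(1)])
        show "sdvd V (\<lambda>x. \<alpha> x ^ Suc a) (B i \<alpha>)" unfolding e R1 by (rule sdvdI[OF r]) simp
        show "sdvd V (\<lambda>x. \<beta> x ^ b) (B i \<beta>)" unfolding e by (rule sdvdI[OF Sym.mult[OF aS g(1)]]) (simp add: g(2))
        show "sdvd V (\<lambda>x. \<gamma> x ^ c) (B i \<gamma>)" unfolding Der_\<gamma>[OF B(1)] e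
        proof (rule sdvdI[OF Sym.mult[OF aS g'(1)]])
          show "\<alpha> x * R2 x - \<alpha> x * R1 x = \<gamma> x ^ c * (\<alpha> x * g' x)" for x
            using g'(2)[of x] by (simp add: \<gamma>_def right_diff_distrib[symmetric])
        qed
      qed
    next
      case 3
      then have "B i \<alpha> = (\<lambda>x. 0)" "B i \<beta> = (\<lambda>x. 0)" using B1 B2 by (simp_all add: h_def const_on_def)
      then show ?thesis using zero Der_\<gamma>[OF B(1)] by (intro mem_iff B(1)) simp_all
    qed
  qed
  have comb: "(\<Sum>i=1..n. f i x * B i (y j) x) =
      (if j = 1 then f 1 x * P1 x + f 2 x * (\<alpha> x * R1 x) else if j = 2 then f 1 x * P2 x + f 2 x * (\<alpha> x * R2 x) else f j x)"
    if j: "j \<in> {1..n}" and f: "\<And>i. i \<in> {1..n} \<Longrightarrow> f i \<in> Sym V" for f :: "nat \<Rightarrow> 'a \<Rightarrow> complex" and j x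
  proof -
    have "(\<Sum>i=3..n. f i x * B i (y j) x) = (\<Sum>i=3..n. if i = j then f j x else 0)"
    proof (rule sum.cong)
      fix i assume i: "i \<in> {3..n}"
      have "f j x = 0" if "x \<notin> V" using Sym_outside[OF f[OF j] that] .
      then show "f i x * B i (y j) x = (if i = j then f j x else 0)"
        using i by (auto simp: B(2)[OF j] h_def const_on_def)
    qed simp
    also have "\<dots> = (if 3 \<le> j then f j x else 0)" using j by simp
    finally show ?thesis using j unfolding sum_from_3[OF n] by (auto simp: B(2)[OF j] h_def)
  qed
  have mb: "module_basis V (log_der V N) n B"
  proof (rule module_basisI)
    show "B i \<in> log_der V N" if "i \<in> {1..n}" for i by (rule B_mem[OF that])
  next
    fix \<theta> assume \<theta>: "\<theta> \<in> log_der V N"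
    then have \<theta>D: "\<theta> \<in> Der V" by (rule log_der_Der)
    note S = Der_Sym[OF \<theta>D Sym.form]
    obtain f g where fg: "f \<in> Sym V" "g \<in> Sym V"
      "\<theta> \<alpha> = (\<lambda>x. f x * P1 x + g x * (\<alpha> x * R1 x))" "\<theta> \<beta> = (\<lambda>x. f x * P2 x + g x * (\<alpha> x * R2 x))"
      using generate_Suc[OF S[OF alpha] S[OF beta]] log_der_dvd[OF \<theta> alpha] log_der_dvd[OF \<theta> beta]
        log_der_dvd[OF \<theta> gamma] cN Der_\<gamma>[OF \<theta>D] by (auto simp: \<gamma>_def)
    define k where "k i = (if i = 1 then f else if i = 2 then g else \<theta> (y i))" for i :: nat
    have k: "k i \<in> Sym V" if "i \<in> {1..n}" for i
      using fg S[OF dual_basisD(1)[OF db that]] by (simp add: k_def)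
    have "\<theta> = (\<lambda>f x. \<Sum>i=1..n. k i x * B i f x)"
    proof (rule Der_eqI_basis[OF db V \<theta>D])
      show "(\<lambda>f x. \<Sum>i=1..n. k i x * B i f x) \<in> Der V" by (rule Der_lincomb[OF k B(1)])
      show "\<theta> (y j) = (\<lambda>x. \<Sum>i=1..n. k i x * B i (y j) x)" if j: "j \<in> {1..n}" for j
      proof
        fix x
        have "(\<Sum>i=1..n. k i x * B i (y j) x) = (if j = 1 then k 1 x * P1 x + k 2 x * (\<alpha> x * R1 x)
            else if j = 2 then k 1 x * P2 x + k 2 x * (\<alpha> x * R2 x) else k j x)"
          by (rule comb[OF j]) (rule k)
        then show "\<theta> (y j) x = (\<Sum>i=1..n. k i x * B i (y j) x)" using fg y by (auto simp: k_def)
      qed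
    qed
    then show "\<exists>k. (\<forall>i\<in>{1..n}. k i \<in> Sym V) \<and> \<theta> = (\<lambda>f x. \<Sum>i=1..n. k i x * B i f x)" using k by blast
  next
    fix f i assume f: "\<forall>i\<in>{1..n}. f i \<in> Sym V" and z: "\<And>g x. (\<Sum>i=1..n. f i x * B i g x) = 0" and i: "i \<in> {1..n}"
    have v: "(if j = 1 then f 1 x * P1 x + f 2 x * (\<alpha> x * R1 x) else if j = 2 then f 1 x * P2 x + f 2 x * (\<alpha> x * R2 x) else f j x) = 0"
      if "j \<in> {1..n}" for j x using comb[OF that, of f x] f z by simp
    have "f 1 \<in> Sym V" "f 2 \<in> Sym V" using f n by auto
    moreover have "f 1 x * P1 x + f 2 x * (\<alpha> x * R1 x) = 0" "f 1 x * P2 x + f 2 x * (\<alpha> x * R2 x) = 0" for x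
      using v[of 1 x] v[of 2 x] n by simp_all
    ultimately have "f 1 = (\<lambda>x. 0)" "f 2 = (\<lambda>x. 0)" using independent_pair_Suc by blast+
    then show "f i = (\<lambda>x. 0)" using v[OF i] by (cases "i = 1"; cases "i = 2") (simp_all add: fun_eq_iff)
  qed
  have pd1: "pdeg V (B 1) d"
    by (rule pdeg_basis[OF db V B(1)]) (simp add: B(2) h_def P_hom homogeneous_0)
  have pd2: "pdeg V (B 2) (Suc e)"
    by (rule pdeg_basis[OF db V B(1)]) (simp add: B(2) h_def homogeneous.mult[OF alpha] R_hom homogeneous_0)
  have "B 1 \<notin> form_times_Der V (ker_on V \<alpha>)"
  proof
    assume "B 1 \<in> form_times_Der V (ker_on V \<alpha>)"
    then obtain \<alpha>' \<delta> where a: "B 1 = (\<lambda>f x. \<alpha>' x * \<delta> f x)" "ker_on V \<alpha>' = ker_on V \<alpha>"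
      unfolding form_times_Der_def by blast
    obtain s where s: "s \<in> V" "\<alpha> s = 0" "P2 s \<noteq> 0" using P2_nz by blast
    then have "s \<in> ker_on V \<alpha>'" unfolding a(2) by (simp add: ker_on_def)
    then have "\<alpha>' s = 0" by (simp add: ker_on_def)
    moreover have "P2 s = B 1 \<beta> s" using B2[of 1] by (simp add: h_def)
    moreover have "B 1 \<beta> s = \<alpha>' s * \<delta> \<beta> s" by (simp only: a(1))
    ultimately show False using s by simp
  qed
  moreover have "B 2 \<in> form_times_Der V (ker_on V \<alpha>)"
  proof -
    define k where "k j = (if j = 1 then R1 else if j = 2 then R2 else (\<lambda>x. 0))" for j :: nat
    have "k j \<in> Sym V" for j using R_Sym by (simp add: k_def Sym_0)
    then obtain \<psi> where \<psi>: "\<psi> \<in> Der V" "\<And>j. j \<in> {1..n} \<Longrightarrow> \<psi> (y j) = k j"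
      using ex_Der_basis[OF db V, of k] by blast
    have "B 2 = (\<lambda>f x. \<alpha> x * \<psi> f x)"
      by (rule Der_eqI_basis[OF db V B(1) Der_scale[OF aS \<psi>(1)]]) (auto simp: B(2) \<psi>(2) h_def k_def)
    then show ?thesis unfolding form_times_Der_def using alpha \<psi>(1) by blast
  qed
  moreover have "is_partial V n y i (B i)" if "i \<in> {3..n}" for i
    unfolding is_partial_def using B(1) that by (auto simp: B(2) h_def)
  ultimately show ?thesis
    unfolding euler_multiplicity_def
    using n dual_basis_coordinates[OF db V] Y y mb pd1 pd2 unfolding N_def by blast
qed

end

section \<open>Arrangements of type A with an edge to be added\<close>

definition edge_mult :: "('i \<Rightarrow> nat) \<Rightarrow> ('i \<times> 'i) set \<Rightarrow> 'i \<Rightarrow> 'i \<Rightarrow> nat" where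
  "edge_mult n G i j = n i + n j + (if (i, j) \<in> G then 1 else 0)"

context complex_space
begin

text \<open>
  The last condition says that \<open>x \<mapsto> (z\<^sub>i x)\<^sub>i\<close> maps \<open>V\<close> onto \<open>\<complex>\<^bsup>I\<^esup>\<close> modulo the diagonal.
\<close>

definition type_A_forms :: "'v set \<Rightarrow> 'i set \<Rightarrow> ('i \<Rightarrow> 'v \<Rightarrow> complex) \<Rightarrow> bool" where
  "type_A_forms V I z \<longleftrightarrow> fd_subspace V \<and> finite I \<and> (\<forall>i\<in>I. z i \<in> dual V) \<and>
     (\<forall>c. \<exists>x\<in>V. \<exists>t. \<forall>i\<in>I. z i x = c i + t)"

definition eq_hyperplane :: "'v set \<Rightarrow> ('i \<Rightarrow> 'v \<Rightarrow> complex) \<Rightarrow> 'i \<Rightarrow> 'i \<Rightarrow> 'v set" where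
  "eq_hyperplane V z i j = ker_on V (\<lambda>x. z i x - z j x)"

text \<open>Described through counts and not as an explicit sum, so that deletions and Euler
  restrictions are recognized as members of the same family. Pairs with \<nu> i j = 0 have no
  hyperplane in \<open>M\<close>.\<close>

definition type_A_arrangement ::
  "'v set \<Rightarrow> 'i set \<Rightarrow> ('i \<Rightarrow> 'v \<Rightarrow> complex) \<Rightarrow> ('i \<Rightarrow> 'i \<Rightarrow> nat) \<Rightarrow> 'v set multiset \<Rightarrow> bool" where
  "type_A_arrangement V I z \<nu> M \<longleftrightarrow>
     (\<forall>H\<in>#M. \<exists>i\<in>I. \<exists>j\<in>I. i \<noteq> j \<and> H = eq_hyperplane V z i j) \<and>
     (\<forall>i\<in>I. \<forall>j\<in>I. i \<noteq> j \<longrightarrow> count M (eq_hyperplane V z i j) = \<nu> i j)"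

lemma eq_hyperplane_iff: "x \<in> eq_hyperplane V z i j \<longleftrightarrow> x \<in> V \<and> z i x = z j x"
  by (simp add: eq_hyperplane_def ker_on_def)

lemma eq_hyperplane_commute: "eq_hyperplane V z i j = eq_hyperplane V z j i"
  unfolding set_eq_iff eq_hyperplane_iff by metis

lemma type_A_forms_subspace: "type_A_forms V I z \<Longrightarrow> subspace V"
  unfolding type_A_forms_def using fd_subspace_subspace by blast

lemma type_A_forms_diff_dual:
  "type_A_forms V I z \<Longrightarrow> i \<in> I \<Longrightarrow> j \<in> I \<Longrightarrow> (\<lambda>x. z i x - z j x) \<in> dual V"
  by (rule dual_minus[OF _ _ type_A_forms_subspace[of V I z]]) (simp_all add: type_A_forms_def)

lemma type_A_forms_point:
  assumes "type_A_forms V I z"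
  obtains x where "x \<in> V" "\<And>i j. i \<in> I \<Longrightarrow> j \<in> I \<Longrightarrow> z i x - z j x = c i - c j"
proof -
  obtain x t where "x \<in> V" "\<forall>i\<in>I. z i x = c i + t" using assms unfolding type_A_forms_def by blast
  then show ?thesis using that[of x] by simp
qed

text \<open>Indicator functions of vertex sets are realized by points. Such points decide all
  inclusions between hyperplanes and flats below.\<close>

lemma type_A_forms_separate:
  assumes "type_A_forms V I z"
  obtains x where "x \<in> V"
    "\<And>i j. i \<in> I \<Longrightarrow> j \<in> I \<Longrightarrow> z i x = z j x \<longleftrightarrow> (i \<in> A \<longleftrightarrow> j \<in> A)"
proof -
  obtain x where x: "x \<in> V" "\<And>i j. i \<in> I \<Longrightarrow> j \<in> I \<Longrightarrow> z i x - z j x = (if i \<in> A then 1 else 0) - (if j \<in> A then 1 else 0)"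
    using type_A_forms_point[OF assms, of "\<lambda>i. if i \<in> A then 1 else 0"] by blast
  show ?thesis
  proof (rule that[OF x(1)])
    fix i j assume "i \<in> I" "j \<in> I"
    from x(2)[OF this] show "z i x = z j x \<longleftrightarrow> (i \<in> A \<longleftrightarrow> j \<in> A)" by (auto split: if_splits)
  qed
qed

lemma eq_hyperplane_inject:
  assumes cfg: "type_A_forms V I z" and ij: "i \<in> I" "j \<in> I" "i \<noteq> j" and pq: "p \<in> I" "q \<in> I" "p \<noteq> q"
    and sub: "eq_hyperplane V z i j \<subseteq> eq_hyperplane V z p q"
  shows "{p, q} = {i, j}"
proof -
  have sep: "p \<in> A \<longleftrightarrow> q \<in> A" if "i \<in> A \<longleftrightarrow> j \<in> A" for A
  proof -
    obtain x where x: "x \<in> V" "\<And>i j. i \<in> I \<Longrightarrow> j \<in> I \<Longrightarrow> z i x = z j x \<longleftrightarrow> (i \<in> A \<longleftrightarrow> j \<in> A)"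
      using type_A_forms_separate[OF cfg, of A] by blast
    then have "x \<in> eq_hyperplane V z i j" using ij that by (simp add: eq_hyperplane_iff)
    then have "x \<in> eq_hyperplane V z p q" using sub by blast
    then show ?thesis using x(2)[OF pq(1,2)] by (simp add: eq_hyperplane_iff)
  qed
  show ?thesis using sep[of "{p}"] sep[of "{q}"] pq ij by auto
qed

lemma homogeneous_restr:
  assumes "homogeneous V d f" "W \<subseteq> V" "subspace W"
  shows "homogeneous W d (restr W f)"
  using homogeneous_pullback[of V d f W "\<lambda>x. x"] assms dual_restr by blast

end

text \<open>\<open>G\<close> is the graph of the deletion and \<open>M\<close> the arrangement after
  adding the edge \<open>vs\<close>. The clique condition enters as \<open>J_s\<close>: each other
  neighbour of \<open>v\<close> is adjacent to \<open>s\<close>.\<close>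

locale edge_addition = complex_space +
  fixes V :: "'a set" and I :: "'i set" and z :: "'i \<Rightarrow> 'a \<Rightarrow> complex" and n :: "'i \<Rightarrow> nat"
    and G :: "('i \<times> 'i) set" and v s :: 'i and J :: "'i set" and M :: "'a set multiset"
  assumes forms: "type_A_forms V I z" and vs: "v \<in> I" "s \<in> I" "v \<noteq> s"
    and G_sym: "(i, j) \<in> G \<longleftrightarrow> (j, i) \<in> G" and vs_G: "(v, s) \<notin> G"
    and J: "j \<in> I \<Longrightarrow> (v, j) \<in> G \<longleftrightarrow> j \<in> J" "J \<subseteq> I - {v, s}"
    and J_s: "j \<in> J \<Longrightarrow> (s, j) \<in> G"
    and arr: "type_A_arrangement V I z (edge_mult n (G \<union> {(v, s), (s, v)})) M"
begin

definition "\<alpha> = (\<lambda>x. z v x - z s x)"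
definition "a = n v + n s"
definition "W = eq_hyperplane V z v s"
definition "M0 = M - {#W#}"
text \<open>The exponent of z_j - z_s in \<open>B\<close>. For the triangle \<open>v, s, j\<close>
  it is the part of the degree of \<psi> beyond \<open>a\<close>.\<close>

definition "bexp j = n j + (if j \<in> J then 1 else 0 :: nat)"

lemma V: "subspace V" and fdV: "fd_subspace V" and I: "finite I"
  using forms type_A_forms_subspace[OF forms] by (simp_all add: type_A_forms_def)

lemma z: "i \<in> I \<Longrightarrow> z i \<in> dual V"
  using forms unfolding type_A_forms_def by blast

lemma diff: "i \<in> I \<Longrightarrow> j \<in> I \<Longrightarrow> (\<lambda>x. z i x - z j x) \<in> dual V"
  by (rule type_A_forms_diff_dual[OF forms])

lemma alpha: "\<alpha> \<in> dual V" unfolding \<alpha>_def by (rule diff[OF vs(1,2)])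

lemma W_ker: "W = ker_on V \<alpha>" by (simp add: W_def eq_hyperplane_def \<alpha>_def)

lemma W_subspace: "subspace W" and W_V: "W \<subseteq> V"
  using subspace_ker[OF alpha V] by (auto simp: W_ker ker_on_def)

lemma W_iff: "x \<in> W \<longleftrightarrow> x \<in> V \<and> z v x = z s x"
  by (simp add: W_def eq_hyperplane_iff)

lemma ex_alpha_1: "\<exists>x\<in>V. \<alpha> x = 1"
proof -
  obtain x where "x \<in> V" "\<And>i j. i \<in> I \<Longrightarrow> j \<in> I \<Longrightarrow> z i x - z j x = (if i = v then 1 else 0) - (if j = v then 1 else 0)"
    using type_A_forms_point[OF forms, of "\<lambda>i. if i = v then 1 else 0"] by blast
  then show ?thesis using vs by (intro bexI[of _ x]) (auto simp: \<alpha>_def)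
qed

lemma count_M: "i \<in> I \<Longrightarrow> j \<in> I \<Longrightarrow> i \<noteq> j \<Longrightarrow>
    count M (eq_hyperplane V z i j) = edge_mult n (G \<union> {(v, s), (s, v)}) i j"
  using arr unfolding type_A_arrangement_def by blast

lemma M_mem:
  assumes "H \<in># M" obtains i j where "i \<in> I" "j \<in> I" "i \<noteq> j" "H = eq_hyperplane V z i j"
proof -
  have "\<exists>i\<in>I. \<exists>j\<in>I. i \<noteq> j \<and> H = eq_hyperplane V z i j"
    using arr assms unfolding type_A_arrangement_def by (elim conjE) (rule bspec)
  then show ?thesis using that by blast
qed

lemma eq_W_iff: "i \<in> I \<Longrightarrow> j \<in> I \<Longrightarrow> i \<noteq> j \<Longrightarrow> eq_hyperplane V z i j = W \<longleftrightarrow> {i, j} = {v, s}"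
proof
  assume ij: "i \<in> I" "j \<in> I" "i \<noteq> j"
  show "{i, j} = {v, s}" if "eq_hyperplane V z i j = W"
    using eq_hyperplane_inject[OF forms ij vs] that by (simp add: W_def)
  show "eq_hyperplane V z i j = W" if "{i, j} = {v, s}"
    using that eq_hyperplane_commute[of V z v s] by (auto simp: W_def doubleton_eq_iff)
qed

lemma count_W: "count M W = Suc a" "count M0 W = a" and W_mem: "W \<in># M"
proof -
  show 1: "count M W = Suc a" using count_M[OF vs] by (simp add: W_def edge_mult_def a_def)
  then show "count M0 W = a" by (simp add: M0_def)
  show "W \<in># M" using 1 by (metis count_inI nat.distinct(1))
qed

lemma arr0: "type_A_arrangement V I z (edge_mult n G) M0"
  unfolding type_A_arrangement_def
proof (intro conjI ballI impI)
  fix H assume "H \<in># M0"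
  then have "H \<in># M" by (simp add: M0_def in_diffD)
  then show "\<exists>i\<in>I. \<exists>j\<in>I. i \<noteq> j \<and> H = eq_hyperplane V z i j" by (elim M_mem) blast
next
  fix i j assume ij: "i \<in> I" "j \<in> I" "i \<noteq> j"
  have "(s, v) \<notin> G" using vs_G G_sym by blast
  then show "count M0 (eq_hyperplane V z i j) = edge_mult n G i j"
    using count_M[OF ij] eq_W_iff[OF ij] vs_G ij
    by (cases "{i, j} = {v, s}") (auto simp: M0_def edge_mult_def doubleton_eq_iff)
qed

lemma count_M0: "i \<in> I \<Longrightarrow> j \<in> I \<Longrightarrow> i \<noteq> j \<Longrightarrow> count M0 (eq_hyperplane V z i j) = edge_mult n G i j"
  using arr0 unfolding type_A_arrangement_def by blast

text \<open>The localization at the intersection of the three hyperplanes of a triangle \<open>v, s, j\<close>.\<close>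

lemma triangle_pair:
  assumes j: "j \<in> I" "j \<noteq> v" "j \<noteq> s"
  shows "\<exists>e P1 P2 R1 R2 r \<kappa>. e - a = bexp j \<and>
     local_pair scale V \<alpha> (\<lambda>x. z j x - z s x) a (edge_mult n G j s) (edge_mult n G j v)
       (n v + n s + n j + (if (s, j) \<in> G then 1 else 0)) e P1 P2 R1 R2 r \<kappa>"
proof -
  define T where "T = {v, s, j}"
  have T: "finite T" "T \<subseteq> I" "v \<in> T" "s \<in> T" "j \<in> T" using j vs by (auto simp: T_def)
  have zT: "z i \<in> dual V" if "i \<in> T" for i using z T(2) that by blast
  define N3 where "N3 = n v + n s + n j"
  have sumT: "(\<Sum>l\<in>T. n l) = N3" using j vs by (simp add: T_def N3_def)
  define J' where "J' = J \<inter> {j}"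
  have J': "J' \<subseteq> T - {v}" using j by (auto simp: J'_def T_def)
  have cJ': "card J' = (if j \<in> J then 1 else 0)" by (simp add: J'_def)
  let ?\<beta> = "\<lambda>x. z j x - z s x"
  obtain x where x: "x \<in> V" "\<And>i k. i \<in> I \<Longrightarrow> k \<in> I \<Longrightarrow> z i x = z k x \<longleftrightarrow> (i \<in> {j} \<longleftrightarrow> k \<in> {j})"
    using type_A_forms_separate[OF forms, of "{j}"] by blast
  have x': "z v x = z s x" "z j x \<noteq> z s x" "z j x \<noteq> z v x"
    using x(2)[OF vs(1,2)] x(2)[OF j(1) vs(2)] x(2)[OF j(1) vs(1)] j by auto
  define d where "d = N3 + (if (s, j) \<in> G then 1 else 0)"
  have "\<exists>h. (\<forall>i\<in>T. homogeneous V d (h i)) \<and>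
      sdvd V (\<lambda>x. (z v x - z s x) ^ Suc a) (\<lambda>x. h v x - h s x) \<and>
      sdvd V (\<lambda>x. (z j x - z s x) ^ edge_mult n G j s) (\<lambda>x. h j x - h s x) \<and>
      sdvd V (\<lambda>x. (z j x - z v x) ^ edge_mult n G j v) (\<lambda>x. h j x - h v x) \<and> h j x \<noteq> h s x"
  proof (cases "(s, j) \<in> G")
    case True
    \<comment> \<open>With the edge \<open>sj\<close>, the integral over the triangle with exponents
      \<open>n\<close> has degree N3 + 1 and raises all three differences by one, which covers
      \<open>vj\<close> both as an edge and as a non-edge.\<close>
    obtain h where h1: "\<And>i. i \<in> T \<Longrightarrow> homogeneous V (Suc (\<Sum>l\<in>T. n l)) (h i)"
      and h2: "\<And>i j. i \<in> T \<Longrightarrow> j \<in> T \<Longrightarrow> i \<noteq> j \<Longrightarrow> \<exists>u\<in>Sym V. \<exists>\<kappa>. \<kappa> \<noteq> 0 \<and>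
        (\<forall>x. h i x - h j x = (z i x - z j x) ^ Suc (n i + n j) * u x) \<and>
        (\<forall>x\<in>V. z i x = z j x \<longrightarrow> u x = \<kappa> * (\<Prod>l\<in>T - {i, j}. (z i x - z l x) ^ n l))"
      and h3: "\<And>x i j. x \<in> V \<Longrightarrow> i \<in> T \<Longrightarrow> j \<in> T \<Longrightarrow> \<forall>l\<in>T. z l x \<in> {z i x, z j x} \<Longrightarrow> z i x \<noteq> z j x \<Longrightarrow>
        h i x \<noteq> h j x"
      by (rule ex_integral_potential[where z = z and k = n, OF V T(1) zT]) (assumption | rule that)+
    have dv: "sdvd V (\<lambda>x. (z i x - z k x) ^ m) (\<lambda>x. h i x - h k x)" if "i \<in> T" "k \<in> T" "i \<noteq> k" "m \<le> Suc (n i + n k)" for i k m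
    proof (rule sdvd_power_le[OF _ _ that(4)])
      show "(\<lambda>x. z i x - z k x) \<in> Sym V" using that T(2) by (intro Sym.form diff) auto
      show "sdvd V (\<lambda>x. (z i x - z k x) ^ Suc (n i + n k)) (\<lambda>x. h i x - h k x)"
        using h2[OF that(1-3)] by (auto intro: sdvdI)
    qed
    have "h j x \<noteq> h s x"
      by (rule h3[OF x(1) T(5,4) ballI x'(2)]) (use x' in \<open>auto simp: T_def\<close>)
    moreover have "homogeneous V d (h i)" if "i \<in> T" for i
      using h1 that True sumT by (simp add: d_def)
    moreover have "sdvd V (\<lambda>x. (z v x - z s x) ^ Suc a) (\<lambda>x. h v x - h s x)"
      using T vs by (intro dv) (simp_all add: a_def)
    moreover have "sdvd V (\<lambda>x. (z j x - z k x) ^ edge_mult n G j k) (\<lambda>x. h j x - h k x)" if "k \<in> {v, s}" for k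
      using T j that by (intro dv) (auto simp: edge_mult_def)
    ultimately show ?thesis by (intro exI[of _ h]) blast
  next
    case False
    then have jJ: "j \<notin> J" using J_s by blast
    then have ng: "(j, s) \<notin> G" "(j, v) \<notin> G" using False J(1)[OF j(1)] G_sym by blast+
    \<comment> \<open>Without \<open>sj\<close> there is no edge \<open>vj\<close> either. The
      vertex potential at \<open>j\<close>, not at \<open>v\<close>, has degree N3 only and still
      gains one at the pair \<open>v, s\<close>.\<close>
    obtain h where h1: "\<And>i. i \<in> T \<Longrightarrow> homogeneous V ((\<Sum>l\<in>T. n l) + card ({} :: 'i set)) (h i)"
      and h2: "\<And>i k. i \<in> T - {j} \<Longrightarrow> k \<in> T - {j} \<Longrightarrow> i \<noteq> k \<Longrightarrow>
        sdvd V (\<lambda>x. (z i x - z k x) ^ Suc (n i + n k)) (\<lambda>x. h i x - h k x)"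
      and h3: "\<And>k. k \<in> T - {j} \<Longrightarrow> \<exists>u\<in>Sym V. \<exists>\<kappa>. \<kappa> \<noteq> 0 \<and>
        (\<forall>x. h j x - h k x = (z j x - z k x) ^ (n j + (n k + (if k \<in> {} then 1 else 0))) * u x) \<and>
        (\<forall>x\<in>V. z j x = z k x \<longrightarrow> u x = \<kappa> * (\<Prod>l\<in>T - {j, k}. (z j x - z l x) ^ (n l + (if l \<in> {} then 1 else 0))))"
      and h4: "\<And>x k. x \<in> V \<Longrightarrow> k \<in> T - {j} \<Longrightarrow> \<forall>l\<in>T - {j}. z l x = z k x \<Longrightarrow> z j x \<noteq> z k x \<Longrightarrow> h j x \<noteq> h k x"
      by (rule ex_vertex_potential[where z = z and n = n and J = "{}", OF V T(1) zT T(5)]) (assumption | rule that empty_subsetI)+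
    have dv: "sdvd V (\<lambda>x. (z j x - z k x) ^ (n j + n k)) (\<lambda>x. h j x - h k x)" if "k \<in> T - {j}" for k
      using h3[OF that] by (auto intro: sdvdI)
    have "h j x \<noteq> h s x"
      by (rule h4[OF x(1) _ ballI x'(2)]) (use x' T j in \<open>auto simp: T_def\<close>)
    moreover have "homogeneous V d (h i)" if "i \<in> T" for i
      using h1 that False sumT by (simp add: d_def)
    moreover have "sdvd V (\<lambda>x. (z v x - z s x) ^ Suc a) (\<lambda>x. h v x - h s x)"
      unfolding a_def using h2 T vs j by blast
    moreover have "sdvd V (\<lambda>x. (z j x - z k x) ^ edge_mult n G j k) (\<lambda>x. h j x - h k x)" if "k \<in> {v, s}" for k
      using dv[of k] T j that ng by (auto simp: edge_mult_def)
    ultimately show ?thesis by (intro exI[of _ h]) blast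
  qed
  then obtain h where h: "\<And>i. i \<in> T \<Longrightarrow> homogeneous V d (h i)"
      "sdvd V (\<lambda>x. (z v x - z s x) ^ Suc a) (\<lambda>x. h v x - h s x)"
      "sdvd V (\<lambda>x. (z j x - z s x) ^ edge_mult n G j s) (\<lambda>x. h j x - h s x)"
      "sdvd V (\<lambda>x. (z j x - z v x) ^ edge_mult n G j v) (\<lambda>x. h j x - h v x)" "h j x \<noteq> h s x"
    by blast
  \<comment> \<open>For \<psi> the distinguished vertex is \<open>v\<close>: the difference of
    \<open>v\<close> and \<open>s\<close> gets exactly the power \<open>a\<close>, with a quotient
    known on the kernel of \<alpha>.\<close>
  obtain g where g1: "\<And>i. i \<in> T \<Longrightarrow> homogeneous V ((\<Sum>l\<in>T. n l) + card J') (g i)"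
      and g2: "\<And>i k. i \<in> T - {v} \<Longrightarrow> k \<in> T - {v} \<Longrightarrow> i \<noteq> k \<Longrightarrow>
        sdvd V (\<lambda>x. (z i x - z k x) ^ Suc (n i + n k)) (\<lambda>x. g i x - g k x)"
      and g3: "\<And>k. k \<in> T - {v} \<Longrightarrow> \<exists>u\<in>Sym V. \<exists>\<kappa>. \<kappa> \<noteq> 0 \<and>
        (\<forall>x. g v x - g k x = (z v x - z k x) ^ (n v + (n k + (if k \<in> J' then 1 else 0))) * u x) \<and>
        (\<forall>x\<in>V. z v x = z k x \<longrightarrow> u x = \<kappa> * (\<Prod>l\<in>T - {v, k}. (z v x - z l x) ^ (n l + (if l \<in> J' then 1 else 0))))"
      and g4: "\<And>x k. x \<in> V \<Longrightarrow> k \<in> T - {v} \<Longrightarrow> \<forall>l\<in>T - {v}. z l x = z k x \<Longrightarrow> z v x \<noteq> z k x \<Longrightarrow> g v x \<noteq> g k x"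
      by (rule ex_vertex_potential[where z = z and n = n, OF V T(1) zT T(3) J']) (assumption | rule that)+
  have sJ: "s \<notin> J'" using j by (auto simp: J'_def)
  have jJ: "j \<in> J' \<longleftrightarrow> j \<in> J" by (simp add: J'_def)
  obtain r \<kappa> where r: "r \<in> Sym V" "\<kappa> \<noteq> 0" "\<And>x. g v x - g s x = (z v x - z s x) ^ a * r x"
    "\<And>x. x \<in> V \<Longrightarrow> z v x = z s x \<Longrightarrow> r x = \<kappa> * (\<Prod>l\<in>T - {v, s}. (z v x - z l x) ^ (n l + (if l \<in> J' then 1 else 0)))"
    using g3[of s] T vs sJ by (auto simp: a_def)
  have Tvs: "T - {v, s} = {j}" using j vs by (auto simp: T_def)
  define e where "e = N3 + card J'"
  have ea: "e - a = bexp j" by (simp add: e_def N3_def a_def bexp_def cJ')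
  have g_hom: "homogeneous V e (g i)" if "i \<in> T" for i using g1 that sumT by (simp add: e_def)
  \<comment> \<open>The sign in the last parameter comes from turning z_v - z_j into z_j - z_s on
    the kernel of \<alpha>.\<close>
  have "local_pair scale V \<alpha> ?\<beta> a (edge_mult n G j s) (edge_mult n G j v) d e
      (\<lambda>x. h v x - h s x) (\<lambda>x. h j x - h s x) (\<lambda>x. g v x - g s x) (\<lambda>x. g j x - g s x) r (\<kappa> * (-1) ^ bexp j)"
  proof unfold_locales
    show "subspace V" by (rule V)
    show "\<alpha> \<in> dual V" by (rule alpha)
    show "?\<beta> \<in> dual V" using diff j vs by blast
    obtain p where "p \<in> V" "\<And>i j. i \<in> I \<Longrightarrow> j \<in> I \<Longrightarrow> z i p - z j p = (if i = v then 1 else 0) - (if j = v then 1 else 0)"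
      using type_A_forms_point[OF forms, of "\<lambda>i. if i = v then 1 else 0"] by blast
    then show "\<exists>x\<in>V. \<alpha> x = 1 \<and> z j x - z s x = 0" using vs j by (intro bexI[of _ p]) (auto simp: \<alpha>_def)
    obtain p where "p \<in> V" "\<And>i k. i \<in> I \<Longrightarrow> k \<in> I \<Longrightarrow> z i p - z k p = (if i = j then 1 else 0) - (if k = j then 1 else 0)"
      using type_A_forms_point[OF forms, of "\<lambda>i. if i = j then 1 else 0"] by blast
    then show "\<exists>x\<in>V. \<alpha> x = 0 \<and> z j x - z s x = 1" using vs j by (intro bexI[of _ p]) (auto simp: \<alpha>_def)
    show "homogeneous V d (\<lambda>x. h v x - h s x)" "homogeneous V d (\<lambda>x. h j x - h s x)"
      using h(1) T by (auto intro: homogeneous_minus)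
    show "homogeneous V e (\<lambda>x. g v x - g s x)" "homogeneous V e (\<lambda>x. g j x - g s x)"
      using g_hom T by (auto intro: homogeneous_minus)
    show "sdvd V (\<lambda>x. \<alpha> x ^ Suc a) (\<lambda>x. h v x - h s x)" unfolding \<alpha>_def by (rule h(2))
    show "sdvd V (\<lambda>x. (z j x - z s x) ^ edge_mult n G j s) (\<lambda>x. h j x - h s x)" by (rule h(3))
    show "sdvd V (\<lambda>x. (z j x - z s x - \<alpha> x) ^ edge_mult n G j v) (\<lambda>x. h j x - h s x - (h v x - h s x))"
      using h(4) by (simp add: \<alpha>_def)
    show "\<exists>x\<in>V. \<alpha> x = 0 \<and> h j x - h s x \<noteq> 0" using x(1) x' h(5) by (intro bexI[of _ x]) (auto simp: \<alpha>_def)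
    show "r \<in> Sym V" by (rule r(1))
    show "(\<lambda>x. g v x - g s x) = (\<lambda>x. \<alpha> x ^ a * r x)" using r(3) by (simp add: \<alpha>_def)
    show "r x = \<kappa> * (-1) ^ bexp j * (z j x - z s x) ^ (e - a)" if "x \<in> V" "\<alpha> x = 0" for x
    proof -
      have e: "z v x = z s x" using that by (simp add: \<alpha>_def)
      have "(z v x - z j x) ^ bexp j = (-1) ^ bexp j * (z j x - z s x) ^ bexp j"
        unfolding e power_mult_distrib[symmetric] by simp
      then show ?thesis using r(4)[OF that(1) e] unfolding Tvs ea by (simp add: bexp_def jJ)
    qed
    show "\<kappa> * (-1) ^ bexp j \<noteq> 0" using r(2) by simp
    show "sdvd V (\<lambda>x. (z j x - z s x) ^ edge_mult n G j s) (\<lambda>x. g j x - g s x)"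
    proof (rule sdvd_power_le)
      show "?\<beta> \<in> Sym V" using diff j vs Sym.form by blast
      show "sdvd V (\<lambda>x. ?\<beta> x ^ Suc (n j + n s)) (\<lambda>x. g j x - g s x)" using g2 T vs j by blast
    qed (simp add: edge_mult_def)
    obtain u where u0: "u \<in> Sym V" "\<And>x. g v x - g j x = (z v x - z j x) ^ (n v + bexp j) * u x"
      using g3[of j] T j by (auto simp: bexp_def jJ)
    define u' where "u' x = - ((-1) ^ (n v + bexp j)) * u x" for x
    have u': "u' \<in> Sym V" unfolding u'_def by (rule Sym_cmult[OF u0(1)])
    have u'_eq: "g j x - g v x = (z j x - z v x) ^ (n v + bexp j) * u' x" for x
    proof -
      have "(z v x - z j x) ^ (n v + bexp j) = (z j x - z v x) ^ (n v + bexp j) * (-1) ^ (n v + bexp j)"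
        unfolding power_mult_distrib[symmetric] by simp
      then show ?thesis using u0(2)[of x] by (simp add: u'_def algebra_simps)
    qed
    have m: "edge_mult n G j v = n v + bexp j"
      using J(1)[OF j(1)] G_sym[of v j] by (auto simp: edge_mult_def bexp_def)
    show "sdvd V (\<lambda>x. (z j x - z s x - \<alpha> x) ^ edge_mult n G j v) (\<lambda>x. g j x - g s x - (g v x - g s x))"
      using sdvdI[OF u' u'_eq] by (simp add: \<alpha>_def m)
    \<comment> \<open>Both sides are 2 N3 plus one for the edge \<open>sj\<close> and one for the
      edge \<open>vj\<close>.\<close>
    show "d + e = a + edge_mult n G j s + edge_mult n G j v"
      using m G_sym[of s j] by (simp add: d_def e_def a_def N3_def cJ' bexp_def edge_mult_def)
  qed
  then show ?thesis using ea unfolding d_def N3_def by blast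
qed

end

section \<open>The addition step\<close>

context complex_space
begin

text \<open>Pure module theory: in coordinates of the basis \<open>b\<close>, membership in D'
  forces \<alpha> to divide the combination of c_k and the c_i q_i. Solving for c_k yields the new
  basis, in which b_k is multiplied by \<alpha>.\<close>

lemma basis_exchange:
  assumes V: "subspace V" and mb: "module_basis V D r b" and D0: "(\<lambda>f x. 0) \<in> D" and D': "D' \<subseteq> D"
    and k: "k \<in> {1..r}" and q: "\<And>i. i \<in> {1..r} \<Longrightarrow> q i \<in> Sym V" and \<alpha>: "\<alpha> \<in> Sym V" "\<alpha> p \<noteq> 0"
    and b': "\<And>i. i \<in> {1..r} \<Longrightarrow> i \<noteq> k \<Longrightarrow> (\<lambda>f x. b i f x - q i x * b k f x) \<in> D'"
    and b'k: "(\<lambda>f x. \<alpha> x * b k f x) \<in> D'"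
    and dvd: "\<And>c. (\<And>i. i \<in> {1..r} \<Longrightarrow> c i \<in> Sym V) \<Longrightarrow> (\<lambda>f x. \<Sum>i=1..r. c i x * b i f x) \<in> D' \<Longrightarrow>
      sdvd V \<alpha> (\<lambda>x. c k x + (\<Sum>i\<in>{1..r} - {k}. c i x * q i x))"
  shows "module_basis V D' r (\<lambda>i. if i = k then (\<lambda>f x. \<alpha> x * b k f x) else (\<lambda>f x. b i f x - q i x * b k f x))"
    (is "module_basis V D' r ?b")
proof (rule module_basisI)
  let ?K = "{1..r} - {k}"
  have split: "(\<Sum>i=1..r. f i) = f k + (\<Sum>i\<in>?K. f i)" for f :: "nat \<Rightarrow> complex"
    by (rule sum.remove[OF _ k]) simp
  have expand: "(\<Sum>i=1..r. c i x * ?b i f x) =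
      (\<alpha> x * c k x - (\<Sum>i\<in>?K. c i x * q i x)) * b k f x + (\<Sum>i\<in>?K. c i x * b i f x)" for c f x
  proof -
    have "(\<Sum>i\<in>?K. c i x * ?b i f x) = (\<Sum>i\<in>?K. c i x * b i f x - c i x * q i x * b k f x)"
      by (rule sum.cong) (auto simp: algebra_simps)
    then show ?thesis unfolding split by (simp add: sum_subtractf sum_distrib_left algebra_simps)
  qed
  show "?b i \<in> D'" if "i \<in> {1..r}" for i using b'[OF that] b'k by simp
  show "\<exists>c. (\<forall>i\<in>{1..r}. c i \<in> Sym V) \<and> \<theta> = (\<lambda>f x. \<Sum>i=1..r. c i x * ?b i f x)" if \<theta>: "\<theta> \<in> D'" for \<theta>
  proof -
    have \<theta>D: "\<theta> \<in> D" using \<theta> D' by blast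
    obtain c where c: "\<And>i. i \<in> {1..r} \<Longrightarrow> c i \<in> Sym V" and eq: "\<theta> = (\<lambda>f x. \<Sum>i=1..r. c i x * b i f x)"
      by (rule module_basis_generate[OF mb \<theta>D]) (rule that)
    have "sdvd V \<alpha> (\<lambda>x. c k x + (\<Sum>i\<in>?K. c i x * q i x))" using c \<theta> unfolding eq by (rule dvd)
    then obtain g where g: "g \<in> Sym V" "\<And>x. c k x + (\<Sum>i\<in>?K. c i x * q i x) = \<alpha> x * g x" by (auto elim: sdvdE)
    define c' where "c' i = (if i = k then g else c i)" for i
    have "\<theta> f x = (\<Sum>i=1..r. c' i x * ?b i f x)" for f x
    proof -
      have "(\<Sum>i\<in>?K. c' i x * q i x) = (\<Sum>i\<in>?K. c i x * q i x)" "(\<Sum>i\<in>?K. c' i x * b i f x) = (\<Sum>i\<in>?K. c i x * b i f x)"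
        by (rule sum.cong; simp add: c'_def)+
      moreover have "\<alpha> x * c' k x - (\<Sum>i\<in>?K. c i x * q i x) = c k x"
        using g(2)[of x] by (simp add: c'_def algebra_simps)
      ultimately have "(\<Sum>i=1..r. c' i x * ?b i f x) = c k x * b k f x + (\<Sum>i\<in>?K. c i x * b i f x)"
        unfolding expand by simp
      then show ?thesis unfolding eq split by simp
    qed
    moreover have "\<forall>i\<in>{1..r}. c' i \<in> Sym V" using c g by (simp add: c'_def)
    ultimately show ?thesis by (intro exI[of _ c']) (simp add: fun_eq_iff)
  qed
  show "c i = (\<lambda>x. 0)" if c: "\<forall>i\<in>{1..r}. c i \<in> Sym V" and zero: "\<And>f x. (\<Sum>i=1..r. c i x * ?b i f x) = 0"
    and i: "i \<in> {1..r}" for c i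
  proof -
    define e where "e i = (if i = k then (\<lambda>x. \<alpha> x * c k x - (\<Sum>i\<in>?K. c i x * q i x)) else c i)" for i
    have "(\<lambda>x. \<alpha> x * c k x - (\<Sum>i\<in>?K. c i x * q i x)) \<in> Sym V"
      using c q k \<alpha> by (intro Sym_minus Sym_sum Sym.mult) auto
    then have eS: "e i \<in> Sym V" if "i \<in> {1..r}" for i using c that by (simp add: e_def)
    have e0: "(\<Sum>i=1..r. e i x * b i f x) = 0" for f x
    proof -
      have "(\<Sum>i\<in>?K. e i x * b i f x) = (\<Sum>i\<in>?K. c i x * b i f x)" by (rule sum.cong) (auto simp: e_def)
      then show ?thesis using zero[of x f] unfolding expand split[of "\<lambda>i. e i x * b i f x"] by (simp add: e_def)
    qed
    have e: "e i = (\<lambda>x. 0)" if "i \<in> {1..r}" for i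
      by (rule module_basis_independent[OF mb D0 _ e0 that]) (rule eS)
    have ci: "c i = (\<lambda>x. 0)" if "i \<in> ?K" for i using e[of i] that by (simp add: e_def)
    show ?thesis
    proof (cases "i = k")
      case True
      have "\<alpha> x * c k x = 0" for x
        using fun_cong[OF e[OF k], of x] ci by (simp add: e_def)
      then show ?thesis unfolding True
        using c k by (intro Sym_cancel[OF V \<alpha> _ Sym_0, where k = 1]) auto
    qed (use ci i in auto)
  qed
qed

lemma has_exponents_basis:
  assumes "has_exponents V M E"
  obtains r b d where "module_basis V (log_der V M) r b" "\<And>i. i \<in> {1..r} \<Longrightarrow> pdeg V (b i) (d i)"
    "E = image_mset d (mset_set {1..r})"
proof -
  obtain r b d where "module_basis V (log_der V M) r b \<and> (\<forall>i\<in>{1..r}. pdeg V (b i) (d i)) \<and>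
      E = image_mset d (mset_set {1..r})" using assms unfolding has_exponents_def by blast
  then show ?thesis using that by blast
qed

end

context edge_addition
begin

section \<open>Leading coefficients of logarithmic derivations along the new hyperplane\<close>

definition "bW j = restr W (\<lambda>x. z j x - z s x)"
definition "B x = (\<Prod>j\<in>I - {v, s}. bW j x ^ bexp j)"

lemma M0_mem:
  assumes "H \<in># M0" obtains i j where "i \<in> I" "j \<in> I" "i \<noteq> j" "H = eq_hyperplane V z i j"
proof -
  have "H \<in># M" using assms by (simp add: M0_def in_diffD)
  then show ?thesis by (rule M_mem) (rule that)
qed

lemma ex_diff_nonzero:
  assumes "i \<in> I" "j \<in> I" "i \<noteq> j"
  shows "\<exists>x. z i x - z j x \<noteq> 0"
proof -
  obtain x where x: "x \<in> V" "\<And>k l. k \<in> I \<Longrightarrow> l \<in> I \<Longrightarrow> z k x = z l x \<longleftrightarrow> (k \<in> {i} \<longleftrightarrow> l \<in> {i})"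
    using type_A_forms_separate[OF forms, of "{i}"] by blast
  show ?thesis using x(2)[OF assms(1,2)] assms(3) by (intro exI[of _ x]) simp
qed

lemma alpha_Sym: "\<alpha> \<in> Sym V" by (rule Sym.form[OF alpha])

lemma bW_dual: "j \<in> I \<Longrightarrow> bW j \<in> dual W"
  unfolding bW_def by (rule dual_restr[OF diff[OF _ vs(2)] W_V W_subspace])

lemma separate_W:
  assumes j: "j \<in> I - {v, s}"
  obtains x where "x \<in> W" "bW j x \<noteq> 0" "\<And>i. i \<in> I - {j} \<Longrightarrow> bW i x = 0"
proof -
  obtain x where x: "x \<in> V" "\<And>i k. i \<in> I \<Longrightarrow> k \<in> I \<Longrightarrow> z i x = z k x \<longleftrightarrow> (i \<in> {j} \<longleftrightarrow> k \<in> {j})"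
    using type_A_forms_separate[OF forms, of "{j}"] by blast
  have "z v x = z s x" "z j x \<noteq> z s x" "\<And>i. i \<in> I - {j} \<Longrightarrow> z i x = z s x" using x(2) vs j by auto
  then show ?thesis using x(1) by (intro that[of x]) (auto simp: bW_def restr_def W_iff)
qed

lemma log_der_alpha:
  assumes "\<xi> \<in> log_der V M0"
  obtains u where "u \<in> Sym V" "\<And>x. \<xi> \<alpha> x = \<alpha> x ^ a * u x"
  using log_der_dvd[OF assms alpha] count_W(2) unfolding W_ker sdvd_def by (metis (no_types))

text \<open>The analogue of the polynomial \<open>B\<close> of Abe, Terao and Wakefield.\<close>

lemma B_dvd:
  assumes \<xi>: "\<xi> \<in> log_der V M0" and u: "u \<in> Sym V" "\<And>x. \<xi> \<alpha> x = \<alpha> x ^ a * u x"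
  shows "sdvd W B (restr W u)"
  unfolding B_def
proof (rule form_powers_dvd[OF W_subspace])
  show "finite (I - {v, s})" using I by simp
  show "bW i \<in> dual W" if "i \<in> I - {v, s}" for i using bW_dual that by blast
  show "\<exists>x\<in>ker_on W (bW i). bW j x \<noteq> 0" if "i \<in> I - {v, s}" "j \<in> I - {v, s}" "i \<noteq> j" for i j
    using separate_W[OF that(2)] that by (auto simp: ker_on_def) (metis)
  show "\<exists>x. bW i x \<noteq> 0" if "i \<in> I - {v, s}" for i using separate_W[OF that] by metis
  show "restr W u \<in> Sym W" by (rule Sym_restr[OF u(1) W_V W_subspace])
  fix j assume "j \<in> I - {v, s}"
  then have j: "j \<in> I" "j \<noteq> v" "j \<noteq> s" by auto
  obtain e P1 P2 R1 R2 r \<kappa> where e: "e - a = bexp j" and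
    "local_pair scale V \<alpha> (\<lambda>x. z j x - z s x) a (edge_mult n G j s) (edge_mult n G j v)
       (n v + n s + n j + (if (s, j) \<in> G then 1 else 0)) e P1 P2 R1 R2 r \<kappa>"
    using triangle_pair[OF j] by (elim exE conjE) (rule that)
  then interpret L: local_pair scale V \<alpha> "\<lambda>x. z j x - z s x" a "edge_mult n G j s" "edge_mult n G j v"
    "n v + n s + n j + (if (s, j) \<in> G then 1 else 0)" e P1 P2 R1 R2 r \<kappa> by -
  have \<xi>D: "\<xi> \<in> Der V" by (rule log_der_Der[OF \<xi>])
  have \<beta>: "(\<lambda>x. z j x - z s x) \<in> dual V" by (rule diff[OF j(1) vs(2)])
  have \<gamma>: "(\<lambda>x. z j x - z v x) \<in> dual V" by (rule diff[OF j(1) vs(1)])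
  have "sdvd V (\<lambda>x. \<alpha> x ^ a) (\<xi> \<alpha>)" by (rule sdvdI[OF u])
  moreover have "sdvd V (\<lambda>x. (z j x - z s x) ^ edge_mult n G j s) (\<xi> (\<lambda>x. z j x - z s x))"
    using log_der_dvd[OF \<xi> \<beta>] count_M0[OF j(1) vs(2) j(3)] by (simp add: eq_hyperplane_def)
  moreover have "sdvd V (\<lambda>x. (z j x - z s x - \<alpha> x) ^ edge_mult n G j v) (\<lambda>x. \<xi> (\<lambda>x. z j x - z s x) x - \<xi> \<alpha> x)"
  proof -
    have g: "(\<lambda>x. z j x - z s x - \<alpha> x) = (\<lambda>x. z j x - z v x)" by (simp add: \<alpha>_def)
    show ?thesis unfolding Der_dual_diff[OF \<xi>D \<beta> alpha, symmetric] unfolding g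
      using log_der_dvd[OF \<xi> \<gamma>] count_M0[OF j(1) vs(1) j(2)] by (simp add: eq_hyperplane_def \<alpha>_def)
  qed
  \<comment> \<open>Localization: \<xi> is logarithmic for the triangle \<open>v, s, j\<close>,
    hence a combination of the local pair on the two forms.\<close>
  ultimately obtain f g where fg: "f \<in> Sym V" "g \<in> Sym V" "\<xi> \<alpha> = (\<lambda>x. f x * P1 x + g x * R1 x)"
    using L.generate[OF Der_Sym[OF \<xi>D alpha_Sym] Der_Sym[OF \<xi>D Sym.form[OF \<beta>]]] by blast
  obtain P1' where P1': "P1' \<in> Sym V" "\<And>x. P1 x = \<alpha> x ^ Suc a * P1' x" using L.P1 by (auto elim: sdvdE)
  obtain p where p: "p \<in> V" "\<alpha> p = 1" using ex_alpha_1 by blast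
  \<comment> \<open>The term with \<theta> disappears on \<open>W\<close> because of its extra
    factor \<alpha>; the other one contains \<open>r\<close>, which is a multiple of the required
    power there.\<close>
  have "u = (\<lambda>x. \<alpha> x * (f x * P1' x) + g x * r x)"
  proof (rule Sym_cancel[OF V alpha_Sym _ u(1), of p, where k = a])
    show "(\<lambda>x. \<alpha> x * (f x * P1' x) + g x * r x) \<in> Sym V"
      by (intro Sym.add Sym.mult alpha_Sym fg P1' L.r)
    show "\<alpha> x ^ a * u x = \<alpha> x ^ a * (\<alpha> x * (f x * P1' x) + g x * r x)" for x
      using fun_cong[OF fg(3), of x] unfolding u(2) P1'(2) L.R1 by (simp add: algebra_simps)
  qed (use p in simp)
  then have ux: "u x = \<alpha> x * (f x * P1' x) + g x * r x" for x by (rule fun_cong)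
  show "sdvd W (\<lambda>x. bW j x ^ bexp j) (restr W u)"
  proof (rule sdvdI[OF Sym_cmult[OF Sym_restr[OF fg(2) W_V W_subspace]]])
    fix x
    show "restr W u x = bW j x ^ bexp j * (\<kappa> * restr W g x)"
    proof (cases "x \<in> W")
      case True
      then have "x \<in> V" "\<alpha> x = 0" using W_V by (auto simp: W_ker ker_on_def)
      then have "u x = g x * (\<kappa> * (z j x - z s x) ^ bexp j)" using L.r_ker[of x] ux[of x] e by simp
      then show ?thesis using True by (simp add: restr_def bW_def)
    qed (simp add: restr_def)
  qed
qed

text \<open>Shows that the bound of \<open>B_dvd\<close> is attained: the vertex potential at
  \<open>v\<close> over all of \<open>I\<close> has leading coefficient \<open>B\<close> up to a
  nonzero constant.\<close>

lemma ex_vertex_derivation: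
  obtains \<eta> u \<kappa> where "\<eta> \<in> log_der V M0" "u \<in> Sym V" "\<And>x. \<eta> \<alpha> x = \<alpha> x ^ a * u x" "\<kappa> \<noteq> 0"
    "\<And>x. x \<in> W \<Longrightarrow> u x = \<kappa> * B x"
proof -
  have J': "J \<subseteq> I - {v}" using J(2) by blast
  obtain h where h1: "\<And>i. i \<in> I \<Longrightarrow> homogeneous V ((\<Sum>l\<in>I. n l) + card J) (h i)"
    and h2: "\<And>i k. i \<in> I - {v} \<Longrightarrow> k \<in> I - {v} \<Longrightarrow> i \<noteq> k \<Longrightarrow>
        sdvd V (\<lambda>x. (z i x - z k x) ^ Suc (n i + n k)) (\<lambda>x. h i x - h k x)"
    and h3: "\<And>k. k \<in> I - {v} \<Longrightarrow> \<exists>u\<in>Sym V. \<exists>\<kappa>. \<kappa> \<noteq> 0 \<and>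
        (\<forall>x. h v x - h k x = (z v x - z k x) ^ (n v + (n k + (if k \<in> J then 1 else 0))) * u x) \<and>
        (\<forall>x\<in>V. z v x = z k x \<longrightarrow> u x = \<kappa> * (\<Prod>l\<in>I - {v, k}. (z v x - z l x) ^ (n l + (if l \<in> J then 1 else 0))))"
    and h4: "\<And>x k. x \<in> V \<Longrightarrow> k \<in> I - {v} \<Longrightarrow> \<forall>l\<in>I - {v}. z l x = z k x \<Longrightarrow> z v x \<noteq> z k x \<Longrightarrow> h v x \<noteq> h k x"
    by (rule ex_vertex_potential[where z = z and n = n, OF V I z vs(1) J']) (assumption | rule that)+
  \<comment> \<open>Vectors dual to the vertices exist only modulo the diagonal, so just the
    differences of the forms are prescribed. This suffices, as every hyperplane is the kernel of
    such a difference.\<close>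
  have "\<exists>x. x \<in> V \<and> (\<forall>i\<in>I. \<forall>j\<in>I. z i x - z j x = (if i = k then 1 else 0) - (if j = k then 1 else 0))" for k
    using type_A_forms_point[OF forms, of "\<lambda>i. if i = k then 1 else 0"] by metis
  then obtain e where e: "\<And>k. e k \<in> V"
    "\<And>k i j. i \<in> I \<Longrightarrow> j \<in> I \<Longrightarrow> z i (e k) - z j (e k) = (if i = k then 1 else 0) - (if j = k then 1 else 0)" by metis
  obtain \<eta> where \<eta>: "\<eta> \<in> Der V" "\<And>\<alpha>. \<alpha> \<in> dual V \<Longrightarrow> \<eta> \<alpha> = (\<lambda>x. \<Sum>k\<in>I. h k x * \<alpha> (e k))"
    using vector_field_Der[OF V, of I e h] e(1) homogeneous_Sym[OF h1] by blast
  have \<eta>_diff: "\<eta> (\<lambda>x. z i x - z j x) = (\<lambda>x. h i x - h j x)" if ij: "i \<in> I" "j \<in> I" for i j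
  proof -
    have "(\<Sum>k\<in>I. h k x * (z i (e k) - z j (e k))) = h i x - h j x" for x
    proof -
      have "(\<Sum>k\<in>I. h k x * (z i (e k) - z j (e k))) =
          (\<Sum>k\<in>I. (if i = k then h k x else 0) - (if j = k then h k x else 0))"
        by (rule sum.cong) (simp_all add: e(2)[OF ij])
      then show ?thesis using ij I by (simp add: sum_subtractf)
    qed
    then show ?thesis using \<eta>(2)[OF diff[OF ij]] by simp
  qed
  have dv: "sdvd V (\<lambda>x. (z i x - z v x) ^ edge_mult n G i v) (\<lambda>x. h i x - h v x)" if i: "i \<in> I - {v}" for i
  proof -
    define m where "m = n v + (n i + (if i \<in> J then 1 else 0))"
    obtain u where u: "u \<in> Sym V" "\<And>x. h v x - h i x = (z v x - z i x) ^ m * u x"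
      using h3[OF i] by (auto simp: m_def)
    have "edge_mult n G i v = m" using J(1)[of i] i G_sym[of i v] by (auto simp: edge_mult_def m_def)
    moreover have hx: "h i x - h v x = (z i x - z v x) ^ m * (- ((-1) ^ m) * u x)" for x
    proof -
      have "(z v x - z i x) ^ m = (z i x - z v x) ^ m * (-1) ^ m"
        unfolding power_mult_distrib[symmetric] by simp
      then show ?thesis using u(2)[of x] by (simp add: algebra_simps)
    qed
    ultimately show ?thesis using sdvdI[OF Sym_cmult[OF u(1)] hx] by simp
  qed
  have dv2: "sdvd V (\<lambda>x. (z i x - z j x) ^ edge_mult n G i j) (\<lambda>x. h i x - h j x)"
    if ij: "i \<in> I - {v}" "j \<in> I - {v}" "i \<noteq> j" for i j
  proof (rule sdvd_power_le)
    show "(\<lambda>x. z i x - z j x) \<in> Sym V" using ij by (intro Sym.form diff) auto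
    show "sdvd V (\<lambda>x. (z i x - z j x) ^ Suc (n i + n j)) (\<lambda>x. h i x - h j x)" by (rule h2[OF ij])
  qed (simp add: edge_mult_def)
  have \<eta>_mem: "\<eta> \<in> log_der V M0"
  proof (rule log_derI[OF V \<eta>(1)])
    fix H assume "H \<in># M0"
    then obtain i j where ij: "i \<in> I" "j \<in> I" "i \<noteq> j" "H = eq_hyperplane V z i j"
      by (rule M0_mem)
    have "\<exists>i j. i \<in> I \<and> j \<in> I \<and> i \<noteq> j \<and> i \<noteq> v \<and> H = eq_hyperplane V z i j"
      using ij eq_hyperplane_commute[of V z i j] by (cases "i = v") auto
    then obtain i j where ij: "i \<in> I" "j \<in> I" "i \<noteq> j" "i \<noteq> v" "H = eq_hyperplane V z i j" by blast
    have "sdvd V (\<lambda>x. (z i x - z j x) ^ edge_mult n G i j) (\<lambda>x. h i x - h j x)"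
      using dv[of i] dv2[of i j] ij by (cases "j = v") auto
    moreover have "\<exists>x. z i x - z j x \<noteq> 0"
      by (rule ex_diff_nonzero[OF ij(1-3)])
    ultimately show "\<exists>\<alpha>\<in>dual V. (\<exists>x. \<alpha> x \<noteq> 0) \<and> H = ker_on V \<alpha> \<and> sdvd V (\<lambda>x. \<alpha> x ^ count M0 H) (\<eta> \<alpha>)"
      using diff[OF ij(1,2)] \<eta>_diff[OF ij(1,2)] count_M0[OF ij(1-3)] ij(5)
      by (intro bexI[of _ "\<lambda>x. z i x - z j x"]) (simp_all add: eq_hyperplane_def)
  qed
  have s: "s \<in> I - {v}" "s \<notin> J" using vs J by auto
  obtain u \<kappa> where u: "u \<in> Sym V" "\<kappa> \<noteq> 0" "\<And>x. h v x - h s x = (z v x - z s x) ^ a * u x"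
    "\<And>x. x \<in> V \<Longrightarrow> z v x = z s x \<Longrightarrow> u x = \<kappa> * (\<Prod>l\<in>I - {v, s}. (z v x - z l x) ^ (n l + (if l \<in> J then 1 else 0)))"
    using h3[OF s(1)] s(2) by (auto simp: a_def)
  have uB: "u x = \<kappa> * (-1) ^ (\<Sum>l\<in>I - {v, s}. bexp l) * B x" if x: "x \<in> W" for x
  proof -
    have x': "x \<in> V" "z v x = z s x" using x by (simp_all add: W_iff)
    have "(\<Prod>l\<in>I - {v, s}. (z v x - z l x) ^ (n l + (if l \<in> J then 1 else 0))) =
        (\<Prod>l\<in>I - {v, s}. (-1) ^ bexp l * bW l x ^ bexp l)"
    proof (rule prod.cong)
      fix l
      have "(z v x - z l x) ^ bexp l = (-1) ^ bexp l * bW l x ^ bexp l"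
        using x x' unfolding power_mult_distrib[symmetric] by (simp add: bW_def restr_def)
      then show "(z v x - z l x) ^ (n l + (if l \<in> J then 1 else 0)) = (-1) ^ bexp l * bW l x ^ bexp l"
        by (simp add: bexp_def)
    qed simp
    then show ?thesis using u(4)[OF x'] by (simp add: B_def prod.distrib power_sum)
  qed
  have "\<eta> \<alpha> x = \<alpha> x ^ a * u x" for x
    using \<eta>_diff[OF vs(1,2)] u(3)[of x] by (simp add: \<alpha>_def)
  moreover have "\<kappa> * (-1) ^ (\<Sum>l\<in>I - {v, s}. bexp l) \<noteq> 0" using u(2) by simp
  ultimately show ?thesis using \<eta>_mem u(1) uB by (intro that) blast+
qed

lemma log_der_M_subset: "log_der V M \<subseteq> log_der V M0"
proof
  fix \<xi> assume \<xi>: "\<xi> \<in> log_der V M"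
  show "\<xi> \<in> log_der V M0"
  proof (rule log_derI[OF V log_der_Der[OF \<xi>]])
    fix H assume "H \<in># M0"
    then obtain i j where ij: "i \<in> I" "j \<in> I" "i \<noteq> j" "H = eq_hyperplane V z i j"
      by (rule M0_mem)
    let ?\<beta> = "\<lambda>x. z i x - z j x"
    have \<beta>: "?\<beta> \<in> dual V" by (rule diff[OF ij(1,2)])
    have "count M0 H \<le> count M H" by (simp add: M0_def)
    moreover have "sdvd V (\<lambda>x. ?\<beta> x ^ count M H) (\<xi> ?\<beta>)"
      using log_der_dvd[OF \<xi> \<beta>] ij(4) by (simp add: eq_hyperplane_def)
    ultimately have "sdvd V (\<lambda>x. ?\<beta> x ^ count M0 H) (\<xi> ?\<beta>)"
      by (rule sdvd_power_le[OF Sym.form[OF \<beta>], rotated])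
    moreover have "\<exists>x. z i x - z j x \<noteq> 0"
      by (rule ex_diff_nonzero[OF ij(1-3)])
    ultimately show "\<exists>\<alpha>\<in>dual V. (\<exists>x. \<alpha> x \<noteq> 0) \<and> H = ker_on V \<alpha> \<and> sdvd V (\<lambda>x. \<alpha> x ^ count M0 H) (\<xi> \<alpha>)"
      using \<beta> ij(4) by (intro bexI[of _ ?\<beta>]) (simp_all add: eq_hyperplane_def)
  qed
qed

text \<open>The two modules differ only by one more factor \<alpha> in \<xi>(\<alpha>), which is
  present if and only if the leading coefficient vanishes on \<open>W\<close>.\<close>

lemma log_der_M_iff:
  assumes \<xi>: "\<xi> \<in> log_der V M0" and u: "u \<in> Sym V" "\<And>x. \<xi> \<alpha> x = \<alpha> x ^ a * u x"
  shows "\<xi> \<in> log_der V M \<longleftrightarrow> (\<forall>x\<in>W. u x = 0)"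
proof
  obtain p where p: "p \<in> V" "\<alpha> p = 1" using ex_alpha_1 by blast
  assume \<xi>': "\<xi> \<in> log_der V M"
  obtain g where g: "g \<in> Sym V" "\<And>x. \<xi> \<alpha> x = \<alpha> x ^ Suc a * g x"
    using log_der_dvd[OF \<xi>' alpha] count_W(1) by (auto elim!: sdvdE simp: W_ker)
  have "u = (\<lambda>x. \<alpha> x * g x)"
    by (rule Sym_cancel[OF V alpha_Sym _ u(1) Sym.mult[OF alpha_Sym g(1)], of p, where k = a])
      (use p in simp, metis g(2) u(2) mult.assoc power_Suc2)
  then show "\<forall>x\<in>W. u x = 0" by (simp add: W_ker ker_on_def)
next
  obtain p where p: "p \<in> V" "\<alpha> p = 1" using ex_alpha_1 by blast
  assume "\<forall>x\<in>W. u x = 0"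
  then have "sdvd V \<alpha> u" using p by (intro form_dvd[OF V alpha _ u(1), of p]) (auto simp: W_ker)
  then obtain g where g: "g \<in> Sym V" "\<And>x. u x = \<alpha> x * g x" by (auto elim: sdvdE)
  show "\<xi> \<in> log_der V M"
  proof (rule log_derI[OF V log_der_Der[OF \<xi>]])
    fix H assume H: "H \<in># M"
    show "\<exists>\<alpha>\<in>dual V. (\<exists>x. \<alpha> x \<noteq> 0) \<and> H = ker_on V \<alpha> \<and> sdvd V (\<lambda>x. \<alpha> x ^ count M H) (\<xi> \<alpha>)"
    proof (cases "H = W")
      case True
      have "sdvd V (\<lambda>x. \<alpha> x ^ Suc a) (\<xi> \<alpha>)" by (rule sdvdI[OF g(1)]) (simp add: u(2) g(2) mult_ac)
      then show ?thesis using True alpha p count_W(1)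
        by (intro bexI[of _ \<alpha>] conjI exI[of _ p]) (simp_all add: W_ker)
    next
      case False
      obtain i j where ij: "i \<in> I" "j \<in> I" "i \<noteq> j" "H = eq_hyperplane V z i j" using M_mem[OF H] by blast
      let ?\<beta> = "\<lambda>x. z i x - z j x"
      have \<beta>: "?\<beta> \<in> dual V" by (rule diff[OF ij(1,2)])
      have "count M H = count M0 H" using False by (simp add: M0_def)
      then have "sdvd V (\<lambda>x. ?\<beta> x ^ count M H) (\<xi> ?\<beta>)"
        using log_der_dvd[OF \<xi> \<beta>] ij(4) by (simp add: eq_hyperplane_def)
      moreover have "\<exists>x. z i x - z j x \<noteq> 0"
        by (rule ex_diff_nonzero[OF ij(1-3)])
      ultimately show ?thesis using \<beta> ij(4) by (intro bexI[of _ ?\<beta>]) (simp_all add: eq_hyperplane_def)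
    qed
  qed
qed

end

context complex_space
begin

lemma Der_outside_space: "\<theta> \<in> Der V \<Longrightarrow> x \<notin> V \<Longrightarrow> \<theta> f x = 0"
  using Der_outside[of \<theta> V f] Sym_outside[OF Der_Sym[of \<theta> V f]] by (cases "f \<in> Sym V") simp_all

lemma log_der_minus_multiple:
  assumes \<xi>: "\<xi> \<in> log_der V M" and \<zeta>: "\<zeta> \<in> log_der V M" and q: "q \<in> Sym V"
  shows "(\<lambda>f x. \<xi> f x - q x * \<zeta> f x) \<in> log_der V M"
proof -
  define c where "c i = (if i then const_on V 1 else (\<lambda>x. -1 * q x))" for i :: bool
  define b where "b i = (if i then \<xi> else \<zeta>)" for i :: bool
  have "(\<lambda>f x. \<Sum>i\<in>{True, False}. c i x * b i f x) \<in> log_der V M"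
    using \<xi> \<zeta> Sym_cmult[OF q, of "-1"] Sym.const by (intro log_der_lincomb) (auto simp: c_def b_def)
  moreover have "(\<lambda>f x. \<Sum>i\<in>{True, False}. c i x * b i f x) = (\<lambda>f x. \<xi> f x - q x * \<zeta> f x)"
    using Der_outside_space[OF log_der_Der[OF \<xi>]] by (auto simp: c_def b_def const_on_def fun_eq_iff)
  ultimately show ?thesis by simp
qed

lemma log_der_multiple:
  assumes \<zeta>: "\<zeta> \<in> log_der V M" and q: "q \<in> Sym V"
  shows "(\<lambda>f x. q x * \<zeta> f x) \<in> log_der V M"
  using log_der_lincomb[of "{()}" "\<lambda>_. q" V "\<lambda>_. \<zeta>"] assms by simp

end

context edge_addition
begin

definition "\<delta> = (\<Sum>l\<in>I. n l) + card J"

lemma W_zero: "0 \<in> W"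
  using W_subspace by (rule subspace_0)

text \<open>Identifies the degree of the vertex potential with \<open>a\<close> plus the degree of
  \<open>B\<close>, the least degree compatible with a nonzero leading coefficient.\<close>

lemma delta_eq: "\<delta> = a + (\<Sum>j\<in>I - {v, s}. bexp j)"
proof -
  have "(\<Sum>l\<in>I. n l) = n v + (n s + (\<Sum>l\<in>I - {v, s}. n l))"
  proof -
    have "I - {v} - {s} = I - {v, s}" by auto
    then show ?thesis using I vs sum.remove[of I v n] sum.remove[of "I - {v}" s n] by simp
  qed
  moreover have "(\<Sum>l\<in>I - {v, s}. if l \<in> J then 1 else 0 :: nat) = card J"
  proof -
    have "{l \<in> I - {v, s}. l \<in> J} = J" using J(2) by auto
    then show ?thesis using I by (simp add: sum.If_cases Int_def)
  qed
  ultimately show ?thesis by (simp add: \<delta>_def a_def bexp_def sum.distrib)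
qed

lemma B_homogeneous: "homogeneous W (\<Sum>j\<in>I - {v, s}. bexp j) (restr W B)"
  unfolding B_def using I bW_dual by (intro homogeneous_prod_powers) auto

text \<open>A point with pairwise distinct values, except that \<open>v\<close> and \<open>s\<close>
  share one, lies on \<open>W\<close> and on no other hyperplane.\<close>

lemma B_nonzero: "\<exists>x\<in>W. B x \<noteq> 0"
proof -
  obtain f :: "'i \<Rightarrow> nat" and m where f: "inj_on f I" using finite_imp_inj_to_nat_seg[OF I] by blast
  define c where "c i = (if i = v then of_nat (f s) else of_nat (f i) :: complex)" for i
  obtain x where x: "x \<in> V" "\<And>i j. i \<in> I \<Longrightarrow> j \<in> I \<Longrightarrow> z i x - z j x = c i - c j"
    using type_A_forms_point[OF forms, of c] by blast
  have "x \<in> W" using x(1) x(2)[OF vs(1,2)] vs(3) by (simp add: W_iff c_def)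
  moreover have "bW j x \<noteq> 0" if "j \<in> I - {v, s}" for j
    using that x(2)[of j s] vs \<open>x \<in> W\<close> inj_on_eq_iff[OF f, of j s] by (auto simp: bW_def restr_def c_def)
  ultimately show ?thesis using I by (intro bexI[of _ x]) (auto simp: B_def)
qed

lemma B_cancel:
  assumes f: "f \<in> Sym V" and g: "g \<in> Sym V" and eq: "\<And>x. x \<in> W \<Longrightarrow> B x * f x = B x * g x" and x: "x \<in> W"
  shows "f x = g x"
proof -
  obtain p where "p \<in> W" "B p \<noteq> 0" using B_nonzero by blast
  then have "restr W f = restr W g"
    using eq by (intro Sym_cancel[OF W_subspace homogeneous_Sym[OF B_homogeneous] _ Sym_restr[OF f W_V W_subspace]
      Sym_restr[OF g W_V W_subspace], of p, where k = 1]) (simp_all add: restr_def)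
  from fun_cong[OF this, of x] x show ?thesis by (simp add: restr_def)
qed

text \<open>Dividing first by \<alpha>^a on \<open>V\<close> and then by \<open>B\<close> on
  \<open>W\<close> lowers the degree by \<delta>. In particular a derivation of degree below
  \<delta> has leading coefficient zero.\<close>

lemma quotient_homogeneous:
  assumes hom: "homogeneous V p f" and u: "u \<in> Sym V" "\<And>x. f x = \<alpha> x ^ a * u x"
    and g: "g \<in> Sym W" "\<And>x. restr W u x = B x * g x"
  shows "g = (\<lambda>x. 0) \<or> \<delta> \<le> p \<and> homogeneous W (p - \<delta>) g"
proof -
  obtain q where q: "q \<in> V" "\<alpha> q = 1" using ex_alpha_1 by blast
  obtain w where w: "w \<in> W" "B w \<noteq> 0" using B_nonzero by blast
  have "homogeneous V (a + 0) (\<lambda>x. \<alpha> x ^ a * const_on V 1 x)"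
    by (rule homogeneous_power_mult[OF alpha homogeneous.const])
  then have qa: "homogeneous V a (\<lambda>x. \<alpha> x ^ a * const_on V 1 x)" by simp
  have "f = (\<lambda>x. (\<alpha> x ^ a * const_on V 1 x) * u x)"
    using u(2) Sym_outside[OF u(1)] by (auto simp: const_on_def)
  then have "homogeneous V p (\<lambda>x. (\<alpha> x ^ a * const_on V 1 x) * u x)" using hom by simp
  note hu = homogeneous_quotient[OF V qa _ u(1) this, of q]
  have Bg: "restr W u = (\<lambda>x. restr W B x * g x)"
    using g Sym_outside[OF g(1)] by (auto simp: restr_def fun_eq_iff)
  have Bg0: "g = (\<lambda>x. 0)" if "u = (\<lambda>x. 0)"
  proof (rule Sym_cancel[OF W_subspace homogeneous_Sym[OF B_homogeneous] _ g(1) Sym_0, of w, where k = 1])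
    show "restr W B w \<noteq> 0" using w by (simp add: restr_def)
    show "restr W B x ^ 1 * g x = restr W B x ^ 1 * 0" if "x \<in> W" for x
      using fun_cong[OF Bg, of x] \<open>u = (\<lambda>x. 0)\<close> by (simp add: restr_def split: if_splits)
  qed
  show ?thesis
  proof (cases "a \<le> p")
    case True
    then have "homogeneous V (p - a) u" using hu(1) q by (simp add: const_on_def)
    then have "homogeneous W (p - a) (\<lambda>x. restr W B x * g x)"
      using homogeneous_restr[OF _ W_V W_subspace] unfolding Bg[symmetric] by blast
    note hg = homogeneous_quotient[OF W_subspace B_homogeneous _ g(1) this, of w]
    have "restr W B w \<noteq> 0" using w by (simp add: restr_def)
    from hg[OF this] show ?thesis using True unfolding delta_eq
      by (cases "(\<Sum>j\<in>I - {v, s}. bexp j) \<le> p - a") auto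
  next
    case False
    then have "u = (\<lambda>x. 0)" using hu(2) q by (simp add: const_on_def)
    then show ?thesis using Bg0 by blast
  qed
qed

lemma ex_lift:
  assumes "homogeneous W m g"
  shows "\<exists>q. homogeneous V m q \<and> (\<forall>x\<in>W. q x = g x)"
proof -
  obtain p where p: "p \<in> V" "\<alpha> p = 1" using ex_alpha_1 by blast
  note pf = projection_facts[OF V alpha p]
  have "homogeneous V m (restr V (\<lambda>x. g (x - \<alpha> x *\<^sub>V p)))"
    by (rule homogeneous_pullback[OF assms[unfolded W_ker]]) (use pf in auto)
  moreover have "\<forall>x\<in>W. restr V (\<lambda>x. g (x - \<alpha> x *\<^sub>V p)) x = g x"
    using W_V by (auto simp: restr_def W_ker ker_on_def)
  ultimately show ?thesis by blast
qed

text \<open>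
  Some basis element has \<open>\<xi> \<alpha> = \<alpha>\<^sup>a u\<close> with \<open>u\<close> a nonzero multiple of \<open>B\<close> on \<open>W\<close>, because the
  derivation of the vertex potential is of this form; it is multiplied by \<open>\<alpha>\<close>, and multiples of
  it are subtracted from the others.
\<close>

lemma addition:
  assumes E: "has_exponents V M0 E"
  shows "\<delta> \<in># E" "has_exponents V M (add_mset (Suc \<delta>) (E - {#\<delta>#}))"
proof -
  obtain r b d where mb: "module_basis V (log_der V M0) r b" and d: "\<And>i. i \<in> {1..r} \<Longrightarrow> pdeg V (b i) (d i)"
    and Ed: "E = image_mset d (mset_set {1..r})"
    using E by (rule has_exponents_basis) (rule that)
  have b_mem: "b i \<in> log_der V M0" if "i \<in> {1..r}" for i by (rule module_basis_mem[OF mb that])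
  have "\<exists>u. i \<in> {1..r} \<longrightarrow> u \<in> Sym V \<and> (\<forall>x. b i \<alpha> x = \<alpha> x ^ a * u x)" for i
    using log_der_alpha[OF b_mem, of i] by metis
  then obtain u where u: "\<And>i. i \<in> {1..r} \<Longrightarrow> u i \<in> Sym V" "\<And>i x. i \<in> {1..r} \<Longrightarrow> b i \<alpha> x = \<alpha> x ^ a * u i x"
    by metis
  have "\<exists>g. i \<in> {1..r} \<longrightarrow> g \<in> Sym W \<and> (\<forall>x. restr W (u i) x = B x * g x)" for i
  proof (cases "i \<in> {1..r}")
    case True
    show ?thesis using B_dvd[OF b_mem[OF True] u(1)[OF True] u(2)[OF True]] unfolding sdvd_def by metis
  qed blast
  then obtain g where g: "\<And>i. i \<in> {1..r} \<Longrightarrow> g i \<in> Sym W" "\<And>i x. i \<in> {1..r} \<Longrightarrow> restr W (u i) x = B x * g i x"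
    by metis
  have uW: "u i x = B x * g i x" if "i \<in> {1..r}" "x \<in> W" for i x
    using g(2)[OF that(1), of x] that(2) by (simp add: restr_def)
  have gd: "g i = (\<lambda>x. 0) \<or> \<delta> \<le> d i \<and> homogeneous W (d i - \<delta>) (g i)" if i: "i \<in> {1..r}" for i
  proof (rule quotient_homogeneous)
    show "homogeneous V (d i) (b i \<alpha>)" using d[OF i] alpha by (simp add: pdeg_def)
  qed (use u g i in auto)
  have sum_u: "(\<Sum>i=1..r. c i x * b i \<alpha> x) = \<alpha> x ^ a * (\<Sum>i=1..r. c i x * u i x)" for c x
    unfolding sum_distrib_left by (rule sum.cong) (simp_all add: u(2))
  have sum_uS: "(\<lambda>x. \<Sum>i=1..r. c i x * u i x) \<in> Sym V" if "\<And>i. i \<in> {1..r} \<Longrightarrow> c i \<in> Sym V" for c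
    using that u(1) by (intro Sym_sum Sym.mult) auto
  have sum_uW: "(\<Sum>i=1..r. c i x * u i x) = B x * (\<Sum>i=1..r. c i x * g i x)" if "x \<in> W" for c x
    unfolding sum_distrib_left by (rule sum.cong) (simp_all add: uW that)
  \<comment> \<open>Expanding the vertex derivation gives \<Sum> c_i g_i = \<kappa> on
    \<open>W\<close> with \<kappa> nonzero. At the origin some summand must be nonzero.\<close>
  obtain k where k: "k \<in> {1..r}" "g k 0 \<noteq> 0"
  proof -
    obtain \<eta> w \<kappa> where \<eta>: "\<eta> \<in> log_der V M0" "w \<in> Sym V" "\<And>x. \<eta> \<alpha> x = \<alpha> x ^ a * w x" "\<kappa> \<noteq> 0"
      "\<And>x. x \<in> W \<Longrightarrow> w x = \<kappa> * B x" using ex_vertex_derivation by blast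
    obtain c where c: "\<And>i. i \<in> {1..r} \<Longrightarrow> c i \<in> Sym V" and eq: "\<eta> = (\<lambda>f x. \<Sum>i=1..r. c i x * b i f x)"
      by (rule module_basis_generate[OF mb \<eta>(1)]) (rule that)
    obtain p where p: "p \<in> V" "\<alpha> p = 1" using ex_alpha_1 by blast
    have w: "w = (\<lambda>x. \<Sum>i=1..r. c i x * u i x)"
    proof (rule Sym_cancel[OF V alpha_Sym _ \<eta>(2) sum_uS[OF c], of p, where k = a])
      show "\<alpha> x ^ a * w x = \<alpha> x ^ a * (\<Sum>i=1..r. c i x * u i x)" for x
        unfolding sum_u[symmetric] \<eta>(3)[symmetric] eq ..
    qed (use p in auto)
    have "restr W (\<lambda>x. \<Sum>i=1..r. c i x * g i x) \<in> Sym W"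
    proof -
      have "(\<lambda>x. \<Sum>i=1..r. restr W (c i) x * g i x) \<in> Sym W"
        using c g(1) Sym_restr[OF _ W_V W_subspace] by (intro Sym_sum Sym.mult) auto
      moreover have "(\<lambda>x. \<Sum>i=1..r. restr W (c i) x * g i x) = restr W (\<lambda>x. \<Sum>i=1..r. c i x * g i x)"
        by (auto simp: restr_def)
      ultimately show ?thesis by simp
    qed
    then have "restr W (\<lambda>x. \<Sum>i=1..r. c i x * g i x) = const_on W \<kappa>"
    proof -
      obtain q where q: "q \<in> W" "B q \<noteq> 0" using B_nonzero by blast
      assume S: "restr W (\<lambda>x. \<Sum>i=1..r. c i x * g i x) \<in> Sym W"
      show ?thesis
      proof (rule Sym_cancel[OF W_subspace homogeneous_Sym[OF B_homogeneous] _ S Sym.const, of q, where k = 1])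
        show "restr W B q \<noteq> 0" using q by (simp add: restr_def)
        fix x assume x: "x \<in> W"
        have "B x * (\<Sum>i=1..r. c i x * g i x) = B x * \<kappa>"
          using sum_uW[OF x, of c] \<eta>(5)[OF x] fun_cong[OF w, of x] by (simp add: mult.commute)
        then show "restr W B x ^ 1 * restr W (\<lambda>x. \<Sum>i=1..r. c i x * g i x) x = restr W B x ^ 1 * const_on W \<kappa> x"
          using x by (simp add: restr_def const_on_def)
      qed
    qed
    from fun_cong[OF this, of 0] have "(\<Sum>i=1..r. c i 0 * g i 0) = \<kappa>"
      using W_zero by (simp add: restr_def const_on_def)
    then have "(\<Sum>i=1..r. c i 0 * g i 0) \<noteq> 0" using \<eta>(4) by simp
    then obtain i where "i \<in> {1..r}" "c i 0 * g i 0 \<noteq> 0" by (rule sum.not_neutral_contains_not_neutral)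
    then show ?thesis using that[of i] by simp
  qed
  define \<kappa> where "\<kappa> = g k 0"
  have hk: "\<delta> \<le> d k" "homogeneous W (d k - \<delta>) (g k)" using gd[OF k(1)] k(2) by auto
  \<comment> \<open>A homogeneous polynomial that is nonzero at the origin has degree 0.\<close>
  have dk: "d k = \<delta>"
  proof (rule ccontr)
    assume "d k \<noteq> \<delta>"
    then have "(0 :: complex) ^ (d k - \<delta>) = 0" using hk(1) by (intro zero_power) simp
    then have "g k 0 = 0" using homogeneous_scale[OF hk(2) W_subspace W_zero, of 0]
      by (simp only: scale_zero_left mult_zero_left)
    then show False using k(2) by simp
  qed
  have gk: "g k x = \<kappa>" if "x \<in> W" for x
    using homogeneous_0_const[of W "g k" x] hk W_subspace that by (simp add: dk \<kappa>_def)
  have \<kappa>: "\<kappa> \<noteq> 0" using k by (simp add: \<kappa>_def)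
  \<comment> \<open>The lift of g_i / \<kappa> is chosen homogeneous of degree d i - \<delta>, so
    that subtracting its multiple of b_k keeps the degree d i.\<close>
  have "\<exists>q. i \<in> {1..r} \<longrightarrow> (q = (\<lambda>x. 0) \<or> \<delta> \<le> d i \<and> homogeneous V (d i - \<delta>) q) \<and> (\<forall>x\<in>W. q x = g i x / \<kappa>)" for i
  proof (cases "i \<in> {1..r} \<and> g i \<noteq> (\<lambda>x. 0)")
    case True
    then have "\<delta> \<le> d i" "homogeneous W (d i - \<delta>) (g i)" using gd by blast+
    then show ?thesis using ex_lift[OF homogeneous_cmult[of W _ "g i" "1 / \<kappa>"]] by fastforce
  qed (auto intro: exI[of _ "\<lambda>x. 0"])
  then obtain q where q: "\<And>i. i \<in> {1..r} \<Longrightarrow> q i = (\<lambda>x. 0) \<or> \<delta> \<le> d i \<and> homogeneous V (d i - \<delta>) (q i)"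
    "\<And>i x. i \<in> {1..r} \<Longrightarrow> x \<in> W \<Longrightarrow> q i x = g i x / \<kappa>" by metis
  have qS: "q i \<in> Sym V" if "i \<in> {1..r}" for i using q(1)[OF that] homogeneous_Sym Sym_0 by fastforce
  let ?b = "\<lambda>i. if i = k then (\<lambda>f x. \<alpha> x * b k f x) else (\<lambda>f x. b i f x - q i x * b k f x)"
  have b'k: "(\<lambda>f x. \<alpha> x * b k f x) \<in> log_der V M"
  proof -
    have m: "(\<lambda>f x. \<alpha> x * b k f x) \<in> log_der V M0" by (rule log_der_multiple[OF b_mem[OF k(1)] alpha_Sym])
    have "(\<lambda>x. \<alpha> x * u k x) \<in> Sym V" by (rule Sym.mult[OF alpha_Sym u(1)[OF k(1)]])
    from log_der_M_iff[OF m this] show ?thesis using u(2)[OF k(1)] by (auto simp: W_ker ker_on_def mult_ac)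
  qed
  have b': "(\<lambda>f x. b i f x - q i x * b k f x) \<in> log_der V M" if i: "i \<in> {1..r}" for i
  proof -
    have m: "(\<lambda>f x. b i f x - q i x * b k f x) \<in> log_der V M0"
      by (rule log_der_minus_multiple[OF b_mem[OF i] b_mem[OF k(1)] qS[OF i]])
    have "(\<lambda>x. u i x - q i x * u k x) \<in> Sym V" using u(1) qS i k(1) by (intro Sym_minus Sym.mult)
    from log_der_M_iff[OF m this] show ?thesis using u(2) i k(1) uW gk q(2) \<kappa> by (auto simp: algebra_simps)
  qed
  have mb': "module_basis V (log_der V M) r ?b"
  proof -
    obtain p where p: "p \<in> V" "\<alpha> p = 1" using ex_alpha_1 by blast
    show ?thesis
    proof (rule basis_exchange[OF V mb zero_log_der log_der_M_subset k(1) qS alpha_Sym _ b' b'k])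
      show "\<alpha> p \<noteq> 0" using p by simp
      fix c assume c: "\<And>i. i \<in> {1..r} \<Longrightarrow> c i \<in> Sym V" and m: "(\<lambda>f x. \<Sum>i=1..r. c i x * b i f x) \<in> log_der V M"
      let ?C = "\<lambda>x. c k x + (\<Sum>i\<in>{1..r} - {k}. c i x * q i x)"
      have C: "?C \<in> Sym V" using c k(1) qS by (intro Sym.add Sym_sum Sym.mult) auto
      have "\<forall>x\<in>W. (\<Sum>i=1..r. c i x * u i x) = 0"
      proof -
        have "(\<lambda>x. \<Sum>i=1..r. c i x * u i x) \<in> Sym V" by (rule sum_uS) (rule c)
        from log_der_M_iff[OF subsetD[OF log_der_M_subset m] this, OF sum_u[of c]] show ?thesis using m by blast
      qed
      then have z: "B x * (\<Sum>i=1..r. c i x * g i x) = 0" if "x \<in> W" for x using sum_uW that by simp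
      have "?C x = 0" if x: "x \<in> W" for x
      proof (rule B_cancel[OF C Sym_0 _ x])
        fix x assume x: "x \<in> W"
        have "(\<Sum>i\<in>{1..r} - {k}. c i x * g i x) = \<kappa> * (\<Sum>i\<in>{1..r} - {k}. c i x * q i x)"
          unfolding sum_distrib_left by (rule sum.cong) (use q(2) x \<kappa> in auto)
        then have "(\<Sum>i=1..r. c i x * g i x) = \<kappa> * ?C x"
          using sum.remove[of "{1..r}" k "\<lambda>i. c i x * g i x"] k(1) gk[OF x] by (simp add: algebra_simps)
        then show "B x * ?C x = B x * 0" using z[OF x] \<kappa> by simp
      qed
      then show "sdvd V \<alpha> ?C" using p by (intro form_dvd[OF V alpha _ C, of p]) (auto simp: W_ker)
    qed
  qed
  have d': "pdeg V (?b i) (if i = k then Suc \<delta> else d i)" if i: "i \<in> {1..r}" for i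
  proof (cases "i = k")
    case True
    then show ?thesis using d[OF k(1)] log_der_Der[OF b'k] dk alpha
      by (auto simp: pdeg_def intro: homogeneous.mult)
  next
    case False
    have "homogeneous V (d i) (\<lambda>x. b i \<beta> x - q i x * b k \<beta> x)" if \<beta>: "\<beta> \<in> dual V" for \<beta>
    proof -
      have h: "homogeneous V (d i) (b i \<beta>)" "homogeneous V \<delta> (b k \<beta>)"
        using d[OF i] d[OF k(1)] dk \<beta> by (auto simp: pdeg_def)
      show ?thesis using q(1)[OF i]
      proof
        assume "\<delta> \<le> d i \<and> homogeneous V (d i - \<delta>) (q i)"
        then show ?thesis using homogeneous_minus[OF h(1)] homogeneous_mult[OF _ h(2), of "d i - \<delta>" "q i"] by simp
      qed (use h in simp)
    qed
    then show ?thesis using False log_der_Der[OF b'[OF i]] by (simp add: pdeg_def)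
  qed
  have ms: "mset_set {1..r} = add_mset k (mset_set ({1..r} - {k}))"
    using k(1) by (simp add: mset_set.remove)
  then have E2: "E = add_mset \<delta> (image_mset d (mset_set ({1..r} - {k})))" by (simp add: Ed dk)
  then show "\<delta> \<in># E" by simp
  have "image_mset (\<lambda>i. if i = k then Suc \<delta> else d i) (mset_set ({1..r} - {k})) = image_mset d (mset_set ({1..r} - {k}))"
    by (rule image_mset_cong) auto
  then have "image_mset (\<lambda>i. if i = k then Suc \<delta> else d i) (mset_set {1..r}) = add_mset (Suc \<delta>) (E - {#\<delta>#})"
    unfolding ms E2 by simp
  then have E': "add_mset (Suc \<delta>) (E - {#\<delta>#}) = image_mset (\<lambda>i. if i = k then Suc \<delta> else d i) (mset_set {1..r})"
    by (rule sym)
  show "has_exponents V M (add_mset (Suc \<delta>) (E - {#\<delta>#}))"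
    unfolding has_exponents_def
  proof (intro exI conjI ballI)
    show "module_basis V (log_der V M) r ?b" by (rule mb')
    show "pdeg V (?b i) (if i = k then Suc \<delta> else d i)" if "i \<in> {1..r}" for i by (rule d'[OF that])
  qed (rule E')
qed

end

section \<open>The Euler restriction\<close>

context complex_space
begin

lemma type_A_forms_restrict:
  assumes cfg: "type_A_forms V I z" and vs: "v \<in> I" "s \<in> I" "v \<noteq> s"
  shows "type_A_forms (eq_hyperplane V z v s) (I - {v}) (\<lambda>i. restr (eq_hyperplane V z v s) (z i))"
    and "dim V = Suc (dim (eq_hyperplane V z v s))"
proof -
  define \<alpha> where "\<alpha> = (\<lambda>x. z v x - z s x)"
  define W where "W = eq_hyperplane V z v s"
  have W: "W = ker_on V \<alpha>" by (simp add: W_def eq_hyperplane_def \<alpha>_def)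
  have V: "fd_subspace V" "finite I" "\<And>i. i \<in> I \<Longrightarrow> z i \<in> dual V"
    using cfg by (simp_all add: type_A_forms_def)
  have alpha: "\<alpha> \<in> dual V" unfolding \<alpha>_def by (rule type_A_forms_diff_dual[OF cfg vs(1,2)])
  obtain x where "x \<in> V" "\<And>i j. i \<in> I \<Longrightarrow> j \<in> I \<Longrightarrow> z i x - z j x = (if i = v then 1 else 0) - (if j = v then 1 else 0)"
    using type_A_forms_point[OF cfg, of "\<lambda>i. if i = v then 1 else 0"] by blast
  then have p: "x \<in> V" "\<alpha> x = 1" using vs by (auto simp: \<alpha>_def)
  show "dim V = Suc (dim (eq_hyperplane V z v s))"
    using dim_ker[OF V(1) alpha p] by (simp add: W[symmetric] W_def)
  have sub: "subspace W" "W \<subseteq> V"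
    using subspace_ker[OF alpha fd_subspace_subspace[OF V(1)]] by (auto simp: W ker_on_def)
  have "type_A_forms W (I - {v}) (\<lambda>i. restr W (z i))"
    unfolding type_A_forms_def
  proof (intro conjI ballI allI)
    show "fd_subspace W" unfolding W by (rule fd_subspace_ker[OF V(1) alpha p])
    show "finite (I - {v})" using V(2) by simp
    show "restr W (z i) \<in> dual W" if "i \<in> I - {v}" for i
      using that V(3) sub by (intro dual_restr) auto
    fix c :: "'a \<Rightarrow> complex"
    \<comment> \<open>Giving \<open>v\<close> the value of \<open>s\<close> puts the realizing point
      on the hyperplane.\<close>
    define c' where "c' = c(v := c s)"
    obtain x t where x: "x \<in> V" "\<forall>i\<in>I. z i x = c' i + t" using cfg unfolding type_A_forms_def by blast
    then have "x \<in> W" using vs by (simp add: W_def eq_hyperplane_iff c'_def)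
    then show "\<exists>x\<in>W. \<exists>t. \<forall>i\<in>I - {v}. restr W (z i) x = c i + t"
      using x by (intro bexI[of _ x] exI[of _ t]) (auto simp: restr_def c'_def)
  qed
  then show "type_A_forms (eq_hyperplane V z v s) (I - {v}) (\<lambda>i. restr (eq_hyperplane V z v s) (z i))"
    by (simp add: W_def)
qed

text \<open>Protects the truncated subtraction \<open>dim V + 1 - card I\<close> in the number of
  zero exponents.\<close>

lemma type_A_forms_card:
  assumes "type_A_forms V I z"
  shows "card I \<le> Suc (dim V)"
  using assms
proof (induction "card I" arbitrary: V I z rule: less_induct)
  case less
  have fin: "finite I" using less.prems by (simp add: type_A_forms_def)
  show ?case
  proof (cases "card I \<le> 1")
    case False
    then obtain v where v: "v \<in> I" by fastforce
    then have card: "card (I - {v}) = card I - 1" using fin by simp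
    then have "I - {v} \<noteq> {}" using False by force
    then obtain s where s: "s \<in> I" "v \<noteq> s" by blast
    show ?thesis
      using card less.hyps[OF _ type_A_forms_restrict(1)[OF less.prems v s]] type_A_forms_restrict(2)[OF less.prems v s] False
      by simp
  qed simp
qed

end

context edge_addition
begin

definition "n' = n(s := n v + n s)"
definition "z' i = restr W (z i)"
definition "\<nu>' = edge_mult n' G"
definition "Y i j = eq_hyperplane W z' i j"

lemma Y_iff: "x \<in> Y i j \<longleftrightarrow> x \<in> V \<and> z v x = z s x \<and> z i x = z j x"
  by (auto simp: Y_def eq_hyperplane_iff z'_def restr_def W_iff)

lemma restricted_forms: "type_A_forms W (I - {v}) z'"
  using type_A_forms_restrict(1)[OF forms vs] unfolding W_def z'_def .

lemma dim_W: "dim V = Suc (dim W)"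
  using type_A_forms_restrict(2)[OF forms vs] unfolding W_def .

section \<open>Local Euler multiplicities\<close>

lemma ex_dual_basis_alpha:
  assumes "i \<in> I" "j \<in> I" "i \<noteq> j" "i \<notin> {v, s}"
  shows "\<exists>m y u. dual_basis V m y u \<and> 2 \<le> m \<and> y 1 = \<alpha> \<and> y 2 = (\<lambda>x. z i x - z j x)"
    and "\<exists>x\<in>V. \<alpha> x = 1 \<and> z i x - z j x = 0" and "\<exists>x\<in>V. \<alpha> x = 0 \<and> z i x - z j x = 1"
proof -
  \<comment> \<open>The point must have \<alpha> = 1 and equal values at i and j: raise
    \<open>v\<close>, or lower \<open>s\<close> if j is \<open>v\<close> itself.\<close>
  define c where "c k = (if j = v then (if k = s then -1 else 0) else if k = v then 1 else 0 :: complex)" for k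
  obtain p where p: "p \<in> V" "\<And>k l. k \<in> I \<Longrightarrow> l \<in> I \<Longrightarrow> z k p - z l p = c k - c l"
    using type_A_forms_point[OF forms, of c] by blast
  obtain q where q: "q \<in> V" "\<And>k l. k \<in> I \<Longrightarrow> l \<in> I \<Longrightarrow> z k q - z l q = (if k = i then 1 else 0) - (if l = i then 1 else 0)"
    using type_A_forms_point[OF forms, of "\<lambda>k. if k = i then 1 else 0"] by blast
  have p': "\<alpha> p = 1" "z i p - z j p = 0"
    using p(2)[OF vs(1,2)] p(2)[OF assms(1,2)] assms vs by (auto simp: \<alpha>_def c_def split: if_splits)
  have q': "\<alpha> q = 0" "z i q - z j q = 1"
    using q(2)[OF vs(1,2)] q(2)[OF assms(1,2)] assms by (auto simp: \<alpha>_def)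
  show "\<exists>m y u. dual_basis V m y u \<and> 2 \<le> m \<and> y 1 = \<alpha> \<and> y 2 = (\<lambda>x. z i x - z j x)"
    by (rule ex_dual_basis_two[OF fdV alpha diff[OF assms(1,2)] p(1) p' q(1) q'])
  show "\<exists>x\<in>V. \<alpha> x = 1 \<and> z i x - z j x = 0" using p(1) p' by blast
  show "\<exists>x\<in>V. \<alpha> x = 0 \<and> z i x - z j x = 1" using q(1) q' by blast
qed

lemma separate_Y:
  assumes ij: "i \<in> I" "j \<in> I" and pq: "p \<in> I" "q \<in> I" and sub: "Y i j \<subseteq> eq_hyperplane V z p q"
    and A: "v \<in> A \<longleftrightarrow> s \<in> A" "i \<in> A \<longleftrightarrow> j \<in> A"
  shows "p \<in> A \<longleftrightarrow> q \<in> A"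
proof -
  obtain x where x: "x \<in> V" "\<And>k l. k \<in> I \<Longrightarrow> l \<in> I \<Longrightarrow> z k x = z l x \<longleftrightarrow> (k \<in> A \<longleftrightarrow> l \<in> A)"
    using type_A_forms_separate[OF forms, of A] by blast
  then have "x \<in> Y i j" using ij vs A by (simp add: Y_iff)
  then have "x \<in> eq_hyperplane V z p q" using sub by blast
  then show ?thesis using x(2)[OF pq] by (simp add: eq_hyperplane_iff)
qed

lemma euler_multiplicity_triangle:
  assumes j: "j \<in> I" "j \<noteq> v" "j \<noteq> s"
  shows "euler_multiplicity V M W (Y j s) (\<nu>' j s)"
proof -
  obtain e P1 P2 R1 R2 r \<kappa> where
    "local_pair scale V \<alpha> (\<lambda>x. z j x - z s x) a (edge_mult n G j s) (edge_mult n G j v)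
       (n v + n s + n j + (if (s, j) \<in> G then 1 else 0)) e P1 P2 R1 R2 r \<kappa>"
    using triangle_pair[OF j] by (elim exE conjE) (rule that)
  then interpret L: local_pair scale V \<alpha> "\<lambda>x. z j x - z s x" a "edge_mult n G j s" "edge_mult n G j v"
    "n v + n s + n j + (if (s, j) \<in> G then 1 else 0)" e P1 P2 R1 R2 r \<kappa> by -
  obtain m y u where db: "dual_basis V m y u" "2 \<le> m" "y 1 = \<alpha>" "y 2 = (\<lambda>x. z j x - z s x)"
    using ex_dual_basis_alpha(1)[OF j(1) vs(2) j(3)] j by blast
  have g: "(\<lambda>x. z j x - z s x - \<alpha> x) = (\<lambda>x. z j x - z v x)" by (simp add: \<alpha>_def)
  have "euler_multiplicity V M (ker_on V \<alpha>) (Y j s) (n v + n s + n j + (if (s, j) \<in> G then 1 else 0))"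
  proof (rule L.euler_multiplicity_pair[OF db])
    show "Y j s = {x \<in> V. \<alpha> x = 0 \<and> z j x - z s x = 0}" by (auto simp: Y_iff \<alpha>_def)
    show "count M (ker_on V \<alpha>) = Suc a" using count_W(1) by (simp add: W_ker)
    show "count M (ker_on V (\<lambda>x. z j x - z s x)) = edge_mult n G j s"
      using count_M[OF j(1) vs(2) j(3)] j by (simp add: eq_hyperplane_def edge_mult_def)
    show "count M (ker_on V (\<lambda>x. z j x - z s x - \<alpha> x)) = edge_mult n G j v"
      unfolding g using count_M[OF j(1) vs(1) j(2)] j by (simp add: eq_hyperplane_def edge_mult_def)
    fix H assume H: "H \<in># M" "Y j s \<subseteq> H"
    obtain p q where pq: "p \<in> I" "q \<in> I" "p \<noteq> q" "H = eq_hyperplane V z p q" using M_mem[OF H(1)] by metis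
    have sep: "p \<in> A \<longleftrightarrow> q \<in> A" if "v \<in> A \<longleftrightarrow> s \<in> A" "j \<in> A \<longleftrightarrow> s \<in> A" for A
      by (rule separate_Y[OF j(1) vs(2) pq(1,2) _ that]) (use H(2) pq(4) in simp)
    \<comment> \<open>The indicator of a vertex outside the triangle gives a point of the flat that
      lies off the hyperplane of \<open>p, q\<close>.\<close>
    have "p \<in> {v, s, j}" using sep[of "{p}"] pq(3) by auto
    moreover have "q \<in> {v, s, j}" using sep[of "{q}"] pq(3) by auto
    ultimately have "H \<in> {eq_hyperplane V z v s, eq_hyperplane V z j s, eq_hyperplane V z j v}"
      unfolding pq(4) using pq(3) eq_hyperplane_commute[of V z] by auto
    then show "H \<in> {ker_on V \<alpha>, ker_on V (\<lambda>x. z j x - z s x), ker_on V (\<lambda>x. z j x - z s x - \<alpha> x)}"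
      unfolding g by (simp add: eq_hyperplane_def \<alpha>_def)
  qed
  moreover have "\<nu>' j s = n v + n s + n j + (if (s, j) \<in> G then 1 else 0)"
    using j G_sym[of j s] by (simp add: \<nu>'_def edge_mult_def n'_def)
  ultimately show ?thesis by (simp add: W_ker)
qed

text \<open>The localization is a product of two rank-one arrangements, so the multiplicity of the
  other hyperplane is inherited. It fits the rank-two scheme with multiplicity 0 for the third
  form.\<close>

lemma euler_multiplicity_disjoint:
  assumes i: "i \<in> I" "i \<notin> {v, s}" and j: "j \<in> I" "j \<notin> {v, s}" and ij: "i \<noteq> j"
  shows "euler_multiplicity V M W (Y i j) (\<nu>' i j)"
proof -
  let ?\<beta> = "\<lambda>x. z i x - z j x"
  have \<beta>: "?\<beta> \<in> dual V" by (rule diff[OF i(1) j(1)])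
  obtain m y u where db: "dual_basis V m y u" "2 \<le> m" "y 1 = \<alpha>" "y 2 = ?\<beta>"
    using ex_dual_basis_alpha(1)[OF i(1) j(1) ij i(2)] by blast
  note points = ex_dual_basis_alpha(2,3)[OF i(1) j(1) ij i(2)]
  have c: "homogeneous V (k + 0) (\<lambda>x. f x ^ k * const_on V 1 x)" if "f \<in> dual V" for f k
    by (rule homogeneous_power_mult[OF that homogeneous.const])
  \<comment> \<open>\<theta> is the power of \<beta> on \<beta> and zero on \<alpha>; \<psi> is
    \<alpha>^a on \<alpha> and zero on \<beta>. So r = 1 on \<open>V\<close>, e = a and \<kappa> =
    1.\<close>
  interpret L: local_pair scale V \<alpha> ?\<beta> a "\<nu>' i j" 0 "\<nu>' i j" a "\<lambda>x. 0" "\<lambda>x. ?\<beta> x ^ \<nu>' i j * const_on V 1 x"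
    "\<lambda>x. \<alpha> x ^ a * const_on V 1 x" "\<lambda>x. 0" "const_on V 1" 1
  proof unfold_locales
    show "subspace V" by (rule V)
    show "\<alpha> \<in> dual V" by (rule alpha)
    show "?\<beta> \<in> dual V" by (rule \<beta>)
    show "\<exists>x\<in>V. \<alpha> x = 1 \<and> z i x - z j x = 0" "\<exists>x\<in>V. \<alpha> x = 0 \<and> z i x - z j x = 1" by (rule points)+
    show "homogeneous V (\<nu>' i j) (\<lambda>x. ?\<beta> x ^ \<nu>' i j * const_on V 1 x)" using c[OF \<beta>] by simp
    show "homogeneous V a (\<lambda>x. \<alpha> x ^ a * const_on V 1 x)" using c[OF alpha] by simp
    show "homogeneous V (\<nu>' i j) (\<lambda>x. 0)" "homogeneous V a (\<lambda>x. 0)" by (rule homogeneous_0)+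
    have z0: "sdvd V f (\<lambda>x. 0)" for f by (rule sdvdI[OF Sym_0]) simp
    show "sdvd V (\<lambda>x. \<alpha> x ^ Suc a) (\<lambda>x. 0)" by (rule z0)
    show "sdvd V (\<lambda>x. (z i x - z j x) ^ \<nu>' i j) (\<lambda>x. 0)" by (rule z0)
    show "sdvd V (\<lambda>x. (z i x - z j x) ^ \<nu>' i j) (\<lambda>x. (z i x - z j x) ^ \<nu>' i j * const_on V 1 x)"
      by (rule sdvdI[OF Sym.const[of V 1]]) simp
    show "sdvd V (\<lambda>x. (z i x - z j x - \<alpha> x) ^ 0) (\<lambda>x. (z i x - z j x) ^ \<nu>' i j * const_on V 1 x - 0)"
      by (rule sdvdI[OF homogeneous_Sym[OF c[OF \<beta>, of "\<nu>' i j"]]]) simp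
    obtain x where "x \<in> V" "\<alpha> x = 0" "z i x - z j x = 1" using points(2) by blast
    then show "\<exists>x\<in>V. \<alpha> x = 0 \<and> (z i x - z j x) ^ \<nu>' i j * const_on V 1 x \<noteq> 0"
      by (intro bexI[of _ x]) (simp_all add: const_on_def)
    show "const_on V 1 \<in> Sym V" by (rule Sym.const)
    show "(\<lambda>x. \<alpha> x ^ a * const_on V 1 x) = (\<lambda>x. \<alpha> x ^ a * const_on V 1 x)" ..
    show "const_on V 1 x = 1 * (z i x - z j x) ^ (a - a)" if "x \<in> V" for x using that by (simp add: const_on_def)
    show "sdvd V (\<lambda>x. (z i x - z j x - \<alpha> x) ^ 0) (\<lambda>x. 0 - \<alpha> x ^ a * const_on V 1 x)"
      by (rule sdvdI[OF Sym_cmult[OF homogeneous_Sym[OF c[OF alpha, of a]], of "-1"]]) simp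
  qed simp_all
  have H_iff: "H \<in> {ker_on V \<alpha>, ker_on V ?\<beta>}" if H: "H \<in># M" "Y i j \<subseteq> H" for H
  proof -
    obtain p q where pq: "p \<in> I" "q \<in> I" "p \<noteq> q" "H = eq_hyperplane V z p q" using M_mem[OF H(1)] by metis
    have sep: "p \<in> A \<longleftrightarrow> q \<in> A" if "v \<in> A \<longleftrightarrow> s \<in> A" "i \<in> A \<longleftrightarrow> j \<in> A" for A
      by (rule separate_Y[OF i(1) j(1) pq(1,2) _ that]) (use H(2) pq(4) in simp)
    have "p \<in> {v, s, i, j}" using sep[of "{p}"] pq(3) by auto
    moreover have "q \<in> {v, s, i, j}" using sep[of "{q}"] pq(3) by auto
    moreover have "p \<in> {v, s} \<longleftrightarrow> q \<in> {v, s}" using sep[of "{v, s}"] i j by auto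
    ultimately have "{p, q} = {v, s} \<or> {p, q} = {i, j}" using pq(3) i j by auto
    then have "H \<in> {eq_hyperplane V z v s, eq_hyperplane V z i j}"
      unfolding pq(4) using eq_hyperplane_commute[of V z] by (auto simp: doubleton_eq_iff)
    then show ?thesis by (simp add: eq_hyperplane_def \<alpha>_def)
  qed
  have "euler_multiplicity V M (ker_on V \<alpha>) (Y i j) (\<nu>' i j)"
  proof (rule L.euler_multiplicity_pair[OF db])
    show Ye: "Y i j = {x \<in> V. \<alpha> x = 0 \<and> z i x - z j x = 0}" by (auto simp: Y_iff \<alpha>_def)
    show "count M (ker_on V \<alpha>) = Suc a" using count_W(1) by (simp add: W_ker)
    show "count M (ker_on V (\<lambda>x. z i x - z j x)) = \<nu>' i j"
      using count_M[OF i(1) j(1) ij] i j by (simp add: eq_hyperplane_def edge_mult_def \<nu>'_def n'_def)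
    show "H \<in> {ker_on V \<alpha>, ker_on V (\<lambda>x. z i x - z j x), ker_on V (\<lambda>x. z i x - z j x - \<alpha> x)}"
      if "H \<in># M" "Y i j \<subseteq> H" for H using H_iff[OF that] by blast
    \<comment> \<open>The third hyperplane contains the flat, but the sum of the two dual points
      lies on it and on neither of the hyperplanes of \<open>M\<close> through the flat.\<close>
    show "count M (ker_on V (\<lambda>x. z i x - z j x - \<alpha> x)) = 0"
    proof (rule ccontr)
      let ?H = "ker_on V (\<lambda>x. z i x - z j x - \<alpha> x)"
      assume "count M ?H \<noteq> 0"
      then have "?H \<in># M" by (simp add: count_eq_zero_iff)
      moreover have "Y i j \<subseteq> ?H" unfolding Ye by (auto simp: ker_on_def)
      ultimately have "?H \<in> {ker_on V \<alpha>, ker_on V ?\<beta>}" by (rule H_iff)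
      moreover obtain x where x: "x \<in> V" "\<alpha> x = 1" "z i x - z j x = 0" using points(1) by blast
      moreover obtain w where w: "w \<in> V" "\<alpha> w = 0" "z i w - z j w = 1" using points(2) by blast
      have xw: "x + w \<in> V" "\<alpha> (x + w) = 1" "z i (x + w) - z j (x + w) = 1"
        using subspace_add[OF V x(1) w(1)] dual_add[OF alpha x(1) w(1)] dual_add[OF \<beta> x(1) w(1)] x(2,3) w(2,3)
        by simp_all
      then have "x + w \<in> ?H" "x + w \<notin> ker_on V \<alpha>" "x + w \<notin> ker_on V ?\<beta>"
        unfolding ker_on_def by auto
      ultimately show False by blast
    qed
  qed
  then show ?thesis by (simp add: W_ker)
qed

lemma \<nu>'_commute: "\<nu>' i j = \<nu>' j i"
  using G_sym[of i j] by (simp add: \<nu>'_def edge_mult_def)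

lemma Y_commute: "Y i j = Y j i"
  unfolding Y_def by (rule eq_hyperplane_commute)

lemma euler_multiplicity_Y:
  assumes "i \<in> I - {v}" "j \<in> I - {v}" "i \<noteq> j"
  shows "euler_multiplicity V M W (Y i j) (\<nu>' i j)"
proof -
  consider "j = s" | "i = s" | "i \<noteq> s" "j \<noteq> s" by blast
  then show ?thesis
  proof cases
    case 1
    then show ?thesis using euler_multiplicity_triangle[of i] assms by simp
  next
    case 2
    then show ?thesis using euler_multiplicity_triangle[of j] assms by (simp add: Y_commute[of s] \<nu>'_commute[of s])
  next
    case 3
    then show ?thesis using euler_multiplicity_disjoint[of i j] assms by simp
  qed
qed

text \<open>The support of the Euler restriction is defined by intersections and not by \<nu>', so
  vanishing multiplicities must be matched in both directions.\<close>

lemma restriction_hyperplanes: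
  "{H \<inter> W | H. H \<in># M \<and> H \<noteq> W} = {Y i j | i j. i \<in> I - {v} \<and> j \<in> I - {v} \<and> i \<noteq> j \<and> 0 < \<nu>' i j}"
proof (intro subset_antisym subsetI)
  fix K assume "K \<in> {H \<inter> W | H. H \<in># M \<and> H \<noteq> W}"
  then obtain H where H: "H \<in># M" "H \<noteq> W" "K = H \<inter> W" by blast
  obtain p q where pq: "p \<in> I" "q \<in> I" "p \<noteq> q" "H = eq_hyperplane V z p q" using M_mem[OF H(1)] by metis
  have "\<exists>p q. p \<in> I \<and> q \<in> I \<and> p \<noteq> q \<and> p \<noteq> v \<and> H = eq_hyperplane V z p q"
    using pq eq_hyperplane_commute[of V z p q] by (cases "p = v") auto
  then obtain p q where pq: "p \<in> I" "q \<in> I" "p \<noteq> q" "p \<noteq> v" "H = eq_hyperplane V z p q" by blast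
  have ne: "{p, q} \<noteq> {v, s}" using eq_W_iff[OF pq(1-3)] H(2) pq(5) by simp
  have pos: "0 < edge_mult n G p q"
  proof -
    have "count M H \<noteq> 0" using H(1) by (simp add: count_eq_zero_iff)
    then show ?thesis using count_M[OF pq(1-3)] ne by (auto simp: pq(5) edge_mult_def doubleton_eq_iff split: if_splits)
  qed
  show "K \<in> {Y i j | i j. i \<in> I - {v} \<and> j \<in> I - {v} \<and> i \<noteq> j \<and> 0 < \<nu>' i j}"
  proof (cases "q = v")
    case True
    have "p \<noteq> s" using ne True by auto
    moreover have "K = Y p s" using True by (auto simp: H(3) pq(5) Y_iff eq_hyperplane_iff W_iff)
    \<comment> \<open>If only the edge \<open>pv\<close> makes the multiplicity positive, then
      \<open>p\<close> is in \<open>J\<close> and the clique condition supplies the edge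
      \<open>sp\<close>.\<close>
    moreover have "0 < \<nu>' p s"
      using pos True \<open>p \<noteq> s\<close> J(1)[OF pq(1)] J_s[of p] G_sym[of p v] G_sym[of p s]
      by (auto simp: edge_mult_def \<nu>'_def n'_def split: if_splits)
    ultimately show ?thesis using pq vs by blast
  next
    case False
    have "K = Y p q" by (auto simp: H(3) pq(5) Y_iff eq_hyperplane_iff W_iff)
    moreover have "0 < \<nu>' p q" using pos by (auto simp: edge_mult_def \<nu>'_def n'_def split: if_splits)
    ultimately show ?thesis using pq False by blast
  qed
next
  fix K assume "K \<in> {Y i j | i j. i \<in> I - {v} \<and> j \<in> I - {v} \<and> i \<noteq> j \<and> 0 < \<nu>' i j}"
  then obtain i j where "i \<in> I - {v}" "j \<in> I - {v}" "i \<noteq> j" "0 < \<nu>' i j" "K = Y i j" by blast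
  then have "\<exists>i j. i \<in> I - {v} \<and> j \<in> I - {v} \<and> i \<noteq> j \<and> i \<noteq> s \<and> 0 < \<nu>' i j \<and> K = Y i j"
    using Y_commute[of i j] \<nu>'_commute[of i j] by (cases "i = s"; metis)
  then obtain i j where ij: "i \<in> I" "j \<in> I" "i \<noteq> v" "j \<noteq> v" "i \<noteq> j" "i \<noteq> s" "0 < \<nu>' i j" "K = Y i j" by blast
  show "K \<in> {H \<inter> W | H. H \<in># M \<and> H \<noteq> W}"
  \<comment> \<open>Merging \<open>v\<close> into \<open>s\<close>, the flat of i and
    \<open>s\<close> comes from either of two hyperplanes. If that of i and \<open>s\<close> is
    absent, n_v must be positive and that of i and \<open>v\<close> is present.\<close>
  proof (cases "j = s \<and> edge_mult n G i s = 0")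
    case True
    have "0 < edge_mult n G i v"
      using ij True by (auto simp: \<nu>'_def edge_mult_def n'_def split: if_splits)
    then have "eq_hyperplane V z i v \<in># M"
      using count_M[OF ij(1) vs(1) ij(3)] by (intro count_inI) (auto simp: edge_mult_def split: if_splits)
    moreover have "eq_hyperplane V z i v \<noteq> W"
      using eq_W_iff[OF ij(1) vs(1) ij(3)] ij by (auto simp: doubleton_eq_iff)
    moreover have "K = eq_hyperplane V z i v \<inter> W" using True ij(8) by (auto simp: Y_iff eq_hyperplane_iff W_iff)
    ultimately show ?thesis by blast
  next
    case False
    have "0 < edge_mult n G i j"
      using ij False by (auto simp: \<nu>'_def edge_mult_def n'_def split: if_splits)
    then have "eq_hyperplane V z i j \<in># M"
      using count_M[OF ij(1,2,5)] by (intro count_inI) (auto simp: edge_mult_def split: if_splits)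
    moreover have "eq_hyperplane V z i j \<noteq> W"
      using eq_W_iff[OF ij(1,2,5)] ij by (auto simp: doubleton_eq_iff)
    moreover have "K = eq_hyperplane V z i j \<inter> W" using ij(8) by (auto simp: Y_iff eq_hyperplane_iff W_iff)
    ultimately show ?thesis by blast
  qed
qed

lemma ex_euler_restriction:
  "\<exists>M''. euler_restriction V M W M'' \<and> type_A_arrangement W (I - {v}) z' \<nu>' M''"
proof -
  define \<A> where "\<A> = {H \<inter> W | H. H \<in># M \<and> H \<noteq> W}"
  have \<A>: "K \<in> \<A> \<longleftrightarrow> (\<exists>i j. i \<in> I - {v} \<and> j \<in> I - {v} \<and> i \<noteq> j \<and> 0 < \<nu>' i j \<and> K = Y i j)" for K
    unfolding \<A>_def restriction_hyperplanes by blast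
  have "\<A> = (\<lambda>H. H \<inter> W) ` {H \<in> set_mset M. H \<noteq> W}" by (auto simp: \<A>_def)
  then have fin: "finite \<A>" by simp
  \<comment> \<open>The restriction wants a multiplicity as a function of the flat; the choice of
    indices is harmless because flats determine unordered pairs.\<close>
  define \<mu> where "\<mu> K = (SOME m. \<exists>i j. i \<in> I - {v} \<and> j \<in> I - {v} \<and> i \<noteq> j \<and> K = Y i j \<and> m = \<nu>' i j)" for K
  have \<mu>: "\<mu> (Y i j) = \<nu>' i j" if ij: "i \<in> I - {v}" "j \<in> I - {v}" "i \<noteq> j" for i j
  proof -
    have "\<exists>m k l. k \<in> I - {v} \<and> l \<in> I - {v} \<and> k \<noteq> l \<and> Y i j = Y k l \<and> m = \<nu>' k l" using ij by blast
    from someI_ex[OF this] obtain k l where kl: "k \<in> I - {v}" "l \<in> I - {v}" "k \<noteq> l" "Y i j = Y k l" "\<mu> (Y i j) = \<nu>' k l"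
      unfolding \<mu>_def by blast
    have "{k, l} = {i, j}"
      by (rule eq_hyperplane_inject[OF restricted_forms ij kl(1-3)]) (use kl(4) in \<open>simp add: Y_def\<close>)
    then show ?thesis using kl(5) \<nu>'_commute by (auto simp: doubleton_eq_iff)
  qed
  define M'' where "M'' = (\<Sum>K\<in>\<A>. replicate_mset (\<mu> K) K)"
  have count: "count M'' K = (if K \<in> \<A> then \<mu> K else 0)" for K
  proof -
    have "count M'' K = (\<Sum>L\<in>\<A>. if K = L then \<mu> L else 0)"
      unfolding M''_def by (simp add: count_sum)
    then show ?thesis using fin by (simp add: sum.delta')
  qed
  have "euler_restriction V M W M''"
    unfolding euler_restriction_def Let_def \<A>_def[symmetric]
  proof (intro exI[of _ \<mu>] conjI ballI)
    fix K assume "K \<in> \<A>"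
    then obtain i j where ij: "i \<in> I - {v}" "j \<in> I - {v}" "i \<noteq> j" "K = Y i j" unfolding \<A> by blast
    show "euler_multiplicity V M W K (\<mu> K)" unfolding ij(4) \<mu>[OF ij(1-3)] by (rule euler_multiplicity_Y[OF ij(1-3)])
  qed (simp add: M''_def)
  moreover have "type_A_arrangement W (I - {v}) z' \<nu>' M''"
    unfolding type_A_arrangement_def
  proof (intro conjI ballI impI)
    fix K assume "K \<in># M''"
    then have "count M'' K \<noteq> 0" by (simp add: count_eq_zero_iff)
    then have "K \<in> \<A>" unfolding count by (metis)
    then show "\<exists>i\<in>I - {v}. \<exists>j\<in>I - {v}. i \<noteq> j \<and> K = eq_hyperplane W z' i j" unfolding \<A> Y_def by blast
  next
    fix i j assume ij: "i \<in> I - {v}" "j \<in> I - {v}" "i \<noteq> j"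
    have "count M'' (Y i j) = \<nu>' i j"
    proof (cases "Y i j \<in> \<A>")
      case True
      then show ?thesis by (simp add: count \<mu>[OF ij])
    next
      case False
      have "\<nu>' i j = 0"
      proof (rule ccontr)
        assume "\<nu>' i j \<noteq> 0"
        then have "Y i j \<in> \<A>" unfolding \<A> using ij by (intro exI[of _ i] exI[of _ j]) simp
        with False show False by blast
      qed
      then show ?thesis using False by (simp add: count)
    qed
    then show "count M'' (eq_hyperplane W z' i j) = \<nu>' i j" by (simp add: Y_def)
  qed
  ultimately show ?thesis by blast
qed

end

section \<open>Inductive freeness for chordal graphs\<close>

text \<open>
  \<open>E\<close> lists, in an elimination order, the numbers of edges from each vertex but the first one to
  its predecessors, which form a clique.
\<close>

inductive chordal :: "'i set \<Rightarrow> ('i \<times> 'i) set \<Rightarrow> nat multiset \<Rightarrow> bool" where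
  edgeless: "finite I \<Longrightarrow> I \<noteq> {} \<Longrightarrow> chordal I {} (replicate_mset (card I - 1) 0)"
| attach: "chordal I G E \<Longrightarrow> v \<notin> I \<Longrightarrow> S \<subseteq> I \<Longrightarrow> S \<noteq> {} \<Longrightarrow>
    \<forall>i\<in>S. \<forall>j\<in>S. i \<noteq> j \<longrightarrow> (i, j) \<in> G \<Longrightarrow>
    chordal (insert v I) (G \<union> {v} \<times> S \<union> S \<times> {v}) (add_mset (card S) E)"

lemma chordal_finite: "chordal I G E \<Longrightarrow> finite I"
  by (induction rule: chordal.induct) auto

lemma chordal_subset: "chordal I G E \<Longrightarrow> G \<subseteq> I \<times> I"
  by (induction rule: chordal.induct) auto

lemma chordal_sym: "chordal I G E \<Longrightarrow> (i, j) \<in> G \<longleftrightarrow> (j, i) \<in> G"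
  by (induction rule: chordal.induct) auto

text \<open>\<open>attach\<close> demands a nonempty clique, so a vertex that has lost its last edge
  is moved to the edgeless start of the elimination order.\<close>

lemma chordal_insert_isolated:
  "chordal I G E \<Longrightarrow> v \<notin> I \<Longrightarrow> chordal (insert v I) G (add_mset 0 E)"
proof (induction rule: chordal.induct)
  case (edgeless I)
  then have "0 < card I" by (simp add: card_gt_0_iff)
  then have "add_mset 0 (replicate_mset (card I - 1) 0) = replicate_mset (card (insert v I) - 1) (0 :: nat)"
    using edgeless by (cases "card I") simp_all
  then show ?case using chordal.edgeless[of "insert v I"] edgeless by simp
next
  case (attach I G E w S)
  have "chordal (insert w (insert v I)) (G \<union> {w} \<times> S \<union> S \<times> {w}) (add_mset (card S) (add_mset 0 E))"
    using attach by (intro chordal.attach) auto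
  then show ?case by (simp add: insert_commute add_mset_commute)
qed

lemma chordal_star:
  assumes "finite L" "c \<notin> L"
  shows "chordal (insert c L) ({c} \<times> L \<union> L \<times> {c}) (replicate_mset (card L) 1)"
  using assms
proof (induction L rule: finite_induct)
  case empty
  show ?case using chordal.edgeless[of "{c}"] by simp
next
  case (insert v L)
  have "chordal (insert v (insert c L)) (({c} \<times> L \<union> L \<times> {c}) \<union> {v} \<times> {c} \<union> {c} \<times> {v})
      (add_mset (card {c}) (replicate_mset (card L) 1))"
    using insert by (intro chordal.attach) auto
  moreover have "({c} \<times> L \<union> L \<times> {c}) \<union> {v} \<times> {c} \<union> {c} \<times> {v} = {c} \<times> insert v L \<union> insert v L \<times> {c}" by auto
  ultimately show ?case using insert.hyps by (simp add: insert_commute)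
qed

lemma chordal_complete:
  assumes "finite I" "I \<noteq> {}"
  shows "chordal I {(i, j). i \<in> I \<and> j \<in> I \<and> i \<noteq> j} (mset_set {1..card I - 1})"
  using assms
proof (induction I rule: finite_ne_induct)
  case (singleton x)
  have "{(i, j). i \<in> {x} \<and> j \<in> {x} \<and> i \<noteq> j} = {}" by auto
  show ?case unfolding \<open>_ = {}\<close> using chordal.edgeless[of "{x}"] by simp
next
  case (insert v I)
  have "chordal (insert v I) ({(i, j). i \<in> I \<and> j \<in> I \<and> i \<noteq> j} \<union> {v} \<times> I \<union> I \<times> {v})
      (add_mset (card I) (mset_set {1..card I - 1}))"
    using insert by (intro chordal.attach) auto
  moreover have "{(i, j). i \<in> I \<and> j \<in> I \<and> i \<noteq> j} \<union> {v} \<times> I \<union> I \<times> {v} =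
      {(i, j). i \<in> insert v I \<and> j \<in> insert v I \<and> i \<noteq> j}" using insert.hyps by auto
  moreover have "add_mset (card I) (mset_set {1..card I - 1}) = mset_set {1..card I}"
  proof -
    have "0 < card I" using insert by (simp add: card_gt_0_iff)
    then obtain m where "card I = Suc m" by (cases "card I") auto
    then show ?thesis by (simp add: atLeastAtMostSuc_conv)
  qed
  ultimately show ?case using insert.hyps by simp
qed

context complex_space
begin

text \<open>The zeros belong to the common kernel of all differences of the forms, whose dimension
  is \<open>dim V - (card I - 1)\<close>; in \<complex>^\<ell> it is the diagonal.\<close>

definition graph_exponents :: "'v set \<Rightarrow> 'i set \<Rightarrow> ('i \<Rightarrow> nat) \<Rightarrow> nat multiset \<Rightarrow> nat multiset" where
  "graph_exponents V I n E =
     replicate_mset (dim V + 1 - card I) 0 + image_mset (\<lambda>k. (\<Sum>i\<in>I. n i) + k) E"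

definition graph_free :: "'v set \<Rightarrow> 'i set \<Rightarrow> ('i \<Rightarrow> nat) \<Rightarrow> nat multiset \<Rightarrow> 'v set multiset \<Rightarrow> bool" where
  "graph_free V I n E M \<longleftrightarrow> inductively_free V M \<and> has_exponents V M (graph_exponents V I n E)"

lemma log_der_empty: "log_der V {#} = Der V"
  by (auto simp: log_der_def)

lemma has_exponents_empty:
  assumes "fd_subspace V"
  shows "has_exponents V {#} (replicate_mset (dim V) 0)"
proof -
  have V: "subspace V" by (rule fd_subspace_subspace[OF assms])
  define m where "m = dim V"
  obtain y u where db: "dual_basis V m y u" using ex_dual_basis[OF assms] unfolding m_def by blast
  have "\<exists>\<theta>\<in>Der V. \<forall>j\<in>{1..m}. \<theta> (y j) = const_on V (if j = i then 1 else 0)" for i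
    by (rule ex_Der_basis[OF db V Sym.const])
  then obtain b where b: "\<And>i. b i \<in> Der V" "\<And>i j. j \<in> {1..m} \<Longrightarrow> b i (y j) = const_on V (if j = i then 1 else 0)"
    by metis
  have comb: "(\<Sum>i=1..m. c i x * b i (y j) x) = c j x"
    if j: "j \<in> {1..m}" and c: "c j \<in> Sym V" for c :: "nat \<Rightarrow> 'v \<Rightarrow> complex" and j x
  proof -
    have "(\<Sum>i=1..m. c i x * b i (y j) x) = (\<Sum>i=1..m. if i = j then c j x else 0)"
      using Sym_outside[OF c] by (intro sum.cong) (auto simp: b(2)[OF j] const_on_def)
    then show ?thesis using j by simp
  qed
  have "module_basis V (log_der V {#}) m b"
    unfolding log_der_empty
  proof (rule module_basisI)
    show "b i \<in> Der V" for i by (rule b(1))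
    fix \<theta> assume \<theta>: "\<theta> \<in> Der V"
    have S: "\<theta> (y i) \<in> Sym V" if "i \<in> {1..m}" for i
      by (rule Der_Sym[OF \<theta> Sym.form[OF dual_basisD(1)[OF db that]]])
    have "\<theta> = (\<lambda>f x. \<Sum>i=1..m. \<theta> (y i) x * b i f x)"
    proof (rule Der_eqI_basis[OF db V \<theta>])
      show "(\<lambda>f x. \<Sum>i=1..m. \<theta> (y i) x * b i f x) \<in> Der V" by (rule Der_lincomb[OF S b(1)])
      show "\<theta> (y j) = (\<lambda>x. \<Sum>i=1..m. \<theta> (y i) x * b i (y j) x)" if "j \<in> {1..m}" for j
      proof
        show "\<theta> (y j) x = (\<Sum>i=1..m. \<theta> (y i) x * b i (y j) x)" for x
          by (rule comb[symmetric]) (use that S in auto)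
      qed
    qed
    then show "\<exists>c. (\<forall>i\<in>{1..m}. c i \<in> Sym V) \<and> \<theta> = (\<lambda>f x. \<Sum>i=1..m. c i x * b i f x)"
      using S by (intro exI[of _ "\<lambda>i. \<theta> (y i)"]) blast
  next
    fix c i assume c: "\<forall>i\<in>{1..m}. c i \<in> Sym V" and z: "\<And>f x. (\<Sum>i=1..m. c i x * b i f x) = 0" and i: "i \<in> {1..m}"
    show "c i = (\<lambda>x. 0)" using comb[OF i, of c] c i z by (auto simp: fun_eq_iff)
  qed
  moreover have "pdeg V (b i) 0" for i
    by (rule pdeg_basis[OF db V b(1)]) (simp add: b(2) homogeneous.const)
  moreover have "replicate_mset m 0 = image_mset (\<lambda>_. 0 :: nat) (mset_set {1..m})"
    by (simp add: image_mset_const_eq)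
  ultimately show ?thesis unfolding has_exponents_def m_def[symmetric]
    by (intro exI[of _ m] exI[of _ b] exI[of _ "\<lambda>_. 0"] conjI ballI)
qed

lemma type_A_multiarrangement:
  assumes cfg: "type_A_forms V I z" and arr: "type_A_arrangement V I z \<nu> M"
  shows "multiarrangement V M"
  unfolding multiarrangement_def
proof (intro conjI ballI)
  show "fd_subspace V" using cfg by (simp add: type_A_forms_def)
  fix H assume "H \<in># M"
  then have "\<exists>i\<in>I. \<exists>j\<in>I. i \<noteq> j \<and> H = eq_hyperplane V z i j"
    using arr unfolding type_A_arrangement_def by (elim conjE) (rule bspec)
  then obtain i j where ij: "i \<in> I" "j \<in> I" "i \<noteq> j" "H = eq_hyperplane V z i j" by blast
  obtain x where x: "x \<in> V" "\<And>k l. k \<in> I \<Longrightarrow> l \<in> I \<Longrightarrow> z k x = z l x \<longleftrightarrow> (k \<in> {i} \<longleftrightarrow> l \<in> {i})"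
    using type_A_forms_separate[OF cfg, of "{i}"] by blast
  have "z i x - z j x \<noteq> 0" using x(2)[OF ij(1,2)] ij(3) by simp
  then have "(\<lambda>x. z i x - z j x) \<noteq> (\<lambda>x. 0)" by (auto simp: fun_eq_iff)
  then show "hyperplane V H"
    unfolding hyperplane_def using type_A_forms_diff_dual[OF cfg ij(1,2)] ij(4) by (auto simp: eq_hyperplane_def)
qed

lemma type_A_arrangement_cong:
  assumes "type_A_arrangement V I z \<nu> M" "\<And>i j. i \<in> I \<Longrightarrow> j \<in> I \<Longrightarrow> i \<noteq> j \<Longrightarrow> \<nu> i j = \<nu>' i j"
  shows "type_A_arrangement V I z \<nu>' M"
  using assms unfolding type_A_arrangement_def by simp

lemma type_A_arrangement_zero:
  assumes "type_A_arrangement V I z \<nu> M" "\<And>i j. i \<in> I \<Longrightarrow> j \<in> I \<Longrightarrow> i \<noteq> j \<Longrightarrow> \<nu> i j = 0"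
  shows "M = {#}"
proof (rule ccontr)
  assume "M \<noteq> {#}"
  then obtain H where H: "H \<in># M" by blast
  then have "\<exists>i\<in>I. \<exists>j\<in>I. i \<noteq> j \<and> H = eq_hyperplane V z i j"
    using assms(1) unfolding type_A_arrangement_def by (elim conjE) (rule bspec)
  then obtain i j where ij: "i \<in> I" "j \<in> I" "i \<noteq> j" "H = eq_hyperplane V z i j" by blast
  then have "count M H = 0" using assms unfolding type_A_arrangement_def by simp
  then show False using H by (simp add: count_eq_zero_iff)
qed

text \<open>
  Attaching \<open>v\<close> to \<open>S\<close> instead of \<open>S - {s}\<close> adds the hyperplane of \<open>v, s\<close>; the restriction to it
  belongs to the graph without \<open>v\<close>.
\<close>

lemma graph_free_attach:
  fixes I :: "'i set" and n :: "'i \<Rightarrow> nat"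
  assumes G: "chordal I G E" and v: "v \<notin> I" and S: "S \<subseteq> I" "s \<in> S"
    and clique: "\<forall>i\<in>S. \<forall>j\<in>S. i \<noteq> j \<longrightarrow> (i, j) \<in> G"
    and cfg: "type_A_forms V (insert v I) z"
    and arr: "type_A_arrangement V (insert v I) z (edge_mult n (G \<union> {v} \<times> S \<union> S \<times> {v})) M"
    and deletion: "\<And>M0. size M0 < size M \<Longrightarrow>
      type_A_arrangement V (insert v I) z (edge_mult n (G \<union> {v} \<times> (S - {s}) \<union> (S - {s}) \<times> {v})) M0 \<Longrightarrow>
      graph_free V (insert v I) n (add_mset (card (S - {s})) E) M0"
    and restriction: "\<And>W z' n' M''. type_A_forms W I z' \<Longrightarrow> type_A_arrangement W I z' (edge_mult n' G) M'' \<Longrightarrow>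
      graph_free W I n' E M''"
  shows "graph_free V (insert v I) n (add_mset (card S) E) M"
proof -
  define J where "J = S - {s}"
  define G0 where "G0 = G \<union> {v} \<times> J \<union> J \<times> {v}"
  have GI: "G \<subseteq> I \<times> I" by (rule chordal_subset[OF G])
  have fin: "finite I" by (rule chordal_finite[OF G])
  have s: "s \<in> I" "s \<noteq> v" using S v by auto
  have G1: "G \<union> {v} \<times> S \<union> S \<times> {v} = G0 \<union> {(v, s), (s, v)}" using S by (auto simp: G0_def J_def)
  interpret A: edge_addition scale V "insert v I" z n G0 v s J M
  proof unfold_locales
    show "type_A_forms V (insert v I) z" by (rule cfg)
    show "v \<in> insert v I" "s \<in> insert v I" "v \<noteq> s" using s by auto
    show "(i, j) \<in> G0 \<longleftrightarrow> (j, i) \<in> G0" for i j using chordal_sym[OF G, of i j] by (auto simp: G0_def)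
    show "(v, s) \<notin> G0" using GI v s by (auto simp: G0_def J_def)
    show "(v, j) \<in> G0 \<longleftrightarrow> j \<in> J" for j using GI v S by (auto simp: G0_def J_def)
    show "J \<subseteq> insert v I - {v, s}" using S v by (auto simp: J_def)
    show "(s, j) \<in> G0" if "j \<in> J" for j using clique S(2) that by (auto simp: G0_def J_def)
    show "type_A_arrangement V (insert v I) z (edge_mult n (G0 \<union> {(v, s), (s, v)})) M"
      using arr unfolding G1 .
  qed
  have sizeM0: "size A.M0 < size M" using A.W_mem by (simp add: A.M0_def size_Diff1_less)
  have del: "graph_free V (insert v I) n (add_mset (card J) E) A.M0"
    using deletion[OF sizeM0] A.arr0 unfolding G0_def J_def by blast
  obtain M'' where M'': "euler_restriction V M A.W M''" "type_A_arrangement A.W (insert v I - {v}) A.z' A.\<nu>' M''"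
    using A.ex_euler_restriction by blast
  have I': "insert v I - {v} = I" using v by auto
  have arr'': "type_A_arrangement A.W I A.z' (edge_mult A.n' G) M''"
  proof (rule type_A_arrangement_cong[OF M''(2)[unfolded I']])
    fix i j assume "i \<in> I" "j \<in> I"
    then have "(i, j) \<in> G0 \<longleftrightarrow> (i, j) \<in> G" using v by (auto simp: G0_def)
    then show "A.\<nu>' i j = edge_mult A.n' G i j" by (simp add: A.\<nu>'_def edge_mult_def)
  qed
  have res: "graph_free A.W I A.n' E M''"
    by (rule restriction[OF A.restricted_forms[unfolded I'] arr''])
  \<comment> \<open>The multiplicity of the removed vertex has moved to \<open>s\<close>, so the
    offset of all exponents is preserved.\<close>
  have sum_n': "(\<Sum>i\<in>I. A.n' i) = (\<Sum>i\<in>insert v I. n i)"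
  proof -
    have "(\<Sum>i\<in>I - {s}. A.n' i) = (\<Sum>i\<in>I - {s}. n i)" by (rule sum.cong) (auto simp: A.n'_def)
    moreover have "A.n' s = n v + n s" by (simp add: A.n'_def)
    ultimately show ?thesis using fin v sum.remove[OF fin s(1), of "A.n'"] sum.remove[OF fin s(1), of n] by simp
  qed
  define N where "N = (\<Sum>i\<in>insert v I. n i)"
  have \<delta>: "A.\<delta> = N + card J" by (simp add: A.\<delta>_def N_def)
  define F where "F = graph_exponents A.W I A.n' E"
  have card_I: "card (insert v I) = Suc (card I)" using fin v by simp
  have F_eq: "F = replicate_mset (dim V + 1 - card (insert v I)) 0 + image_mset (\<lambda>k. N + k) E"
    unfolding F_def graph_exponents_def sum_n' N_def using A.dim_W card_I by simp
  \<comment> \<open>Deletion and enlarged arrangement have the exponents of the restriction and one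
    more, N + k, with k the size of the clique to which \<open>v\<close> is attached.\<close>
  have E0: "graph_exponents V (insert v I) n (add_mset k E) = add_mset (N + k) F" for k
    unfolding F_eq graph_exponents_def N_def by simp
  have ex0: "has_exponents V A.M0 (add_mset A.\<delta> F)"
    using del unfolding graph_free_def E0 \<delta> by blast
  have ex: "has_exponents V M (add_mset (Suc A.\<delta>) F)"
    using A.addition(2)[OF ex0] by simp
  have "finite S" using finite_subset[OF S(1) fin] .
  then have "card S = Suc (card J)"
    unfolding J_def using card_Suc_Diff1[OF _ S(2)] by simp
  then have "has_exponents V M (graph_exponents V (insert v I) n (add_mset (card S) E))"
    using ex unfolding E0 \<delta> by simp
  moreover have "inductively_free V M"
  proof (rule inductively_free.add)
    show "multiarrangement V M" by (rule type_A_multiarrangement[OF cfg arr])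
    show "A.W \<in># M" by (rule A.W_mem)
    show "inductively_free V (M - {#A.W#})" using del unfolding graph_free_def A.M0_def by blast
    show "euler_restriction V M A.W M''" by (rule M''(1))
    show "inductively_free A.W M''" using res unfolding graph_free_def by blast
    show "has_exponents V (M - {#A.W#}) (add_mset A.\<delta> F)" using ex0 unfolding A.M0_def .
    show "has_exponents A.W M'' F" using res unfolding graph_free_def F_def by blast
    show "F \<subseteq># add_mset A.\<delta> F" by simp
  qed
  ultimately show ?thesis unfolding graph_free_def by blast
qed

text \<open>
  Induction on \<open>card I\<close>, then on the number of hyperplanes. Without edges, the multiplicity
  \<open>n i + n j\<close> is that of a star with centre \<open>c\<close> after lowering \<open>n c\<close> by one.
\<close>

lemma graph_free_chordal:
  fixes I :: "'i set" and n :: "'i \<Rightarrow> nat"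
  assumes "chordal I G E" "type_A_forms V I z" "type_A_arrangement V I z (edge_mult n G) M"
  shows "graph_free V I n E M"
  using assms
proof (induction "card I" arbitrary: V I z n G E M rule: less_induct)
  case less
  note outer = less.hyps
  from less.prems show ?case
  proof (induction "size M" arbitrary: V z n G E M rule: less_induct)
    case less
    note inner = less.hyps
    have fdV: "fd_subspace V" using less.prems(2) by (simp add: type_A_forms_def)
    \<comment> \<open>Stated for arbitrary vertex multiplicities \<open>m\<close>, because the
      edgeless case rewrites the same \<open>M\<close> as a star with a changed
      multiplicity.\<close>
    have attached: "graph_free V (insert v I') m (add_mset (card S) E') M"
      if I: "I = insert v I'" and G': "chordal I' G' E'" and v: "v \<notin> I'" and S: "S \<subseteq> I'" "S \<noteq> {}"
        "\<forall>i\<in>S. \<forall>j\<in>S. i \<noteq> j \<longrightarrow> (i, j) \<in> G'"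
        and arr: "type_A_arrangement V I z (edge_mult m (G' \<union> {v} \<times> S \<union> S \<times> {v})) M" for v I' G' E' S m
    proof -
      obtain s where s: "s \<in> S" using S by blast
      show ?thesis
      proof (rule graph_free_attach[OF G' v S(1) s S(3)])
        show "type_A_forms V (insert v I') z" using less.prems(2) I by simp
        show "type_A_arrangement V (insert v I') z (edge_mult m (G' \<union> {v} \<times> S \<union> S \<times> {v})) M" using arr I by simp
        have "chordal (insert v I') (G' \<union> {v} \<times> (S - {s}) \<union> (S - {s}) \<times> {v}) (add_mset (card (S - {s})) E')"
        proof (cases "S - {s} = {}")
          case True
          show ?thesis unfolding True using chordal_insert_isolated[OF G' v] by simp
        next
          case False
          then show ?thesis using S by (intro chordal.attach[OF G' v]) auto
        qed
        then show "graph_free V (insert v I') m (add_mset (card (S - {s})) E') M0"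
          if "size M0 < size M"
            "type_A_arrangement V (insert v I') z (edge_mult m (G' \<union> {v} \<times> (S - {s}) \<union> (S - {s}) \<times> {v})) M0" for M0
          using inner[OF that(1), of G'] inner[OF that(1)] less.prems(2) that(2) I by blast
        have "card I' < card I" using I v chordal_finite[OF G'] by simp
        then show "graph_free W I' n' E' M''"
          if "type_A_forms W I' z'" "type_A_arrangement W I' z' (edge_mult n' G') M''" for W z' n' M''
          using outer G' that by blast
      qed
    qed
    from less.prems(1) show ?case
    proof cases
      case edgeless
      show ?thesis
      proof (cases "\<forall>i\<in>I. \<forall>j\<in>I. i \<noteq> j \<longrightarrow> n i + n j = 0")
        case True
        then have M: "M = {#}"
          by (intro type_A_arrangement_zero[OF less.prems(3)]) (simp add: edge_mult_def edgeless)
        have "graph_exponents V I n E = replicate_mset (dim V) 0"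
        \<comment> \<open>A single vertex may carry a positive \<open>n\<close>, but then there are
          no pairs and \<open>E\<close> is empty.\<close>
        proof (cases "card I = 1")
          case True
          then show ?thesis by (simp add: graph_exponents_def edgeless)
        next
          case False
          then have cI: "2 \<le> card I" using edgeless by (metis One_nat_def Suc_leI card_gt_0_iff le_neq_implies_less numeral_2_eq_2)
          have "n i = 0" if i: "i \<in> I" for i
          proof -
            have "card (I - {i}) \<noteq> 0" using i cI by simp
            then obtain j where "j \<in> I" "i \<noteq> j" by (metis card.empty DiffE ex_in_conv insertI1)
            then show ?thesis using True i by auto
          qed
          then have "(\<Sum>i\<in>I. n i) = 0" by simp
          then show ?thesis using type_A_forms_card[OF less.prems(2)] cI
            by (intro multiset_eqI) (auto simp: graph_exponents_def edgeless)
        qed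
        then show ?thesis
          using inductively_free.empty[OF fdV] has_exponents_empty[OF fdV] by (simp add: graph_free_def M)
      next
        case False
        then obtain i j where ij: "i \<in> I" "j \<in> I" "i \<noteq> j" "n i + n j \<noteq> 0" by blast
        obtain c v where c: "c \<in> I" "0 < n c" "v \<in> I" "v \<noteq> c"
          using ij by (cases "n i = 0") auto
        define L where "L = I - {c, v}"
        define m where "m = n(c := n c - 1)"
        have L: "finite L" "c \<notin> L" "v \<notin> insert c L" "I = insert v (insert c L)" using c edgeless by (auto simp: L_def)
        let ?G = "{c} \<times> L \<union> L \<times> {c}"
        have "type_A_arrangement V I z (edge_mult m (?G \<union> {v} \<times> {c} \<union> {c} \<times> {v})) M"
        proof (rule type_A_arrangement_cong[OF less.prems(3)])
          show "edge_mult n G i j = edge_mult m (?G \<union> {v} \<times> {c} \<union> {c} \<times> {v}) i j"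
            if "i \<in> I" "j \<in> I" "i \<noteq> j" for i j
            using that c L by (auto simp: edge_mult_def m_def edgeless)
        qed
        then have "graph_free V (insert v (insert c L)) m (add_mset (card {c}) (replicate_mset (card L) 1)) M"
          using L by (intro attached[OF L(4) chordal_star[OF L(1,2)]]) auto
        moreover have "graph_exponents V I n E =
            graph_exponents V (insert v (insert c L)) m (add_mset (card {c}) (replicate_mset (card L) 1))"
        \<comment> \<open>The total drops by one, and each entry of the star's \<open>E\<close> is
          one instead of zero.\<close>
        proof -
          have "(\<Sum>i\<in>I - {c}. m i) = (\<Sum>i\<in>I - {c}. n i)" by (rule sum.cong) (auto simp: m_def)
          then have "(\<Sum>i\<in>I. n i) = Suc (\<Sum>i\<in>I. m i)"
            using c edgeless sum.remove[of I c n] sum.remove[of I c m] by (simp add: m_def)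
          moreover have "card I - 1 = Suc (card L)" using L by simp
          ultimately show ?thesis unfolding graph_exponents_def L(4)[symmetric]
            by (simp add: edgeless)
        qed
        ultimately show ?thesis using L(4) by (simp add: graph_free_def)
      qed
    next
      case (attach I' G' E' v S)
      then show ?thesis using attached[of v I' G' E' S n] less.prems(3) by simp
    qed
  qed
qed

end

section \<open>Constant multiplicities\<close>

context complex_space
begin

lemma constant_multiplicity_free:
  assumes cfg: "type_A_forms V I z" and I: "I \<noteq> {}" and arr: "type_A_arrangement V I z (\<lambda>_ _. m) M"
  shows "inductively_free V M"
    and "even m \<Longrightarrow> has_exponents V M
      (replicate_mset (dim V + 1 - card I) 0 + replicate_mset (card I - 1) (m * card I div 2))"
    and "odd m \<Longrightarrow> has_exponents V M
      (replicate_mset (dim V + 1 - card I) 0 +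
       image_mset (\<lambda>k. (m - 1) * card I div 2 + k) (mset_set {1..card I - 1}))"
proof -
  have fin: "finite I" using cfg by (simp add: type_A_forms_def)
  define n where "n = (\<lambda>_ :: 'a. m div 2)"
  have ev: "graph_free V I n (replicate_mset (card I - 1) 0) M" if "even m"
  proof (rule graph_free_chordal[OF chordal.edgeless[OF fin I] cfg])
    show "type_A_arrangement V I z (edge_mult n {}) M"
      by (rule type_A_arrangement_cong[OF arr]) (use that in \<open>auto simp: edge_mult_def n_def\<close>)
  qed
  have od: "graph_free V I n (mset_set {1..card I - 1}) M" if "odd m"
  proof (rule graph_free_chordal[OF chordal_complete[OF fin I] cfg])
    show "type_A_arrangement V I z (edge_mult n {(i, j). i \<in> I \<and> j \<in> I \<and> i \<noteq> j}) M"
      by (rule type_A_arrangement_cong[OF arr]) (use that in \<open>auto simp: edge_mult_def n_def elim!: oddE\<close>)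
  qed
  show "inductively_free V M" using ev od unfolding graph_free_def by blast
  have "(\<Sum>i\<in>I. n i) = m * card I div 2" if "even m" using that by (auto simp: n_def elim!: evenE)
  then show "even m \<Longrightarrow> has_exponents V M
      (replicate_mset (dim V + 1 - card I) 0 + replicate_mset (card I - 1) (m * card I div 2))"
    using ev unfolding graph_free_def graph_exponents_def by simp
  have "(\<Sum>i\<in>I. n i) = (m - 1) * card I div 2" if "odd m" using that by (auto simp: n_def elim!: oddE)
  then show "odd m \<Longrightarrow> has_exponents V M
      (replicate_mset (dim V + 1 - card I) 0 +
       image_mset (\<lambda>k. (m - 1) * card I div 2 + k) (mset_set {1..card I - 1}))"
    using od unfolding graph_free_def graph_exponents_def by simp
qed

end

section \<open>The braid arrangement\<close>

lemma count_const_mult: "finite \<A> \<Longrightarrow> count (const_mult \<A> m) H = (if H \<in> \<A> then m else 0)"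
  by (simp add: const_mult_def count_sum sum.delta')

lemma set_const_mult: "finite \<A> \<Longrightarrow> 1 \<le> m \<Longrightarrow> set_mset (const_mult \<A> m) = \<A>"
  by (auto simp: count_const_mult simp flip: count_greater_zero_iff split: if_splits)

lemma ordered_pair_image:
  fixes f :: "'n::linorder \<Rightarrow> 'n \<Rightarrow> 'a"
  assumes "\<And>i j. f i j = f j i" "i \<noteq> j"
  shows "f i j \<in> {f i j | i j. i < j}"
proof (cases "i < j")
  case False
  then have "j < i" using assms(2) by simp
  then show ?thesis using assms(1)[of i j] by blast
qed blast

lemma braid_eq: "braid = {cvec.eq_hyperplane UNIV (\<lambda>i x. x $ i) i j | i j. i < j}"
  by (auto simp: braid_def cvec.eq_hyperplane_def cvec.ker_on_def)

lemma finite_braid: "finite (braid :: (complex ^ 'n::{finite,linorder}) set set)"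
proof -
  have eq: "braid = (\<lambda>(i, j). {x. x $ i - x $ j = 0}) ` {(i, j). i < (j :: 'n)}" by (auto simp: braid_def)
  show ?thesis unfolding eq by (rule finite_imageI) (rule finite)
qed

lemma cvec_forms: "cvec.type_A_forms UNIV UNIV (\<lambda>i (x :: complex ^ 'n::finite). x $ i)"
  unfolding cvec.type_A_forms_def
proof (intro conjI ballI allI)
  show "cvec.fd_subspace (UNIV :: (complex ^ 'n) set)"
    unfolding cvec.fd_subspace_def using finite_cart_basis span_cart_basis by blast
  show "(\<lambda>x :: complex ^ 'n. x $ i) \<in> cvec.dual UNIV" for i
    by (simp add: cvec.dual_def)
  show "\<exists>x\<in>UNIV. \<exists>t. \<forall>i\<in>UNIV. (x :: complex ^ 'n) $ i = c i + t" for c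
    by (intro bexI[of _ "\<chi> i. c i"] exI[of _ 0]) simp_all
qed simp

lemma cvec_arrangement:
  "cvec.type_A_arrangement UNIV UNIV (\<lambda>i x. x $ i) (\<lambda>_ _. m)
     (const_mult (braid :: (complex ^ 'n::{finite,linorder}) set set) m)"
  unfolding cvec.type_A_arrangement_def
proof (intro conjI ballI impI)
  fix H :: "(complex, 'n) vec set" assume "H \<in># const_mult braid m"
  then have "H \<in> braid" by (auto simp: count_const_mult finite_braid simp flip: count_greater_zero_iff split: if_splits)
  then obtain i j where "i < j" "H = cvec.eq_hyperplane UNIV (\<lambda>i x. x $ i) i j" unfolding braid_eq by blast
  then show "\<exists>i\<in>UNIV. \<exists>j\<in>UNIV. i \<noteq> j \<and> H = cvec.eq_hyperplane UNIV (\<lambda>i x. x $ i) i j"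
    by (intro bexI[of _ i] bexI[of _ j]) auto
next
  fix i j :: 'n assume "i \<noteq> j"
  then have "cvec.eq_hyperplane UNIV (\<lambda>i x. x $ i) i j \<in> (braid :: (complex, 'n) vec set set)"
    unfolding braid_eq by (rule ordered_pair_image[rotated]) (rule cvec.eq_hyperplane_commute)
  then show "count (const_mult (braid :: (complex, 'n) vec set set) m) (cvec.eq_hyperplane UNIV (\<lambda>i x. x $ i) i j) = m"
    by (simp add: count_const_mult finite_braid)
qed

text \<open>The definition multiplies over hyperplanes, the formula over pairs i < j. Distinct pairs
  give distinct hyperplanes, so the product can be reindexed.\<close>

lemma braid_defining_polynomial:
  assumes "1 \<le> m"
  shows "cvec.defining_polynomial UNIV (const_mult (braid :: (complex ^ 'n::{finite,linorder}) set set) m)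
       (\<lambda>x. \<Prod>(i, j)\<in>{(i, j). i < j}. (x $ i - x $ j) ^ m)"
proof -
  define P where "P = {(i, j). i < (j :: 'n)}"
  define h where "h = (\<lambda>(i, j). cvec.eq_hyperplane UNIV (\<lambda>i (x :: (complex, 'n) vec). x $ i) i j)"
  have inj: "inj_on h P"
  proof (rule inj_onI)
    fix p q assume pq: "p \<in> P" "q \<in> P" "h p = h q"
    obtain i j where p: "p = (i, j)" "i < j" using pq(1) by (auto simp: P_def)
    obtain k l where q: "q = (k, l)" "k < l" using pq(2) by (auto simp: P_def)
    have "{k, l} = {i, j}"
      by (rule cvec.eq_hyperplane_inject[OF cvec_forms]) (use p q pq(3) in \<open>auto simp: h_def\<close>)
    then show "p = q" using p q by (auto simp: doubleton_eq_iff)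
  qed
  have hP: "h ` P = braid" unfolding braid_eq by (auto simp: h_def P_def)
  define \<alpha> where "\<alpha> H x = x $ fst (the_inv_into P h H) - x $ snd (the_inv_into P h H)" for H and x :: "(complex, 'n) vec"
  have \<alpha>: "\<alpha> (h (i, j)) = (\<lambda>x. x $ i - x $ j)" if "i < j" for i j
    using that by (simp add: \<alpha>_def fun_eq_iff P_def the_inv_into_f_f[OF inj, unfolded P_def])
  show ?thesis
    unfolding cvec.defining_polynomial_def
  proof (intro exI[of _ \<alpha>] conjI ballI)
    fix H :: "(complex, 'n) vec set" assume "H \<in># const_mult braid m"
    then have "H \<in> h ` P"
      using set_const_mult[OF finite_braid assms] hP by blast
    then obtain i j where ij: "i < j" "H = h (i, j)" by (auto simp: P_def)
    show "\<alpha> H \<in> cvec.dual UNIV" unfolding ij(2) \<alpha>[OF ij(1)]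
      by (rule cvec.type_A_forms_diff_dual[OF cvec_forms]) simp_all
    show "cvec.ker_on UNIV (\<alpha> H) = H" unfolding ij(2) \<alpha>[OF ij(1)]
      by (simp add: h_def cvec.eq_hyperplane_def)
  next
    have "(\<Prod>H\<in>braid. \<alpha> H x ^ count (const_mult braid m) H) = (\<Prod>(i, j)\<in>P. (x $ i - x $ j) ^ m)" for x
    proof -
      have "(\<Prod>H\<in>braid. \<alpha> H x ^ count (const_mult braid m) H) = (\<Prod>H\<in>h ` P. \<alpha> H x ^ m)"
        unfolding hP by (rule prod.cong) (simp_all add: count_const_mult finite_braid)
      also have "\<dots> = (\<Prod>p\<in>P. \<alpha> (h p) x ^ m)" by (simp add: prod.reindex[OF inj])
      also have "\<dots> = (\<Prod>(i, j)\<in>P. (x $ i - x $ j) ^ m)"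
        by (rule prod.cong) (auto simp: P_def \<alpha>)
      finally show ?thesis .
    qed
    then show "(\<lambda>x. \<Prod>(i, j)\<in>{(i, j). i < j}. (x $ i - x $ j) ^ m) =
      (\<lambda>x. if x \<in> UNIV then \<Prod>H\<in>set_mset (const_mult braid m). \<alpha> H x ^ count (const_mult braid m) H else 0)"
      unfolding set_const_mult[OF finite_braid assms] by (simp add: P_def)
  qed
qed

section \<open>The Coxeter arrangement in the quotient by the diagonal\<close>

abbreviation quot :: "complex ^ 'n::finite \<Rightarrow> 'n diag_quotient" where
  "quot \<equiv> abs_diag_quotient"

lemma quot_surj: "\<exists>x. v = quot x"
  by (metis Quotient3_abs_rep Quotient3_diag_quotient)

lemma quot_add: "quot (x + y) = quot x + quot y"
  by (simp add: plus_diag_quotient.abs_eq)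

lemma quot_scale: "quot (c *s x) = scale_diag c (quot x)"
  by (simp add: scale_diag.abs_eq)

lemma quot_zero: "quot 0 = 0"
  by (simp add: zero_diag_quotient_def)

lemma quot_sum: "quot (\<Sum>i\<in>K. f i) = (\<Sum>i\<in>K. quot (f i))"
  by (induction K rule: infinite_finite_induct) (simp_all add: quot_add quot_zero)

lemma diff_form_quot: "diff_form i j (quot x) = x $ i - x $ j"
  by (simp add: diff_form.abs_eq)

lemma diff_form_diff: "diff_form i k v - diff_form j k v = diff_form i j v"
  by transfer simp

lemma quot_spanning:
  fixes k :: "'n::finite"
  defines "B \<equiv> (\<lambda>i. quot (axis i 1)) ` (UNIV - {k})"
  shows "cquot.span B = UNIV"
proof -
  have "v \<in> cquot.span B" for v
  proof -
    obtain x where x: "v = quot x" using quot_surj by blast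
    \<comment> \<open>The representative of the same class whose coordinate at \<open>k\<close> is
      zero.\<close>
    define y where "y = (\<Sum>i\<in>UNIV - {k}. (x $ i - x $ k) *s axis i 1 :: complex ^ 'n)"
    have "y $ j = x $ j - x $ k" for j
    proof -
      have "y $ j = (\<Sum>i\<in>UNIV - {k}. if i = j then x $ i - x $ k else 0)"
        unfolding y_def by (simp add: axis_def if_distrib cong: if_cong sum.cong)
      then show ?thesis by (cases "j = k") simp_all
    qed
    then have "\<forall>i. y $ i = x $ i + (- (x $ k))" by simp
    then have "diag_rel y x" unfolding diag_rel_iff by blast
    then have "v = quot y" using x Quotient3_rel_abs[OF Quotient3_diag_quotient] by metis
    also have "\<dots> = (\<Sum>i\<in>UNIV - {k}. scale_diag (x $ i - x $ k) (quot (axis i 1)))"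
      unfolding y_def quot_sum quot_scale ..
    also have "\<dots> \<in> cquot.span B"
      by (intro cquot.span_sum cquot.span_scale cquot.span_base) (auto simp: B_def)
    finally show ?thesis .
  qed
  then show ?thesis by blast
qed

text \<open>This bound makes the number of zero exponents vanish in the quotient.\<close>

lemma cquot_dim: "cquot.dim (UNIV :: 'n::finite diag_quotient set) \<le> CARD('n) - 1"
proof -
  fix k :: 'n
  let ?B = "(\<lambda>i. quot (axis i 1)) ` (UNIV - {k})"
  have "cquot.dim (UNIV :: 'n diag_quotient set) \<le> card ?B"
    by (rule cquot.dim_le_card) (simp_all add: quot_spanning)
  also have "\<dots> \<le> card (UNIV - {k})" by (rule card_image_le) simp
  also have "\<dots> = CARD('n) - 1" by simp
  finally show ?thesis .
qed

text \<open>Coordinates are not defined on the quotient; subtracting a fixed one makes them so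
  without changing their differences.\<close>

lemma cquot_forms:
  fixes k :: "'n::finite"
  shows "cquot.type_A_forms UNIV UNIV (\<lambda>i. diff_form i k)"
  unfolding cquot.type_A_forms_def
proof (intro conjI ballI allI)
  show "cquot.fd_subspace (UNIV :: 'n diag_quotient set)"
    unfolding cquot.fd_subspace_def by (rule exI, rule conjI[OF _ quot_spanning[of k]]) simp
  show "diff_form i k \<in> cquot.dual UNIV" for i
    unfolding cquot.dual_def by (auto; transfer; simp add: algebra_simps)
  show "\<exists>x\<in>UNIV. \<exists>t. \<forall>i\<in>UNIV. diff_form i k x = c i + t" for c
    by (intro bexI[of _ "quot (\<chi> i. c i)"] exI[of _ "- c k"]) (simp_all add: diff_form_quot)
qed simp

lemma coxeter_A_eq:
  "coxeter_A = {cquot.eq_hyperplane UNIV (\<lambda>i. diff_form i k) i j | i j. i < (j :: 'n::{finite,linorder})}"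
  by (auto simp: coxeter_A_def cquot.eq_hyperplane_def cquot.ker_on_def diff_form_diff)

lemma finite_coxeter_A: "finite (coxeter_A :: 'n::{finite,linorder} diag_quotient set set)"
proof -
  have eq: "coxeter_A = (\<lambda>(i, j). {v. diff_form i j v = 0}) ` {(i, j). i < (j :: 'n)}" by (auto simp: coxeter_A_def)
  show ?thesis unfolding eq by (rule finite_imageI) (rule finite)
qed

lemma cquot_arrangement:
  fixes k :: "'n::{finite,linorder}"
  shows "cquot.type_A_arrangement UNIV UNIV (\<lambda>i. diff_form i k) (\<lambda>_ _. m) (const_mult coxeter_A m)"
  unfolding cquot.type_A_arrangement_def
proof (intro conjI ballI impI)
  fix H :: "'n diag_quotient set" assume "H \<in># const_mult coxeter_A m"
  then have "H \<in> coxeter_A" by (auto simp: count_const_mult finite_coxeter_A simp flip: count_greater_zero_iff split: if_splits)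
  then obtain i j where "i < j" "H = cquot.eq_hyperplane UNIV (\<lambda>i. diff_form i k) i j" unfolding coxeter_A_eq[of k] by blast
  then show "\<exists>i\<in>UNIV. \<exists>j\<in>UNIV. i \<noteq> j \<and> H = cquot.eq_hyperplane UNIV (\<lambda>i. diff_form i k) i j"
    by (intro bexI[of _ i] bexI[of _ j]) auto
next
  fix i j :: 'n assume "i \<noteq> j"
  then have "cquot.eq_hyperplane UNIV (\<lambda>i. diff_form i k) i j \<in> coxeter_A"
    unfolding coxeter_A_eq[of k] by (rule ordered_pair_image[rotated]) (rule cquot.eq_hyperplane_commute)
  then show "count (const_mult coxeter_A m) (cquot.eq_hyperplane UNIV (\<lambda>i. diff_form i k) i j) = m"
    by (simp add: count_const_mult finite_coxeter_A)
qed

theorem theorem1p1: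
  fixes l m :: nat
  assumes "CARD('n::{finite,linorder}) = l" and "2 \<le> l" and "1 \<le> m"
  shows
    "cvec.defining_polynomial UNIV (const_mult (braid :: (complex ^ 'n::{finite,linorder}) set set) m)
       (\<lambda>x. \<Prod>(i, j)\<in>{(i, j). i < j}. (x $ i - x $ j) ^ m) \<and>
     cvec.inductively_free UNIV (const_mult (braid :: (complex ^ 'n::{finite,linorder}) set set) m) \<and>
     cquot.inductively_free UNIV (const_mult (coxeter_A :: 'n::{finite,linorder} diag_quotient set set) m) \<and>
     (even m \<longrightarrow>
        cquot.has_exponents UNIV (const_mult (coxeter_A :: 'n::{finite,linorder} diag_quotient set set) m)
          (replicate_mset (l - 1) (m * l div 2))) \<and>
     (odd m \<longrightarrow>
        cquot.has_exponents UNIV (const_mult (coxeter_A :: 'n::{finite,linorder} diag_quotient set set) m)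
          (image_mset (\<lambda>k. (m - 1) * l div 2 + k) (mset_set {1..l - 1})))"
proof -
  fix k :: 'n
  have "cquot.dim (UNIV :: 'n diag_quotient set) + 1 - CARD('n) = 0"
    using cquot_dim[where 'n = 'n] zero_less_card_finite[where 'a = 'n] by linarith
  note exps = cquot.constant_multiplicity_free[OF cquot_forms[of k] UNIV_not_empty cquot_arrangement[of k m], unfolded this]
  show ?thesis
    using braid_defining_polynomial[OF assms(3), where 'n = 'n] exps
      cvec.constant_multiplicity_free(1)[OF cvec_forms UNIV_not_empty cvec_arrangement, where 'n1 = 'n]
    by (simp add: assms(1))
qed

end
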